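(* Let $n\in\mathbb{N}$, let $m_1,\ldots,m_n\in\mathbb{N}\cup\{0\}$, and let $M_0\in\mathbb{N}\cup\{0\}$ be such that $\max_{k=1,\ldots,n}\frac{m_k}{k}\le M_0+2$. Let $\varphi$ be smoothly increasing and let $\omega$ be a radial weight. Let $a_{k,j}$ be analytic in the unit disc $\mathbb{D}$ for all $k=1,\ldots,n$ and $j=0,\ldots,m_k$, and consider the equation $$(E)\qquad (f')^n+\sum_{k=1}^{n}\left(\sum_{j=0}^{m_k}a_{k,j}f^j\right)(f')^{n-k}=0.$$ (i) If $a_{k,j}\in H^\infty_k$ (resp. $a_{k,j}\in H^\infty_{k,0}$) for all $j=0,\ldots,m_k$ and $k=1,\ldots,n$, then each meromorphic solution $f$ of $(E)$ in $\mathbb{D}$ belongs to $\mathcal{N}$ (resp. $\mathcal{N}_0$). (ii) If $a_{k,j}\in H^\infty_{\varphi^k}$ (resp. $a_{k,j}\in H^\infty_{\varphi^k,0}$) for all $j=0,\ldots,m_k$ and $k=1,\ldots,n$, then each meromorphic solution $f$ of $(E)$ in $\mathbb{D}$ belongs to $\mathcal{N}^\varphi$ (resp. $\mathcal{N}^\varphi_0$). (iii) If $a_{k,j}\in A^{2/k}_{\omega^\star}$ for all $j=0,\ldots,m_k$ and $k=1,\ldots,n$, then each meromorphic solution $f$ of $(E)$ in $\mathbb{D}$ belongs to $\mathcal{D}^\#_{\omega^\star}$. (iv) If $$\sup_{a\in\mathbb{D}}\int_{\mathbb{D}}|a_{k,j}(z)|^{\frac2k}\log\frac{1}{|\varphi_a(z)|}\,dA(z)<\infty$$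 for all $j=0,\ldots,m_k$ and $k=1,\ldots,n$, then each meromorphic solution $f$ of $(E)$ in $\mathbb{D}$ belongs to $\mathrm{UBC}$.
   Context: $\mathbb{D}=\{z\in\mathbb{C}:|z|<1\}$, $\mathbb{N}=\{1,2,\ldots\}$, $\mathcal{H}(\mathbb{D})$ and $\mathcal{M}(\mathbb{D})$ are the sets of analytic and meromorphic functions in $\mathbb{D}$, $dA(z)=r\,dr\,d\theta/\pi$ for $z=re^{i\theta}$, and $\varphi_a(z)=\frac{a-z}{1-\overline{a}z}$ for $a\in\mathbb{D}$. For $f\in\mathcal{M}(\mathbb{D})$, $f^{\#}=\frac{|f'|}{1+|f|^2}$ is the spherical derivative, extended continuously to the poles of $f$. Zeroth powers are identically $1$. A meromorphic solution is a meromorphic function in $\mathbb{D}$ satisfying the equation as an identity of meromorphic functions. An increasing function $\varphi:[0,1)\to(0,\infty)$ is smoothly increasing if $\varphi(r)(1-r)\to\infty$ as $r\to1^-$, and $$\frac{\varphi(|a+z/\varphi(|a|)|)}{\varphi(|a|)}\to1,\quad |a|\to1^-,$$ uniformly for $z$ in compact subsets of $\mathbb{C}$. A radial weight is a nonnegative function $\omega\in L^1(0,1)$ extended to $\mathbb{D}$ by $\omega(z)=\omega(|z|)$. For such $\omega$, $\omega^\star(z)=\int_{|z|}^1\omega(s)\log\frac{s}{|z|}\,s\,ds$ for $z\in\mathbb{D}\setminus\{0\}$. Spaces of analytic functions. For $0<p<\infty$, $H^\infty_p$ is the set of $g\in\mathcal{H}(\mathbb{D})$ with $\sup_{z\in\mathbb{D}}|g(z)|(1-|z|)^p<\infty$,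 and $H^\infty_{p,0}$ is the set of $g\in\mathcal{H}(\mathbb{D})$ with $|g(z)|(1-|z|)^p\to0$ as $|z|\to1^-$. For $\psi:[0,1)\to(0,\infty)$ (here $\psi=\varphi^k$, the $k$-th power of $\varphi$), $H^\infty_\psi$ is the set of $g\in\mathcal{H}(\mathbb{D})$ with $\sup_{z\in\mathbb{D}}\frac{|g(z)|}{\psi(|z|)}<\infty$, and $H^\infty_{\psi,0}$ is the set of $g\in\mathcal{H}(\mathbb{D})$ with $\frac{|g(z)|}{\psi(|z|)}\to0$ as $|z|\to1^-$. For $0<p<\infty$, $A^p_{\omega^\star}$ is the set of $g\in\mathcal{H}(\mathbb{D})$ with $\int_{\mathbb{D}}|g(z)|^p\omega^\star(z)\,dA(z)<\infty$. Classes of meromorphic functions. $\mathcal{N}$: $f\in\mathcal{M}(\mathbb{D})$ with $\sup_{z\in\mathbb{D}}f^\#(z)(1-|z|^2)<\infty$. $\mathcal{N}_0$: $f\in\mathcal{M}(\mathbb{D})$ with $f^\#(z)(1-|z|^2)\to0$ as $|z|\to1^-$. $\mathcal{N}^\varphi$: $f\in\mathcal{M}(\mathbb{D})$ with $\sup_{z\in\mathbb{D}}\frac{f^\#(z)}{\varphi(|z|)}<\infty$. $\mathcal{N}^\varphi_0$: $f\in\mathcal{M}(\mathbb{D})$ with $\frac{f^\#(z)}{\varphi(|z|)}\to0$ as $|z|\to1^-$. $\mathcal{D}^\#_{\omega^\star}$: $f\in\mathcal{M}(\mathbb{D})$ with $\int_{\mathbb{D}}f^\#(z)^2\omega^\star(z)\,dA(z)<\infty$.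 $\mathrm{UBC}$: $f\in\mathcal{M}(\mathbb{D})$ with $\sup_{a\in\mathbb{D}}\int_{\mathbb{D}}f^\#(z)^2\log\frac{1}{|\varphi_a(z)|}\,dA(z)<\infty$. *)

theory Defs
  imports "HOL-Complex_Analysis.Complex_Analysis"
begin

text \<open>The open unit disc is \<open>ball 0 1\<close>. A meromorphic function in the disc is any \<open>f\<close> with
  \<open>f meromorphic_on ball 0 1\<close>. The library leaves the values of such an \<open>f\<close> unspecified on a sparse
  set (in particular at poles), so the notions below depend on a meromorphic
  \<open>f\<close> only up to sparse sets.\<close>

text \<open>The limit \<open>|z| \<rightarrow> 1-\<close>.\<close>

definition to_unit_circle :: "complex filter" where
  "to_unit_circle = filtercomap norm (at_left (1::real))"

text \<open>Normalised area measure \<open>dA = r dr d\<theta> / \<pi>\<close>, and the disc automorphisms.\<close>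

definition area_measure :: "complex measure" where
  "area_measure = scale_measure (ennreal (1 / pi)) lborel"

definition disc_aut :: "complex \<Rightarrow> complex \<Rightarrow> complex" where
  "disc_aut a z = (a - z) / (1 - cnj a * z)"

text \<open>The spherical derivative. Taking the limit at every point gives the usual formula where \<open>f\<close> is
  analytic, and the continuous extension at the poles; see \<open>spherical_deriv_analytic\<close> and \<open>spherical_deriv_tendsto\<close>.\<close>

definition spherical_deriv :: "(complex \<Rightarrow> complex) \<Rightarrow> complex \<Rightarrow> real" where
  "spherical_deriv f z = Lim (at z) (\<lambda>w. norm (deriv f w) / (1 + (norm (f w))\<^sup>2))"

lemma analytic_at_imp_eventually_analytic:
  assumes "f analytic_on {w}"
  shows "eventually (\<lambda>x. f analytic_on {x}) (nhds w)"
proof -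
  obtain A where A: "open A" "w \<in> A" "f holomorphic_on A"
    using assms by (auto simp: analytic_at)
  then have "\<forall>x\<in>A. f analytic_on {x}"
    by (auto simp: analytic_at)
  with A show ?thesis
    by (auto simp: eventually_nhds)
qed

lemma analytic_spherical_tendsto:
  assumes "f analytic_on {z}"
  shows "((\<lambda>w. norm (deriv f w) / (1 + (norm (f w))\<^sup>2))
           \<longlongrightarrow> norm (deriv f z) / (1 + (norm (f z))\<^sup>2)) (at z)"
proof -
  have "isCont f z" "isCont (deriv f) z"
    using assms by (auto intro: analytic_at_imp_isCont analytic_deriv)
  then have "isCont (\<lambda>w. norm (deriv f w) / (1 + (norm (f w))\<^sup>2)) z"
    by (intro continuous_intros) (auto simp: add_nonneg_eq_0_iff)
  then show ?thesis
    by (simp add: isCont_def)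
qed

lemma spherical_deriv_analytic:
  assumes "f analytic_on {z}"
  shows "spherical_deriv f z = norm (deriv f z) / (1 + (norm (f z))\<^sup>2)"
  unfolding spherical_deriv_def
  using analytic_spherical_tendsto[OF assms] by (intro tendsto_Lim) auto

lemma spherical_deriv_tendsto:
  assumes "f meromorphic_on {z}"
  shows "((\<lambda>w. norm (deriv f w) / (1 + (norm (f w))\<^sup>2)) \<longlongrightarrow> spherical_deriv f z) (at z)"
proof -
  let ?S = "\<lambda>f w. norm (deriv f w) / (1 + (norm (f w))\<^sup>2)"
  have iso: "isolated_singularity_at f z" and ness: "not_essential f z"
    using assms by (auto simp: meromorphic_at_iff)
  have ev: "eventually (\<lambda>w. f analytic_on {w}) (at z)"
    using iso by (rule isolated_singularity_at_altdef[THEN iffD1])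
  have "\<exists>L. (?S f \<longlongrightarrow> L) (at z)"
  proof (cases "is_pole f z")
    case True
    define g where "g = remove_sings (\<lambda>w. inverse (f w))"
    have mg: "(\<lambda>w. inverse (f w)) meromorphic_on {z}"
      using assms by (intro meromorphic_intros)
    have lim: "((\<lambda>w. inverse (f w)) \<longlongrightarrow> 0) (at z)"
      using True filterlim_compose[OF tendsto_inverse_0] by (auto simp: is_pole_def)
    have an: "g analytic_on {z}"
      unfolding g_def using mg lim
      by (intro remove_sings_analytic_at) (auto simp: meromorphic_at_iff)
    have "eventually (\<lambda>w. f w \<noteq> 0) (at z)"
      using True non_zero_neighbour_pole by blast
    with ev have eq: "eventually (\<lambda>w. ?S g w = ?S f w) (at z)"
    proof eventually_elim
      case (elim w)
      have "(f \<longlongrightarrow> f w) (nhds w)"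
        using elim analytic_at_imp_isCont[of f w]
        by (simp add: isCont_def tendsto_at_iff_tendsto_nhds)
      then have "eventually (\<lambda>x. f x \<noteq> 0) (nhds w)"
        using elim by (intro tendsto_imp_eventually_ne) auto
      moreover have "eventually (\<lambda>x. f analytic_on {x}) (nhds w)"
        using elim by (simp add: analytic_at_imp_eventually_analytic)
      ultimately have "eventually (\<lambda>x. f x \<noteq> 0 \<and> f analytic_on {x}) (nhds w)"
        by (rule eventually_conj)
      then have "eventually (\<lambda>x. g x = inverse (f x)) (nhds w)"
        unfolding g_def by eventually_elim (auto intro!: remove_sings_at_analytic analytic_intros)
      then have 1: "deriv g w = deriv (\<lambda>x. inverse (f x)) w" and 2: "g w = inverse (f w)"
        by (auto intro: deriv_cong_ev dest: eventually_nhds_x_imp_x)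
      have "(f has_field_derivative deriv f w) (at w)"
        using elim analytic_derivI by blast
      then have 3: "deriv g w = - (inverse (f w) * deriv f w * inverse (f w))"
        unfolding 1 using elim by (intro DERIV_imp_deriv DERIV_inverse')
      have alg: "d / (x * x) / (1 + 1 / x\<^sup>2) = d / (1 + x\<^sup>2)" if "x > 0" for d x :: real
      proof -
        have "x * x * (1 + 1 / x\<^sup>2) = 1 + x\<^sup>2"
          using that by (simp add: field_simps power2_eq_square)
        then show ?thesis
          by (metis divide_divide_eq_left)
      qed
      have "norm (deriv g w) = norm (deriv f w) / (norm (f w) * norm (f w))"
        unfolding 3 by (simp only: norm_minus_cancel norm_mult norm_inverse) (simp add: divide_simps)
      moreover have "(norm (g w))\<^sup>2 = 1 / (norm (f w))\<^sup>2"
        unfolding 2 by (simp add: norm_inverse power_inverse divide_inverse)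
      ultimately show ?case
        using alg[of "norm (f w)" "norm (deriv f w)"] elim by simp
    qed
    show ?thesis
      using Lim_transform_eventually[OF analytic_spherical_tendsto[OF an] eq] by (rule exI)
  next
    case False
    then obtain c where "(f \<longlongrightarrow> c) (at z)"
      using ness by (auto simp: not_essential_def)
    then have an: "remove_sings f analytic_on {z}"
      using iso by (intro remove_sings_analytic_at)
    have eq: "eventually (\<lambda>w. ?S (remove_sings f) w = ?S f w) (at z)"
      using ev
    proof eventually_elim
      case (elim w)
      have "eventually (\<lambda>x. f analytic_on {x}) (nhds w)"
        using elim by (simp add: analytic_at_imp_eventually_analytic)
      then have "eventually (\<lambda>x. remove_sings f x = f x) (nhds w)"
        by eventually_elim simp
      then show ?case
        using elim by (simp add: deriv_cong_ev)
    qed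
    show ?thesis
      using Lim_transform_eventually[OF analytic_spherical_tendsto[OF an] eq] by (rule exI)
  qed
  then obtain L where "(?S f \<longlongrightarrow> L) (at z)" ..
  moreover from this have "spherical_deriv f z = L"
    unfolding spherical_deriv_def by (intro tendsto_Lim) auto
  ultimately show ?thesis
    by simp
qed

text \<open>Functions on \<open>[0,1)\<close> and \<open>(0,1)\<close> are total functions whose values elsewhere are irrelevant. In
  \<open>smoothly_increasing\<close> the argument of \<open>\<phi>\<close> in the numerator lies in \<open>[0,1)\<close> once \<open>norm a\<close> is close
  enough to 1, because of the growth condition.\<close>

definition smoothly_increasing :: "(real \<Rightarrow> real) \<Rightarrow> bool" where
  "smoothly_increasing \<phi> \<longleftrightarrow>
     (\<forall>r\<in>{0..<1}. \<phi> r > 0) \<and> mono_on {0..<1} \<phi> \<and>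
     filterlim (\<lambda>r. \<phi> r * (1 - r)) at_top (at_left 1) \<and>
     (\<forall>K. compact K \<longrightarrow>
        uniform_limit K
          (\<lambda>a z. \<phi> (norm (a + z / complex_of_real (\<phi> (norm a)))) / \<phi> (norm a))
          (\<lambda>_. 1) to_unit_circle)"

definition radial_weight :: "(real \<Rightarrow> real) \<Rightarrow> bool" where
  "radial_weight \<omega> \<longleftrightarrow> (\<forall>s\<in>{0<..<1}. \<omega> s \<ge> 0) \<and> \<omega> absolutely_integrable_on {0<..<1}"

text \<open>The value at \<open>z = 0\<close> (where \<open>\<omega>\<^sup>\<star>\<close> is undefined) is irrelevant: \<open>\<omega>\<^sup>\<star>\<close> is only
  integrated against area measure.\<close>

definition weight_star :: "(real \<Rightarrow> real) \<Rightarrow> complex \<Rightarrow> real" where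
  "weight_star \<omega> z = (LINT s:{norm z<..<1}|lebesgue. \<omega> s * ln (s / norm z) * s)"

definition Hinf :: "real \<Rightarrow> (complex \<Rightarrow> complex) set" where
  "Hinf p = {g. g holomorphic_on ball 0 1 \<and>
     bdd_above ((\<lambda>z. norm (g z) * (1 - norm z) powr p) ` ball 0 1)}"

definition Hinf_0 :: "real \<Rightarrow> (complex \<Rightarrow> complex) set" where
  "Hinf_0 p = {g. g holomorphic_on ball 0 1 \<and>
     ((\<lambda>z. norm (g z) * (1 - norm z) powr p) \<longlongrightarrow> 0) to_unit_circle}"

definition Hinf_growth :: "(real \<Rightarrow> real) \<Rightarrow> (complex \<Rightarrow> complex) set" where
  "Hinf_growth \<psi> = {g. g holomorphic_on ball 0 1 \<and>
     bdd_above ((\<lambda>z. norm (g z) / \<psi> (norm z)) ` ball 0 1)}"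

definition Hinf_growth_0 :: "(real \<Rightarrow> real) \<Rightarrow> (complex \<Rightarrow> complex) set" where
  "Hinf_growth_0 \<psi> = {g. g holomorphic_on ball 0 1 \<and>
     ((\<lambda>z. norm (g z) / \<psi> (norm z)) \<longlongrightarrow> 0) to_unit_circle}"

definition weighted_bergman :: "real \<Rightarrow> (complex \<Rightarrow> real) \<Rightarrow> (complex \<Rightarrow> complex) set" where
  "weighted_bergman p w = {g. g holomorphic_on ball 0 1 \<and>
     (\<integral>\<^sup>+z\<in>ball 0 1. ennreal (norm (g z) powr p * w z) \<partial>area_measure) < \<infinity>}"

definition normal_fns :: "(complex \<Rightarrow> complex) set" where
  "normal_fns = {f. f meromorphic_on ball 0 1 \<and>
     bdd_above ((\<lambda>z. spherical_deriv f z * (1 - (norm z)\<^sup>2)) ` ball 0 1)}"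

definition normal_fns_0 :: "(complex \<Rightarrow> complex) set" where
  "normal_fns_0 = {f. f meromorphic_on ball 0 1 \<and>
     ((\<lambda>z. spherical_deriv f z * (1 - (norm z)\<^sup>2)) \<longlongrightarrow> 0) to_unit_circle}"

definition phi_normal_fns :: "(real \<Rightarrow> real) \<Rightarrow> (complex \<Rightarrow> complex) set" where
  "phi_normal_fns \<phi> = {f. f meromorphic_on ball 0 1 \<and>
     bdd_above ((\<lambda>z. spherical_deriv f z / \<phi> (norm z)) ` ball 0 1)}"

definition phi_normal_fns_0 :: "(real \<Rightarrow> real) \<Rightarrow> (complex \<Rightarrow> complex) set" where
  "phi_normal_fns_0 \<phi> = {f. f meromorphic_on ball 0 1 \<and>
     ((\<lambda>z. spherical_deriv f z / \<phi> (norm z)) \<longlongrightarrow> 0) to_unit_circle}"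

definition spherical_dirichlet :: "(complex \<Rightarrow> real) \<Rightarrow> (complex \<Rightarrow> complex) set" where
  "spherical_dirichlet w = {f. f meromorphic_on ball 0 1 \<and>
     (\<integral>\<^sup>+z\<in>ball 0 1. ennreal ((spherical_deriv f z)\<^sup>2 * w z) \<partial>area_measure) < \<infinity>}"

text \<open>In the integrals with \<open>ln (1 / norm (disc_aut a z))\<close>, the single point \<open>z = a\<close> is a null set.\<close>

definition UBC :: "(complex \<Rightarrow> complex) set" where
  "UBC = {f. f meromorphic_on ball 0 1 \<and>
     (SUP a\<in>ball 0 1. \<integral>\<^sup>+z\<in>ball 0 1.
        ennreal ((spherical_deriv f z)\<^sup>2 * ln (1 / norm (disc_aut a z))) \<partial>area_measure) < \<infinity>}"

text \<open>Meromorphic solutions of \<open>(f')^n + (\<Sum>k=1..n. (\<Sum>j=0..m k. a k j * f^j) * (f')^(n-k)) = 0\<close>. Equality of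
  meromorphic functions means equality outside a sparse subset of the disc, expressed by
  \<open>\<forall>\<^sub>\<approx>\<close>.\<close>

definition meromorphic_solution ::
  "nat \<Rightarrow> (nat \<Rightarrow> nat) \<Rightarrow> (nat \<Rightarrow> nat \<Rightarrow> complex \<Rightarrow> complex) \<Rightarrow> (complex \<Rightarrow> complex) \<Rightarrow> bool" where
  "meromorphic_solution n m a f \<longleftrightarrow>
     f meromorphic_on ball 0 1 \<and>
     (\<forall>\<^sub>\<approx>z\<in>ball 0 1.
        deriv f z ^ n + (\<Sum>k=1..n. (\<Sum>j=0..m k. a k j z * f z ^ j) * deriv f z ^ (n - k)) = 0)"

end

theory Submission
  imports Defs
begin

text \<open>With \<open>N = M\<^sub>0 + 1\<close> and \<open>F = f ^ N\<close>, multiplying the equation by \<open>|f| ^ (n * M\<^sub>0)\<close> and dividing by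
  \<open>(1 + |f| ^ (2 * N)) ^ n\<close> bounds the spherical derivative of \<open>F\<close> pointwise by a constant times
  \<open>\<Sum> |a k j| powr (1 / k)\<close>. It remains to pass from \<open>F\<close> to \<open>f\<close>. For the growth conditions this is local:
  if the spherical derivative of \<open>F\<close> is controlled on a disc, then \<open>f\<close> or \<open>1 / f\<close> is bounded on a smaller disc and
  Cauchy's estimate applies. For the integral conditions, \<open>N ln (1 + |f|\<^sup>2) - ln (1 + |F|\<^sup>2)\<close> is a
  bounded smooth function (also at the poles) whose Laplacian is four times the difference of \<open>N\<close> times
  the squared spherical derivative of \<open>f\<close> and that of \<open>F\<close>; Green's formula then bounds the energy of \<open>f\<close>
  against \<open>ln (s / |disc_aut b z|)\<close> by that of \<open>F\<close> up to a constant independent of \<open>b\<close> and \<open>s\<close>. Integrating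
  over \<open>s\<close> gives the weights \<open>\<omega>\<^sup>\<star>\<close>.\<close>

text \<open>Dividing the equation by powers of 1 + |f|^2 would absorb f^j only for j \<le> 2k. The
  price is the factor |f|^(N-1): for N > 1 the spherical derivative of F vanishes at every zero and
  pole of f, whatever that of f is there. No comparison at a single point is possible, so
  information must come from a neighbourhood (growth conditions) or from an average (integral
  conditions). In the second case the error depends only on the bound of the potential difference: N
  ln (1 + |f|^2) and ln (1 + |F|^2) are both within N ln 2 of N ln max(1, |f|^2). Such an error can
  be integrated against the finite weight and survives the supremum over b. Poles are never treated
  separately: f and 1/f have the same spherical derivative, and \<open>inverse 0 = 0\<close> gives
  both the value 0 at a pole.\<close>

section \<open>Maps into the Riemann sphere\<close>

text \<open>Analyticity as a map into the Riemann sphere, where the point at infinity is represented by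
  the value \<open>0 = inverse 0\<close>, as in \<^const>\<open>nicely_meromorphic_on\<close>.\<close>

definition sphere_analytic_on :: "(complex \<Rightarrow> complex) \<Rightarrow> complex set \<Rightarrow> bool" where
  "sphere_analytic_on f S \<longleftrightarrow>
     (\<forall>z\<in>S. f analytic_on {z} \<or> (\<lambda>w. inverse (f w)) analytic_on {z})"

lemma sphere_analytic_on_inverse [simp]:
  "sphere_analytic_on (\<lambda>w. inverse (f w)) S \<longleftrightarrow> sphere_analytic_on f S"
  by (auto simp: sphere_analytic_on_def)

lemma sphere_analytic_on_subset:
  "sphere_analytic_on f S \<Longrightarrow> T \<subseteq> S \<Longrightarrow> sphere_analytic_on f T"
  by (auto simp: sphere_analytic_on_def)

lemma sphere_analytic_on_power:
  assumes "sphere_analytic_on f S"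
  shows "sphere_analytic_on (\<lambda>w. f w ^ N) S"
proof -
  have "(\<lambda>w. inverse (f w) ^ N) analytic_on {z}" if "(\<lambda>w. inverse (f w)) analytic_on {z}" for z
    using that by (rule analytic_on_power)
  then show ?thesis
    using assms by (auto simp: sphere_analytic_on_def power_inverse intro: analytic_on_power)
qed

text \<open>At a pole the convention gives \<open>f z = 0\<close>, hence
  \<open>inverse (f z) = 0\<close>, which is also the limit of 1/f. So 1/f is continuous there, and
  a meromorphic function that is continuous at a point is analytic at it.\<close>

lemma nicely_meromorphic_imp_sphere_analytic:
  assumes "f nicely_meromorphic_on S"
  shows "sphere_analytic_on f S"
  unfolding sphere_analytic_on_def
proof
  fix z assume z: "z \<in> S"
  show "f analytic_on {z} \<or> (\<lambda>w. inverse (f w)) analytic_on {z}"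
  proof (cases "is_pole f z")
    case False
    then show ?thesis
      using nicely_meromorphic_on_imp_analytic_at[OF assms z] by blast
  next
    case True
    then have "f z = 0"
      using assms z not_tendsto_and_filterlim_at_infinity[of "at z" f "f z"]
      by (auto simp: nicely_meromorphic_on_def is_pole_def)
    moreover have "((\<lambda>w. inverse (f w)) \<longlongrightarrow> 0) (at z)"
      using True filterlim_compose[OF tendsto_inverse_0] by (auto simp: is_pole_def)
    ultimately have "isCont (\<lambda>w. inverse (f w)) z"
      by (simp add: isCont_def)
    moreover have "f meromorphic_on {z}"
      using assms z meromorphic_on_subset[of f S "{z}"] by (auto simp: nicely_meromorphic_on_def)
    then have "(\<lambda>w. inverse (f w)) meromorphic_on {z}"
      by (intro meromorphic_intros)
    ultimately show ?thesis
      by (auto intro: meromorphic_at_isCont_imp_analytic)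
  qed
qed

text \<open>Needed for derivatives: \<open>deriv f w\<close> depends on a neighbourhood of
  \<open>w\<close>, so a property that holds near but off \<open>z\<close> has to be turned into one
  that holds around each nearby \<open>w\<close>.\<close>

lemma eventually_at_imp_eventually_nhds:
  assumes "eventually P (at (z :: 'a :: t1_space))"
  shows "eventually (\<lambda>w. eventually P (nhds w)) (at z)"
proof -
  obtain S where S: "open S" "z \<in> S" "\<forall>w\<in>S. w \<noteq> z \<longrightarrow> P w"
    using assms by (auto simp: eventually_at_topological)
  have "eventually P (nhds w)" if "w \<in> S" "w \<noteq> z" for w
    unfolding eventually_nhds using S that by (intro exI[of _ "S - {z}"]) auto
  then show ?thesis
    using S by (auto simp: eventually_at_topological)
qed

lemma spherical_deriv_cong:
  assumes "eventually (\<lambda>w. f w = g w) (at z)"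
  shows "spherical_deriv f z = spherical_deriv g z"
proof -
  have "eventually (\<lambda>w. norm (deriv f w) / (1 + (norm (f w))\<^sup>2) = norm (deriv g w) / (1 + (norm (g w))\<^sup>2)) (at z)"
    using eventually_at_imp_eventually_nhds[OF assms]
  proof eventually_elim
    case (elim w)
    then have "deriv f w = deriv g w" "f w = g w"
      by (auto intro: deriv_cong_ev dest: eventually_nhds_x_imp_x)
    then show ?case
      by simp
  qed
  \<comment> \<open>Stated for every \<open>l\<close>, so that the two \<open>Lim\<close> terms
    agree as descriptions, whether or not the limit exists.\<close>
  then have "((\<lambda>w. norm (deriv f w) / (1 + (norm (f w))\<^sup>2)) \<longlongrightarrow> l) (at z) \<longleftrightarrow>
             ((\<lambda>w. norm (deriv g w) / (1 + (norm (g w))\<^sup>2)) \<longlongrightarrow> l) (at z)" for l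
    by (rule tendsto_cong)
  then show ?thesis
    by (simp add: spherical_deriv_def Topological_Spaces.Lim_def)
qed

lemma spherical_quotient_inverse:
  assumes "f analytic_on {w}" "f w \<noteq> 0"
  shows "norm (deriv (\<lambda>x. inverse (f x)) w) / (1 + (norm (inverse (f w)))\<^sup>2) =
         norm (deriv f w) / (1 + (norm (f w))\<^sup>2)"
proof -
  have "(f has_field_derivative deriv f w) (at w)"
    using assms analytic_derivI by blast
  then have d: "deriv (\<lambda>x. inverse (f x)) w = - (inverse (f w) * deriv f w * inverse (f w))"
    using assms by (intro DERIV_imp_deriv DERIV_inverse')
  have "norm (deriv (\<lambda>x. inverse (f x)) w) = norm (deriv f w) / (norm (f w))\<^sup>2"
    unfolding d by (simp only: norm_minus_cancel norm_mult norm_inverse)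
      (simp add: power2_eq_square divide_simps)
  moreover have "(norm (f w))\<^sup>2 * (1 + (norm (inverse (f w)))\<^sup>2) = 1 + (norm (f w))\<^sup>2"
    using assms by (simp add: norm_divide power_divide field_simps)
  ultimately show ?thesis
    by (metis divide_divide_eq_left)
qed

text \<open>Inversion is an isometry of the sphere. Passing to 1/f therefore lets later arguments
  assume that the function is analytic and of modulus at most 1 at the point considered.\<close>

lemma spherical_deriv_inverse:
  assumes "sphere_analytic_on f {z}"
  shows "spherical_deriv (\<lambda>w. inverse (f w)) z = spherical_deriv f z"
proof -
  have *: "spherical_deriv (\<lambda>w. inverse (f w)) z = spherical_deriv f z" if "f analytic_on {z}" for f
  proof (cases "eventually (\<lambda>w. f w \<noteq> 0) (at z)")
    case True
    have ev: "eventually (\<lambda>w. norm (deriv f w) / (1 + (norm (f w))\<^sup>2) =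
        norm (deriv (\<lambda>x. inverse (f x)) w) / (1 + (norm (inverse (f w)))\<^sup>2)) (at z)"
      using True analytic_at_imp_eventually_analytic[OF that, THEN filter_leD[OF at_within_le_nhds]]
      by eventually_elim (simp add: spherical_quotient_inverse)
    have "((\<lambda>w. norm (deriv (\<lambda>x. inverse (f x)) w) / (1 + (norm (inverse (f w)))\<^sup>2))
            \<longlongrightarrow> spherical_deriv f z) (at z)"
      using Lim_transform_eventually[OF analytic_spherical_tendsto[OF that] ev]
      by (simp add: spherical_deriv_analytic that)
    then show ?thesis
      unfolding spherical_deriv_def[of "\<lambda>w. inverse (f w)"] by (intro tendsto_Lim) auto
  next
    case False
    then have "eventually (\<lambda>w. f w = 0) (at z)"
      using that by (intro not_essential_frequently_0_imp_eventually_0)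
        (auto simp: isolated_singularity_at_analytic not_essential_analytic frequently_def)
    \<comment> \<open>Here \<open>f\<close> vanishes identically near \<open>z\<close>, and
      \<open>inverse 0 = 0\<close> makes 1/f the same function.\<close>
    then have "eventually (\<lambda>w. inverse (f w) = f w) (at z)"
      by eventually_elim simp
    then show ?thesis
      by (rule spherical_deriv_cong)
  qed
  show ?thesis
    using assms *[of f] *[of "\<lambda>w. inverse (f w)"] by (auto simp: sphere_analytic_on_def)
qed

lemma deriv_power_analytic:
  assumes "f analytic_on {z}"
  shows "deriv (\<lambda>w. f w ^ N) z = of_nat N * f z ^ (N - 1) * deriv f z"
proof -
  have "(f has_field_derivative deriv f z) (at z)"
    using assms analytic_derivI by blast
  then have "((\<lambda>w. f w ^ N) has_field_derivative of_nat N * (deriv f z * f z ^ (N - 1))) (at z)"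
    by (rule DERIV_power[THEN DERIV_cong]) simp
  then show ?thesis
    by (simp add: DERIV_imp_deriv mult_ac)
qed

lemma spherical_deriv_nonneg_analytic:
  assumes "sphere_analytic_on f {z}"
  shows "spherical_deriv f z \<ge> 0"
proof -
  have "spherical_deriv g z \<ge> 0" if "g analytic_on {z}" for g
    using that by (simp add: spherical_deriv_analytic)
  from this[of f] this[of "\<lambda>w. inverse (f w)"] show ?thesis
    using assms spherical_deriv_inverse[OF assms] by (auto simp: sphere_analytic_on_def)
qed

lemma spherical_deriv_isCont:
  assumes "sphere_analytic_on f {z}"
  shows "isCont (spherical_deriv f) z"
proof -
  have *: "isCont (spherical_deriv g) z" if "g analytic_on {z}" for g
  proof -
    have "eventually (\<lambda>w. norm (deriv g w) / (1 + (norm (g w))\<^sup>2) = spherical_deriv g w) (nhds z)"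
      using analytic_at_imp_eventually_analytic[OF that]
      by eventually_elim (simp add: spherical_deriv_analytic)
    moreover have "isCont (\<lambda>w. norm (deriv g w) / (1 + (norm (g w))\<^sup>2)) z"
      using analytic_spherical_tendsto[OF that] by (simp add: isCont_def)
    ultimately show ?thesis
      using isCont_cong by fastforce
  qed
  have sph: "eventually (\<lambda>w. sphere_analytic_on f {w}) (nhds z)"
  proof -
    have "eventually (\<lambda>w. sphere_analytic_on g {w}) (nhds z)" if "g analytic_on {z}" for g
      using analytic_at_imp_eventually_analytic[OF that]
      by eventually_elim (simp add: sphere_analytic_on_def)
    from this[of f] this[of "\<lambda>w. inverse (f w)"] show ?thesis
      using assms by (auto simp: sphere_analytic_on_def[of _ "{z}"])
  qed
  show ?thesis
  proof (cases "f analytic_on {z}")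
    case True
    then show ?thesis by (rule *)
  next
    case False
    then have "isCont (spherical_deriv (\<lambda>w. inverse (f w))) z"
      using assms * by (auto simp: sphere_analytic_on_def)
    moreover have "eventually (\<lambda>w. spherical_deriv (\<lambda>w. inverse (f w)) w = spherical_deriv f w) (nhds z)"
      using sph by eventually_elim (rule spherical_deriv_inverse)
    ultimately show ?thesis
      using isCont_cong by fastforce
  qed
qed

text \<open>Pigeonhole: one of the n terms is at least x^n / n, and x^(n-k) cancels. This is the
  classical bound for the roots of a polynomial by its coefficients.\<close>

lemma exists_power_le_of_power_le_sum:
  fixes x :: real and A :: "nat \<Rightarrow> real"
  assumes "n \<ge> 1" "x \<ge> 0" "\<And>k. A k \<ge> 0" "x ^ n \<le> (\<Sum>k=1..n. A k * x ^ (n - k))"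
  shows "\<exists>k\<in>{1..n}. x ^ k \<le> real n * A k"
proof (rule ccontr)
  assume "\<not> ?thesis"
  then have *: "real n * A k < x ^ k" if "k \<in> {1..n}" for k
    using that by force
  \<comment> \<open>Positivity, from the negated claim at k = 1, keeps the inequality strict after
    multiplication by \<open>x ^ (n - k)\<close>.\<close>
  have "x > 0"
  proof -
    have "0 \<le> real n * A 1"
      using assms(3) by simp
    also have "\<dots> < x ^ 1"
      using assms(1) by (intro *) auto
    finally show ?thesis
      by simp
  qed
  have "real n * x ^ n \<le> (\<Sum>k=1..n. real n * (A k * x ^ (n - k)))"
    unfolding sum_distrib_left[symmetric] using assms(4) by (simp add: mult_left_mono)
  also have "\<dots> < (\<Sum>k=1..n. x ^ n)"
  proof (rule sum_strict_mono)
    fix k assume k: "k \<in> {1..n}"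
    then have "real n * A k * x ^ (n - k) < x ^ k * x ^ (n - k)"
      using * \<open>x > 0\<close> by simp
    also have "\<dots> = x ^ n"
      using k by (simp flip: power_add)
    finally show "real n * (A k * x ^ (n - k)) < x ^ n"
      by (simp add: mult_ac)
  qed (use assms in auto)
  finally show False
    by simp
qed

section \<open>The pointwise estimate\<close>

lemma power_le_one_plus_power:
  fixes y :: real
  assumes "y \<ge> 0" "i \<le> k * (2 * N)"
  shows "y ^ i \<le> (1 + y ^ (2 * N)) ^ k"
proof (cases "y \<le> 1")
  case True
  then have "y ^ i \<le> 1"
    using assms by (simp add: power_le_one)
  also have "1 \<le> (1 + y ^ (2 * N)) ^ k"
    using assms by (intro one_le_power) simp
  finally show ?thesis .
next
  case False
  then have "y ^ i \<le> y ^ (k * (2 * N))"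
    using assms by (intro power_increasing) auto
  also have "\<dots> = (y ^ (2 * N)) ^ k"
    using power_mult[of y "2 * N" k] by (simp only: mult.commute)
  also have "\<dots> \<le> (1 + y ^ (2 * N)) ^ k"
    using assms by (intro power_mono) auto
  finally show ?thesis .
qed

text \<open>Multiplying the equation by \<open>|y| ^ (M * n)\<close> makes the degrees \<open>k (M + 2)\<close> admissible.\<close>

lemma equation_bound:
  fixes d y :: complex and c :: "nat \<Rightarrow> nat \<Rightarrow> complex"
  assumes n: "n \<ge> 1" and m: "\<And>k. k \<in> {1..n} \<Longrightarrow> m k \<le> k * (M + 2)"
    and eq: "d ^ n + (\<Sum>k=1..n. (\<Sum>j=0..m k. c k j * y ^ j) * d ^ (n - k)) = 0"
  shows "norm d * norm y ^ M / (1 + norm y ^ (2 * Suc M)) \<le>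
    real (n * (\<Sum>k=1..n. m k + 1)) * (\<Sum>k=1..n. \<Sum>j=0..m k. root k (norm (c k j)))"
proof -
  \<comment> \<open>With \<open>y\<close> for f and \<open>d\<close> for f',
    \<open>t * norm d\<close> is the spherical derivative of f^(M+1) up to the constant M + 1.
    Multiplying the equation by t^n leaves t^k for the coefficient of index k.\<close>
  define t where "t = norm y ^ M / (1 + norm y ^ (2 * Suc M))"
  define x where "x = t * norm d"
  define A where "A k = (\<Sum>j=0..m k. norm (c k j))" for k
  have pos: "1 + norm y ^ (2 * Suc M) > 0"
    by (intro add_pos_nonneg) auto
  have t: "t \<ge> 0"
    unfolding t_def using pos by (intro divide_nonneg_pos) auto
  have A: "A k \<ge> 0" for k
    by (simp add: A_def sum_nonneg)
  \<comment> \<open>The degree condition enters here: k M + j \<le> 2 k (M + 1) is the same as j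
    \<le> k (M + 2).\<close>
  have tk: "t ^ k * norm y ^ j \<le> 1" if "k \<in> {1..n}" "j \<le> m k" for j k
  proof -
    have "norm y ^ (k * M + j) \<le> (1 + norm y ^ (2 * Suc M)) ^ k"
      using m[OF that(1)] that(2) by (intro power_le_one_plus_power) (auto simp: algebra_simps)
    moreover have "t ^ k * norm y ^ j = norm y ^ (k * M + j) / (1 + norm y ^ (2 * Suc M)) ^ k"
      by (simp add: t_def power_divide power_add power_mult[symmetric] mult.commute)
    ultimately show ?thesis
      using pos by (simp del: power_Suc)
  qed
  have "norm d ^ n = norm (\<Sum>k=1..n. (\<Sum>j=0..m k. c k j * y ^ j) * d ^ (n - k))"
    unfolding norm_power[symmetric] using eq
    by (subst norm_minus_cancel[symmetric]) (simp only: minus_unique)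
  also have "\<dots> \<le> (\<Sum>k=1..n. (\<Sum>j=0..m k. norm (c k j) * norm y ^ j) * norm d ^ (n - k))"
  proof (rule sum_norm_le)
    fix k assume "k \<in> {1..n}"
    have "norm (\<Sum>j=0..m k. c k j * y ^ j) \<le> (\<Sum>j=0..m k. norm (c k j) * norm y ^ j)"
      by (rule sum_norm_le) (simp add: norm_mult norm_power)
    then show "norm ((\<Sum>j=0..m k. c k j * y ^ j) * d ^ (n - k)) \<le>
        (\<Sum>j=0..m k. norm (c k j) * norm y ^ j) * norm d ^ (n - k)"
      by (simp only: norm_mult norm_power) (rule mult_right_mono, auto)
  qed
  finally have "t ^ n * norm d ^ n \<le>
      t ^ n * (\<Sum>k=1..n. (\<Sum>j=0..m k. norm (c k j) * norm y ^ j) * norm d ^ (n - k))"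
    using t by (simp add: mult_left_mono)
  also have "\<dots> \<le> (\<Sum>k=1..n. A k * x ^ (n - k))"
    unfolding sum_distrib_left
  proof (rule sum_mono)
    fix k assume k: "k \<in> {1..n}"
    have "t ^ k * (\<Sum>j=0..m k. norm (c k j) * norm y ^ j) \<le> A k"
      unfolding A_def sum_distrib_left
    proof (rule sum_mono)
      fix j assume "j \<in> {0..m k}"
      then have "norm (c k j) * (t ^ k * norm y ^ j) \<le> norm (c k j) * 1"
        using tk[OF k] by (intro mult_left_mono) auto
      then show "t ^ k * (norm (c k j) * norm y ^ j) \<le> norm (c k j)"
        by (simp add: mult_ac)
    qed
    then have "(t ^ k * (\<Sum>j=0..m k. norm (c k j) * norm y ^ j)) * x ^ (n - k) \<le> A k * x ^ (n - k)"
      using t by (intro mult_right_mono) (auto simp: x_def)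
    moreover have "t ^ n = t ^ k * t ^ (n - k)"
      using k by (simp flip: power_add)
    ultimately show "t ^ n * ((\<Sum>j=0..m k. norm (c k j) * norm y ^ j) * norm d ^ (n - k)) \<le> A k * x ^ (n - k)"
      by (simp add: x_def power_mult_distrib mult_ac)
  qed
  finally have "x ^ n \<le> (\<Sum>k=1..n. A k * x ^ (n - k))"
    by (simp add: x_def power_mult_distrib)
  then obtain k where k: "k \<in> {1..n}" "x ^ k \<le> real n * A k"
    using exists_power_le_of_power_le_sum[of n x A] n A t by (auto simp: x_def)
  have x0: "x \<ge> 0"
    using t by (simp add: x_def)
  define S where "S = (\<Sum>j=0..m k. root k (norm (c k j)))"
  have S0: "S \<ge> 0"
    unfolding S_def by (intro sum_nonneg real_root_pos_pos_le) simp
  have "norm (c k j) \<le> S ^ k" if "j \<in> {0..m k}" for j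
  proof -
    have "root k (norm (c k j)) \<le> S"
      unfolding S_def using that
      by (intro member_le_sum[where f = "\<lambda>j. root k (norm (c k j))"]) (auto intro!: real_root_pos_pos_le)
    then have "root k (norm (c k j)) ^ k \<le> S ^ k"
      by (intro power_mono real_root_pos_pos_le) auto
    then show ?thesis
      using k by simp
  qed
  then have "A k \<le> real (m k + 1) * S ^ k"
    unfolding A_def using sum_bounded_above[of "{0..m k}" "\<lambda>j. norm (c k j)" "S ^ k"] by simp
  then have "x ^ k \<le> real (n * (m k + 1)) * S ^ k"
    using k(2) order_trans mult_left_mono[OF _ of_nat_0_le_iff] unfolding of_nat_mult mult.assoc by blast
  \<comment> \<open>The constant is at least 1, so it may be raised to the power k; the k-th root
    can then be taken of the whole product.\<close>
  also have "\<dots> \<le> real (n * (m k + 1)) ^ k * S ^ k"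
    using k n S0 by (intro mult_right_mono self_le_power) (auto simp del: of_nat_mult simp: Suc_le_eq)
  also have "\<dots> = (real (n * (m k + 1)) * S) ^ k"
    by (simp add: power_mult_distrib)
  finally have "x \<le> real (n * (m k + 1)) * S"
    using k S0 by (subst (asm) power_mono_iff) (auto simp: x0)
  \<comment> \<open>The index \<open>k\<close> found by the pigeonhole varies with the point, hence
    the enlargement to a bound without it.\<close>
  also have "\<dots> \<le> real (n * (\<Sum>k=1..n. m k + 1)) * (\<Sum>k=1..n. \<Sum>j=0..m k. root k (norm (c k j)))"
  proof (rule mult_mono)
    have "m k + 1 \<le> (\<Sum>k=1..n. m k + 1)"
      using k by (intro member_le_sum) auto
    then show "real (n * (m k + 1)) \<le> real (n * (\<Sum>k=1..n. m k + 1))"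
      by (intro of_nat_mono mult_le_mono2)
    show "S \<le> (\<Sum>k=1..n. \<Sum>j=0..m k. root k (norm (c k j)))"
      unfolding S_def using k
      by (intro member_le_sum[where f = "\<lambda>k. \<Sum>j=0..m k. root k (norm (c k j))"])
        (auto intro!: sum_nonneg real_root_pos_pos_le)
  qed (simp_all only: of_nat_0_le_iff S0)
  finally show ?thesis
    by (simp add: x_def t_def mult_ac)
qed

text \<open>The equation holds only off a sparse set, so the pointwise estimate is applied on a
  punctured neighbourhood and passed to the limit. Continuity of the coefficients carries it to the
  exceptional points and the poles.\<close>

lemma meromorphic_solution_spherical_deriv_bound:
  assumes n: "n \<ge> 1" and m: "\<And>k. k \<in> {1..n} \<Longrightarrow> m k \<le> k * (M + 2)"
    and a: "\<And>k j. k \<in> {1..n} \<Longrightarrow> j \<in> {0..m k} \<Longrightarrow> a k j holomorphic_on ball 0 1"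
    and sol: "meromorphic_solution n m a f" and z: "z \<in> ball 0 1"
  shows "spherical_deriv (\<lambda>w. f w ^ Suc M) z \<le>
    real (Suc M) * real (n * (\<Sum>k=1..n. m k + 1)) * (\<Sum>k=1..n. \<Sum>j=0..m k. root k (norm (a k j z)))"
    (is "_ \<le> ?C * ?R z")
proof (rule tendsto_le)
  have f: "f meromorphic_on {z}" 
    using sol z by (auto simp: meromorphic_solution_def intro: meromorphic_on_subset)
  then have "(\<lambda>w. f w ^ Suc M) meromorphic_on {z}"
    by (intro meromorphic_intros)
  then show "((\<lambda>w. norm (deriv (\<lambda>w. f w ^ Suc M) w) / (1 + (norm (f w ^ Suc M))\<^sup>2))
      \<longlongrightarrow> spherical_deriv (\<lambda>w. f w ^ Suc M) z) (at z)"
    by (rule spherical_deriv_tendsto)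
  have "isCont (a k j) z" if "k \<in> {1..n}" "j \<in> {0..m k}" for k j
    using a[OF that] z holomorphic_on_imp_continuous_on continuous_on_eq_continuous_at open_ball by blast
  then have "((\<lambda>w. a k j w) \<longlongrightarrow> a k j z) (at z)" if "k \<in> {1..n}" "j \<in> {0..m k}" for k j
    using that by (simp add: isCont_def)
  then show "((\<lambda>w. ?C * ?R w) \<longlongrightarrow> ?C * ?R z) (at z)"
    by (intro tendsto_intros) auto
  have "eventually (\<lambda>w. deriv f w ^ n +
      (\<Sum>k=1..n. (\<Sum>j=0..m k. a k j w * f w ^ j) * deriv f w ^ (n - k)) = 0) (at z)"
    using sol z by (auto simp: meromorphic_solution_def eventually_cosparse_open_eq)
  moreover have "eventually (\<lambda>w. f analytic_on {w}) (at z)"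
    using f by (simp add: meromorphic_at_iff isolated_singularity_at_altdef)
  ultimately show "eventually (\<lambda>w. norm (deriv (\<lambda>w. f w ^ Suc M) w) / (1 + (norm (f w ^ Suc M))\<^sup>2)
      \<le> ?C * ?R w) (at z)"
  proof eventually_elim
    case (elim w)
    have "norm (deriv (\<lambda>w. f w ^ Suc M) w) / (1 + (norm (f w ^ Suc M))\<^sup>2) =
        real (Suc M) * (norm (deriv f w) * norm (f w) ^ M / (1 + norm (f w) ^ (2 * Suc M)))"
      unfolding deriv_power_analytic[OF elim(2)]
      by (simp only: norm_mult norm_of_nat norm_power power_mult[symmetric] mult.commute[of 2])
        (simp add: mult_ac)
    also have "\<dots> \<le> real (Suc M) * (real (n * (\<Sum>k=1..n. m k + 1)) * ?R w)"
      by (intro mult_left_mono equation_bound[OF n m elim(1)]) auto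
    finally show ?case
      by (simp only: mult.assoc)
  qed
qed auto

section \<open>Spherical derivatives of powers\<close>

text \<open>Such a point is a genuine pole. If \<open>f z\<close> were nonzero, \<open>f\<close>
  would be the inverse of a nonvanishing analytic function; if zeros of 1/f accumulated at
  \<open>z\<close>, then 1/f and with it \<open>f\<close> would vanish identically near
  \<open>z\<close>. Either way \<open>f\<close> would be analytic.\<close>

lemma not_analytic_imp_zero_inverse:
  assumes "sphere_analytic_on f {z}" "\<not> f analytic_on {z}"
  shows "(\<lambda>w. inverse (f w)) analytic_on {z}" "f z = 0" "eventually (\<lambda>w. f w \<noteq> 0) (at z)"
proof -
  show an: "(\<lambda>w. inverse (f w)) analytic_on {z}"
    using assms by (auto simp: sphere_analytic_on_def)
  show 0: "f z = 0"
  proof (rule ccontr)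
    assume "f z \<noteq> 0"
    then show False
      using assms analytic_on_inverse[OF an] by simp
  qed
  show "eventually (\<lambda>w. f w \<noteq> 0) (at z)"
  proof (rule ccontr)
    assume "\<not> ?thesis"
    then have "frequently (\<lambda>w. inverse (f w) = 0) (at z)"
      by (simp add: frequently_def)
    then have "eventually (\<lambda>w. inverse (f w) = 0) (at z)"
      using an by (intro not_essential_frequently_0_imp_eventually_0)
        (auto simp: isolated_singularity_at_analytic not_essential_analytic)
    then have "eventually (\<lambda>w. f w = 0) (nhds z)"
      using 0 by (auto simp: eventually_nhds_conv_at)
    then have "f analytic_on {z} \<longleftrightarrow> (\<lambda>_. 0) analytic_on {z}"
      by (intro analytic_at_cong) auto
    then show False
      using assms by simp
  qed
qed

lemma has_derivative_norm_square:
  assumes "(F has_field_derivative d) (at z)"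
  shows "((\<lambda>w. (norm (F w))\<^sup>2) has_derivative (\<lambda>h. 2 * Re (cnj (F z) * (d * h)))) (at z)"
proof -
  have F: "(F has_derivative (\<lambda>h. d * h)) (at z)"
    using assms by (simp add: has_field_derivative_def)
  show ?thesis
    unfolding cmod_power2
    by (rule derivative_eq_intros F refl)+ (simp add: algebra_simps)
qed

text \<open>On the sphere of diameter 1 this function is the depth of the image point below the
  point at infinity, and depth changes no faster than spherical distance. In formulas, 2 |F| \<le> 1
  + |F|^2 cancels one factor of the denominator.\<close>

lemma has_derivative_one_over_one_plus_norm_square:
  assumes "F analytic_on {z}"
  shows "\<exists>s'. ((\<lambda>w. 1 / (1 + (norm (F w))\<^sup>2)) has_derivative s') (at z) \<and> onorm s' \<le> spherical_deriv F z"
proof -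
  let ?q = "1 + (norm (F z))\<^sup>2"
  define s' where "s' = (\<lambda>h. - (2 * Re (cnj (F z) * (deriv F z * h))) / ?q\<^sup>2)"
  have q: "?q > 0"
    by (intro add_pos_nonneg) auto
  have "(F has_field_derivative deriv F z) (at z)"
    using assms analytic_derivI by blast
  note d = has_derivative_norm_square[OF this]
  have "((\<lambda>w. 1 / (1 + (norm (F w))\<^sup>2)) has_derivative s') (at z)"
    unfolding s'_def
    by (rule derivative_eq_intros d refl)+ (use q in \<open>auto simp: power2_eq_square field_simps\<close>)
  moreover have "onorm s' \<le> spherical_deriv F z"
  proof (rule onorm_le)
    fix h
    have "norm (s' h) = 2 * \<bar>Re (cnj (F z) * (deriv F z * h))\<bar> / ?q\<^sup>2"
      unfolding s'_def real_norm_def abs_divide abs_minus_cancel abs_mult[of 2] by simp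
    also have "\<dots> \<le> 2 * (norm (F z) * (norm (deriv F z) * norm h)) / ?q\<^sup>2"
      using abs_Re_le_cmod[of "cnj (F z) * (deriv F z * h)"]
      by (intro divide_right_mono mult_left_mono) (auto simp: norm_mult)
    also have "\<dots> = (2 * norm (F z)) * (norm (deriv F z) * norm h) / ?q\<^sup>2"
      by simp
    also have "\<dots> \<le> ?q * (norm (deriv F z) * norm h) / ?q\<^sup>2"
      using sum_squares_bound[of 1 "norm (F z)"] by (intro divide_right_mono mult_right_mono) auto
    also have "\<dots> = spherical_deriv F z * norm h"
      using q by (simp add: spherical_deriv_analytic[OF assms] power2_eq_square)
    finally show "norm (s' h) \<le> spherical_deriv F z * norm h" .
  qed
  ultimately show ?thesis
    by blast
qed

text \<open>The function \<open>1 / (1 + |F|\<^sup>2)\<close>, extended by 0 to the poles, is Lipschitz with constant \<open>L\<close>, so \<open>F\<close>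
  cannot reach a pole within distance \<open>\<rho>\<close>.\<close>

lemma spherical_deriv_small_imp_analytic:
  assumes F: "sphere_analytic_on F (ball a \<rho>)" and a: "F analytic_on {a}" "norm (F a) \<le> 1"
    and L: "\<And>z. z \<in> ball a \<rho> \<Longrightarrow> spherical_deriv F z \<le> L" and L\<rho>: "L * \<rho> \<le> 1 / 4" and z: "z \<in> ball a \<rho>"
  shows "F analytic_on {z}" "(norm (F z))\<^sup>2 \<le> 3"
proof -
  define s where "s z = (if F analytic_on {z} then 1 / (1 + (norm (F z))\<^sup>2) else 0)" for z
  have "\<exists>s'. (s has_derivative s') (at w) \<and> onorm s' \<le> L" if w: "w \<in> ball a \<rho>" for w
  proof -
    have Fw: "sphere_analytic_on F {w}"
      using F w by (auto simp: sphere_analytic_on_def)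
    show ?thesis
    proof (cases "F analytic_on {w}")
      case True
      obtain s' where s': "((\<lambda>w. 1 / (1 + (norm (F w))\<^sup>2)) has_derivative s') (at w)"
          "onorm s' \<le> spherical_deriv F w"
        using has_derivative_one_over_one_plus_norm_square[OF True] by blast
      have "eventually (\<lambda>x. 1 / (1 + (norm (F x))\<^sup>2) = s x) (nhds w)"
        using analytic_at_imp_eventually_analytic[OF True] by eventually_elim (simp add: s_def)
      then have "(s has_derivative s') (at w)"
        using s'(1) has_derivative_transform_eventually[of _ s' w UNIV s]
        by (auto simp: eventually_nhds_conv_at)
      then show ?thesis
        using s'(2) L[OF w] by fastforce
    next
      case False
      define G where "G = (\<lambda>x. inverse (F x))"
      note G = not_analytic_imp_zero_inverse[OF Fw False, folded G_def]
      obtain s' where s': "((\<lambda>w. 1 / (1 + (norm (G w))\<^sup>2)) has_derivative s') (at w)"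
          "onorm s' \<le> spherical_deriv G w"
        using has_derivative_one_over_one_plus_norm_square[OF G(1)] by blast
      \<comment> \<open>At a pole the function 1/F is analytic, and 1 - 1 / (1 + |1/F|^2) = 1 / (1 +
        |F|^2) around it. So the derivative of \<open>s\<close> is that of the inverted function
        with the opposite sign, and the norm is the same.\<close>
      have "((\<lambda>w. 1 - 1 / (1 + (norm (G w))\<^sup>2)) has_derivative (\<lambda>h. 0 - s' h)) (at w)"
        by (intro derivative_intros s')
      moreover have "eventually (\<lambda>x. 1 - 1 / (1 + (norm (G x))\<^sup>2) = s x) (at w)"
        using G(3) analytic_at_imp_eventually_analytic[OF G(1), THEN filter_leD[OF at_within_le_nhds]]
      proof eventually_elim
        case (elim x)
        then have "(\<lambda>y. inverse (G y)) analytic_on {x}"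
          by (intro analytic_on_inverse) (auto simp: G_def)
        then have "F analytic_on {x}"
          by (simp add: G_def)
        have "1 - 1 / (1 + (inverse y)\<^sup>2) = 1 / (1 + y\<^sup>2)" if "y > 0" for y :: real
        proof -
          have "1 + y\<^sup>2 > 0"
            by (intro add_pos_nonneg) auto
          moreover have "1 + (inverse y)\<^sup>2 = (1 + y\<^sup>2) / y\<^sup>2"
            using that by (simp add: field_simps)
          ultimately show ?thesis
            using that by (simp add: field_simps)
        qed
        from this[of "norm (F x)"] \<open>F analytic_on {x}\<close> elim(1) show ?case
          by (simp add: s_def G_def norm_inverse)
      qed
      ultimately have "(s has_derivative (\<lambda>h. 0 - s' h)) (at w)"
        using False G(2)
          has_derivative_transform_eventually[of "\<lambda>w. 1 - 1 / (1 + (norm (G w))\<^sup>2)" "\<lambda>h. 0 - s' h" w UNIV s]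
        by (simp add: s_def G_def)
      moreover have "onorm (\<lambda>h. 0 - s' h) = onorm s'"
        using onorm_neg[of s'] by simp
      moreover have "spherical_deriv G w \<le> L"
        using L[OF w] spherical_deriv_inverse[OF Fw] by (simp add: G_def)
      ultimately show ?thesis
        using s'(2) by (intro exI[of _ "\<lambda>h. 0 - s' h"]) auto
    qed
  qed
  then obtain s' where s': "\<And>w. w \<in> ball a \<rho> \<Longrightarrow> (s has_derivative s' w) (at w) \<and> onorm (s' w) \<le> L"
    by metis
  have \<rho>: "\<rho> > 0"
    using z by (auto intro: le_less_trans[OF zero_le_dist])
  have "norm (s z - s a) \<le> L * norm (z - a)"
    using s' z \<rho> by (intro differentiable_bound[of "ball a \<rho>" s s']) (auto intro: has_derivative_at_withinI)
  moreover have "0 \<le> L"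
    using L[of a] \<rho> spherical_deriv_nonneg_analytic[of F a] F by (auto simp: sphere_analytic_on_def)
  then have "L * norm (z - a) \<le> L * \<rho>"
    using z by (intro mult_left_mono) (auto simp: dist_norm norm_minus_commute)
  \<comment> \<open>From at least 1/2, \<open>s\<close> drops by at most L \<rho> \<le> 1/4. The
    remaining 1/4 excludes the value 0 of a pole and means |F|^2 \<le> 3.\<close>
  moreover have "s a \<ge> 1 / 2"
    using a power_le_one[of "norm (F a)" 2] by (simp add: s_def field_simps add_pos_nonneg)
  ultimately have sz: "s z \<ge> 1 / 4"
    using L\<rho> by (simp add: abs_le_iff)
  then show an: "F analytic_on {z}"
    by (auto simp: s_def split: if_splits)
  have "1 + (norm (F z))\<^sup>2 > 0"
    by (intro add_pos_nonneg) auto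
  then show "(norm (F z))\<^sup>2 \<le> 3"
    using sz an by (simp add: s_def field_simps)
qed

text \<open>If \<open>f\<close> is small at \<open>a\<close>, Cauchy's estimate bounds \<open>f'(a)\<close>; otherwise \<open>(f ^ N)' = N * f ^ (N - 1) * f'\<close> does.\<close>

lemma spherical_deriv_le_of_power:
  assumes f: "sphere_analytic_on f (ball a \<rho>)" and \<rho>: "\<rho> > 0" and N: "N \<ge> 1"
    and e: "e > 0" "e ^ N \<le> 1 / 4"
    and bd: "\<And>z. z \<in> ball a \<rho> \<Longrightarrow> spherical_deriv (\<lambda>w. f w ^ N) z \<le> e ^ N / \<rho>"
  shows "spherical_deriv f a \<le> 10 * e / \<rho>"
proof -
  \<comment> \<open>The case of a finite value of modulus at most 1 at \<open>a\<close>. In the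
    other case 1/f takes the place of f, with the same spherical derivatives for it and for its N-th
    power.\<close>
  have main: "spherical_deriv f a \<le> 10 * e / \<rho>"
    if f: "sphere_analytic_on f (ball a \<rho>)" and fa: "f analytic_on {a}" "norm (f a) \<le> 1"
      and bd: "\<And>z. z \<in> ball a \<rho> \<Longrightarrow> spherical_deriv (\<lambda>w. f w ^ N) z \<le> e ^ N / \<rho>" for f
  proof -
    define F where "F = (\<lambda>w. f w ^ N)"
    have Fan: "F analytic_on {z}" and F3: "(norm (F z))\<^sup>2 \<le> 3" if "z \<in> ball a \<rho>" for z
    proof -
      have "sphere_analytic_on F (ball a \<rho>)"
        using f unfolding F_def by (rule sphere_analytic_on_power)
      moreover have "F analytic_on {a}"
        using fa(1) unfolding F_def by (rule analytic_on_power)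
      moreover have "norm (F a) \<le> 1"
        using fa(2) by (simp add: F_def norm_power power_le_one)
      moreover have "e ^ N / \<rho> * \<rho> \<le> 1 / 4"
        using e \<rho> by simp
      ultimately show "F analytic_on {z}" "(norm (F z))\<^sup>2 \<le> 3"
        using spherical_deriv_small_imp_analytic[of F a \<rho> "e ^ N / \<rho>" z] bd that by (auto simp: F_def)
    qed
    \<comment> \<open>At a pole of f the product (1/f)^N F would tend to 0, because F stays finite,
      although it equals 1 off the pole.\<close>
    have fan: "f analytic_on {z}" if z: "z \<in> ball a \<rho>" for z
    proof (rule ccontr)
      assume not_an: "\<not> f analytic_on {z}"
      have fz: "sphere_analytic_on f {z}"
        using f z by (auto simp: sphere_analytic_on_def)
      note G = not_analytic_imp_zero_inverse[OF fz not_an]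
      have "isCont (\<lambda>w. inverse (f w) ^ N * F w) z"
        using analytic_at_imp_isCont[OF G(1)] analytic_at_imp_isCont[OF Fan[OF z]]
        by (intro isCont_mult isCont_power)
      then have "((\<lambda>w. inverse (f w) ^ N * F w) \<longlongrightarrow> 0) (at z)"
        using N G(2) by (simp add: isCont_def zero_power)
      moreover have "eventually (\<lambda>w. inverse (f w) ^ N * F w = 1) (at z)"
        using G(3) by eventually_elim (simp add: F_def power_inverse)
      ultimately have "((\<lambda>w. 1 :: complex) \<longlongrightarrow> 0) (at z)"
        by (rule Lim_transform_eventually)
      then show False
        by (simp add: tendsto_const_iff)
    qed
    have hol: "f holomorphic_on ball a \<rho>" 
      using fan analytic_imp_holomorphic analytic_on_analytic_at by blast
    have F': "norm (deriv F z) \<le> e ^ N / \<rho> * (1 + (norm (F z))\<^sup>2)" if "z \<in> ball a \<rho>" for z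
    proof -
      have "1 + (norm (F z))\<^sup>2 > 0"
        by (intro add_pos_nonneg) auto
      then show ?thesis
        using bd[OF that] spherical_deriv_analytic[OF Fan[OF that]] by (simp add: F_def pos_divide_le_eq)
    qed
    have "norm (deriv f a) \<le> 10 * e / \<rho>"
    \<comment> \<open>The threshold is |f(a)| = e. Below it f is of size e on the whole disc; above
      it, dividing F'(a) by N f(a)^(N-1) costs at most the factor e^-(N-1).\<close>
    proof (cases "norm (F a) \<le> e ^ N")
      case True
      have small: "norm (f z) \<le> 5 * e" if z: "z \<in> ball a \<rho>" for z
      proof -
        \<comment> \<open>The 4 is the bound for 1 + |F|^2. It gives |F| \<le> e^N + 4 e^N \<le> (5
          e)^N, and Cauchy's estimate on radius \<rho>/2 turns |f| \<le> 5 e into 10 e /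
          \<rho>.\<close>
        have "norm (F z - F a) \<le> 4 * (e ^ N / \<rho>) * norm (z - a)"
        proof (rule field_differentiable_bound[of "ball a \<rho>" F "deriv F"])
          fix w assume w: "w \<in> ball a \<rho>"
          then show "(F has_field_derivative deriv F w) (at w within ball a \<rho>)"
            using Fan analytic_derivI has_field_derivative_at_within by blast
          have "e ^ N / \<rho> * (1 + (norm (F w))\<^sup>2) \<le> e ^ N / \<rho> * 4"
            using F3[OF w] e \<rho> by (intro mult_left_mono) auto
          then show "norm (deriv F w) \<le> 4 * (e ^ N / \<rho>)"
            using F'[OF w] by simp
        qed (use z \<rho> in auto)
        also have "\<dots> \<le> 4 * (e ^ N / \<rho>) * \<rho>"
          using z e \<rho> by (intro mult_left_mono) (auto simp: dist_norm norm_minus_commute)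
        finally have "norm (F z) \<le> 5 * e ^ N"
          using norm_triangle_ineq2[of "F z" "F a"] True \<rho> by simp
        also have "\<dots> \<le> 5 ^ N * e ^ N"
          using N e self_le_power[of "5::real" N] by (intro mult_right_mono) auto
        finally have "norm (f z) ^ N \<le> (5 * e) ^ N"
          by (simp add: F_def norm_power power_mult_distrib)
        then show ?thesis
          using N e by (subst (asm) power_mono_iff) auto
      qed
      have "norm ((deriv ^^ 1) f a) \<le> fact 1 * (5 * e) / (\<rho> / 2) ^ 1"
      proof (rule Cauchy_inequality)
        show "f holomorphic_on ball a (\<rho> / 2)"
          by (rule holomorphic_on_subset[OF hol]) (use \<rho> in auto)
        show "continuous_on (cball a (\<rho> / 2)) f"
          by (rule continuous_on_subset[OF holomorphic_on_imp_continuous_on[OF hol]]) (use \<rho> in auto)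
        show "norm (f x) \<le> 5 * e" if "norm (a - x) = \<rho> / 2" for x
          using that \<rho> by (intro small) (auto simp: dist_norm)
      qed (use \<rho> in auto)
      then show ?thesis
        by simp
    next
      case False
      then have "e ^ N < norm (f a) ^ N"
        by (simp add: F_def norm_power)
      then have ef: "e \<le> norm (f a)"
        using e by (meson norm_ge_zero not_less power_mono less_imp_le)
      have "norm (F a) \<le> 1"
        using fa(2) by (simp add: F_def norm_power power_le_one)
      then have "e ^ N / \<rho> * (1 + (norm (F a))\<^sup>2) \<le> e ^ N / \<rho> * 2"
        using e \<rho> by (intro mult_left_mono) (auto simp: power_le_one)
      then have 1: "norm (deriv F a) \<le> e ^ N / \<rho> * 2"
        using F'[of a] \<rho> by simp
      have "e ^ (N - 1) * norm (deriv f a) \<le> real N * norm (f a) ^ (N - 1) * norm (deriv f a)"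
        using N ef e power_mono[OF ef, of "N - 1"] mult_mono[of 1 "real N" "e ^ (N - 1)" "norm (f a) ^ (N - 1)"]
        by (intro mult_right_mono) auto
      also have "\<dots> = norm (deriv F a)"
        unfolding F_def deriv_power_analytic[OF fa(1)] by (simp add: norm_mult norm_power)
      also have "\<dots> \<le> e ^ (N - 1) * (2 * e / \<rho>)"
        using 1 N by (cases N) (auto simp: field_simps)
      finally have "norm (deriv f a) \<le> 2 * e / \<rho>"
        by (rule mult_left_le_imp_le) (use e in simp)
      also have "\<dots> \<le> 10 * e / \<rho>"
        using e \<rho> by (intro divide_right_mono) auto
      finally show ?thesis .
    qed
    moreover have "spherical_deriv f a \<le> norm (deriv f a)"
    proof -
      have "norm (deriv f a) / (1 + (norm (f a))\<^sup>2) \<le> norm (deriv f a) / 1"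
        by (intro divide_left_mono) (auto intro: add_pos_nonneg)
      then show ?thesis
        by (simp add: spherical_deriv_analytic[OF fa(1)])
    qed
    ultimately show ?thesis
      by linarith
  qed
  have fS: "sphere_analytic_on f {z}" if "z \<in> ball a \<rho>" for z
    using f that by (auto simp: sphere_analytic_on_def)
  have fa: "sphere_analytic_on f {a}"
    using \<rho> by (intro fS) auto
  show ?thesis
  proof (cases "f analytic_on {a} \<and> norm (f a) \<le> 1")
    case True
    then show ?thesis
      using main[OF f] bd by blast
  next
    case False
    define g where "g = (\<lambda>w. inverse (f w))"
    have ga: "g analytic_on {a} \<and> norm (g a) \<le> 1"
    proof (cases "f analytic_on {a}")
      case True
      then show ?thesis
        using False unfolding g_def by (auto intro!: analytic_on_inverse simp: norm_inverse inverse_le_1_iff)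
    next
      case no: False
      show ?thesis
        using not_analytic_imp_zero_inverse[OF fa no] by (simp add: g_def)
    qed
    have "spherical_deriv (\<lambda>w. g w ^ N) z \<le> e ^ N / \<rho>" if "z \<in> ball a \<rho>" for z
    proof -
      have "spherical_deriv (\<lambda>w. g w ^ N) z = spherical_deriv (\<lambda>w. f w ^ N) z"
        unfolding g_def power_inverse
        by (rule spherical_deriv_inverse[OF sphere_analytic_on_power[OF fS[OF that]]])
      then show ?thesis
        using bd[OF that] by simp
    qed
    then have "spherical_deriv g a \<le> 10 * e / \<rho>"
      using main[of g] f ga by (auto simp: g_def)
    then show ?thesis
      by (simp add: g_def spherical_deriv_inverse[OF fa])
  qed
qed

section \<open>Holomorphic change of variables in the plane\<close>

text \<open>The identification with pairs serves the iterated integrals over rectangles.\<close>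

lemma lborel_complex_eq_distr_prod: "lborel = distr (lborel \<Otimes>\<^sub>M lborel) borel (\<lambda>(x, y). Complex x y)"
proof (rule lborel_eqI)
  have [measurable]: "(\<lambda>(x, y). Complex x y) \<in> borel_measurable (borel \<Otimes>\<^sub>M borel)"
    unfolding borel_prod by (intro borel_measurable_continuous_onI) (auto intro!: continuous_intros simp: case_prod_beta)
  fix l u :: complex
  assume le: "\<And>b. b \<in> Basis \<Longrightarrow> l \<bullet> b \<le> u \<bullet> b"
  then have le': "Re l \<le> Re u" "Im l \<le> Im u"
    using le[of 1] le[of \<i>] by (simp_all add: Basis_complex_def)
  have "(\<lambda>(x, y). Complex x y) -` box l u = {Re l<..<Re u} \<times> {Im l<..<Im u}"
    by (auto simp: in_box_complex_iff)
  then have "emeasure (distr (lborel \<Otimes>\<^sub>M lborel) borel (\<lambda>(x, y). Complex x y)) (box l u) =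
      emeasure (lborel \<Otimes>\<^sub>M lborel) ({Re l<..<Re u} \<times> {Im l<..<Im u})"
    by (subst emeasure_distr) (auto simp: space_pair_measure)
  also have "\<dots> = ennreal (Re u - Re l) * ennreal (Im u - Im l)"
    using le' by (subst lborel.emeasure_pair_measure_Times) auto
  finally show "emeasure (distr (lborel \<Otimes>\<^sub>M lborel) borel (\<lambda>(x, y). Complex x y)) (box l u) =
      (\<Prod>b\<in>Basis. (u - l) \<bullet> b)"
    using le' by (simp add: Basis_complex_def inner_complex_def ennreal_mult complex_eq_iff)
qed simp

text \<open>The change-of-variables theorem speaks of determinants of matrices over
  \<open>real ^ 2\<close>, hence a second identification of the plane besides pairs of
  reals.\<close>

definition complex_of_vec2 :: "real ^ 2 \<Rightarrow> complex" where
  "complex_of_vec2 v = Complex (v $ 1) (v $ 2)"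

definition vec2_of_complex :: "complex \<Rightarrow> real ^ 2" where
  "vec2_of_complex z = vector [Re z, Im z]"

lemma complex_of_vec2_of_complex [simp]: "complex_of_vec2 (vec2_of_complex z) = z"
  by (simp add: complex_of_vec2_def vec2_of_complex_def)

lemma vec2_of_complex_of_vec2 [simp]: "vec2_of_complex (complex_of_vec2 v) = v"
  by (simp add: complex_of_vec2_def vec2_of_complex_def vec_eq_iff forall_2)

lemma bounded_linear_complex_of_vec2: "bounded_linear complex_of_vec2"
  by (intro linear_conv_bounded_linear[THEN iffD1] linearI)
    (auto simp: complex_of_vec2_def complex_eq_iff)

lemma bounded_linear_vec2_of_complex: "bounded_linear vec2_of_complex"
  by (intro linear_conv_bounded_linear[THEN iffD1] linearI)
    (auto simp: vec2_of_complex_def vec_eq_iff forall_2)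

lemma lborel_complex_eq_distr_vec2: "lborel = distr lborel borel complex_of_vec2"
proof (rule lborel_eqI)
  have [measurable]: "complex_of_vec2 \<in> borel_measurable borel"
    by (intro borel_measurable_continuous_onI linear_continuous_on bounded_linear_complex_of_vec2)
  fix l u :: complex
  assume le: "\<And>b. b \<in> Basis \<Longrightarrow> l \<bullet> b \<le> u \<bullet> b"
  then have le': "Re l \<le> Re u" "Im l \<le> Im u"
    using le[of 1] le[of \<i>] by (simp_all add: Basis_complex_def)
  have "complex_of_vec2 -` box l u = box (vec2_of_complex l) (vec2_of_complex u)"
    by (auto simp: in_box_complex_iff complex_of_vec2_def vec2_of_complex_def mem_box_cart forall_2)
  then have "emeasure (distr lborel borel complex_of_vec2) (box l u) =
      emeasure lborel (box (vec2_of_complex l) (vec2_of_complex u))"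
    by (subst emeasure_distr) auto
  also have "\<dots> = (\<Prod>b\<in>Basis. (vec2_of_complex u - vec2_of_complex l) \<bullet> b)"
  proof (rule emeasure_lborel_box)
    have "vec2_of_complex l $ i \<le> vec2_of_complex u $ i" for i
      using exhaust_2[of i] le' by (auto simp: vec2_of_complex_def)
    then show "vec2_of_complex l \<bullet> b \<le> vec2_of_complex u \<bullet> b" if "b \<in> Basis" for b
      using that by (auto simp: Basis_vec_def inner_axis)
  qed
  also have "(\<Prod>b\<in>Basis. (vec2_of_complex u - vec2_of_complex l) \<bullet> b) = (\<Prod>b\<in>Basis. (u - l) \<bullet> b)"
  proof -
    have B: "(Basis :: (real ^ 2) set) = {axis 1 1, axis 2 1}"
      by (auto simp: Basis_vec_def UNIV_2)
    have "(axis 1 1 :: real ^ 2) \<noteq> axis 2 1"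
      by (simp add: axis_eq_axis)
    then show ?thesis
      unfolding B by (simp add: inner_axis Basis_complex_def vec2_of_complex_def)
  qed
  finally show "emeasure (distr lborel borel complex_of_vec2) (box l u) = (\<Prod>b\<in>Basis. (u - l) \<bullet> b)" .
qed simp

text \<open>Multiplication by \<open>c\<close> is a rotation combined with a scaling by |c|; with
  \<open>c\<close> the derivative of a holomorphic map this is its Jacobian.\<close>

lemma det_vec2_mult:
  "det (matrix (\<lambda>v. vec2_of_complex (c * complex_of_vec2 v))) = (norm c)\<^sup>2"
  unfolding cmod_power2
  by (simp add: det_2 matrix_def vec2_of_complex_def complex_of_vec2_def axis_def power2_eq_square)

lemma emeasure_holomorphic_image:
  assumes S: "open S" and h: "h holomorphic_on S" "inj_on h S" and B: "bounded (h ` S)"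
    and A: "A \<in> sets borel" "A \<subseteq> h ` S"
  shows "emeasure lborel A = (\<integral>\<^sup>+w\<in>h -` A \<inter> S. ennreal ((norm (deriv h w))\<^sup>2) \<partial>lborel)"
proof -
  have [measurable]: "complex_of_vec2 \<in> borel_measurable borel"
    by (intro borel_measurable_continuous_onI linear_continuous_on bounded_linear_complex_of_vec2)
  have [measurable]: "vec2_of_complex \<in> borel_measurable borel"
    by (intro borel_measurable_continuous_onI linear_continuous_on bounded_linear_vec2_of_complex)
  have [measurable]: "A \<in> sets borel" "S \<in> sets borel"
    using A S by auto
  have conth: "continuous_on S h"
    using h holomorphic_on_imp_continuous_on by blast
  define T where "T = h -` A \<inter> S"
  have T[measurable]: "T \<in> sets borel"
  proof -
    \<comment> \<open>\<open>h\<close> is controlled on \<open>S\<close> only; cutting it off by the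
      indicator gives a Borel function on the whole plane. The same device recurs for other
      functions known on a domain only.\<close>
    have [measurable]: "(\<lambda>w. indicator S w *\<^sub>R h w) \<in> borel_measurable borel"
      using conth by (intro borel_measurable_continuous_on_indicator) auto
    have "T = (\<lambda>w. indicator S w *\<^sub>R h w) -` A \<inter> S"
      by (auto simp: T_def)
    then show ?thesis
      using A(1) by (auto intro: measurable_sets_borel)
  qed
  define T' where "T' = complex_of_vec2 -` T"
  define A' where "A' = complex_of_vec2 -` A"
  define g where "g = (\<lambda>v. vec2_of_complex (h (complex_of_vec2 v)))"
  define D where "D = (\<lambda>v. (norm (deriv h (complex_of_vec2 v)))\<^sup>2)"
  have T'[measurable]: "T' \<in> sets borel" and A'[measurable]: "A' \<in> sets borel"
    unfolding T'_def A'_def using T A(1)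
    by (auto intro!: measurable_sets_borel[of complex_of_vec2 borel]
        borel_measurable_continuous_onI linear_continuous_on bounded_linear_complex_of_vec2)
  have img: "g ` T' = A'"
  proof -
    have "v \<in> g ` T'" if v: "v \<in> A'" for v
    proof -
      obtain w where "w \<in> S" "h w = complex_of_vec2 v"
        using v A(2) by (force simp: A'_def)
      then have "v = g (vec2_of_complex w)" "vec2_of_complex w \<in> T'"
        using v by (auto simp: g_def T'_def T_def A'_def)
      then show ?thesis
        by blast
    qed
    then show ?thesis
      by (auto simp: g_def T'_def T_def A'_def)
  qed
  \<comment> \<open>Boundedness of the image enters here: the Jacobian formula yields a real
    \<open>measure\<close>, which equals the \<open>emeasure\<close> because the latter is
    finite.\<close>
  have fin: "emeasure lborel A' < \<infinity>"
  proof -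
    have "A' = vec2_of_complex ` A"
      by (force simp: A'_def image_iff intro: vec2_of_complex_of_vec2[symmetric])
    moreover have "bounded A"
      using A(2) B bounded_subset by blast
    ultimately have "bounded A'"
      using bounded_linear_image bounded_linear_vec2_of_complex by blast
    then show ?thesis
      by (rule emeasure_bounded_finite)
  qed
  have der: "(g has_derivative (\<lambda>v'. vec2_of_complex (deriv h (complex_of_vec2 v) * complex_of_vec2 v'))) (at v within T')"
    if v: "v \<in> T'" for v
  proof -
    have "(h has_field_derivative deriv h (complex_of_vec2 v)) (at (complex_of_vec2 v))"
      using v h S by (auto simp: T'_def T_def intro: holomorphic_derivI)
    then have hd: "(h has_derivative (\<lambda>x. deriv h (complex_of_vec2 v) * x)) (at (complex_of_vec2 v))"
      by (simp add: has_field_derivative_def)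
    have "((\<lambda>v. h (complex_of_vec2 v)) has_derivative (\<lambda>v'. deriv h (complex_of_vec2 v) * complex_of_vec2 v')) (at v)"
      by (rule has_derivative_compose[OF bounded_linear_imp_has_derivative[OF bounded_linear_complex_of_vec2] hd])
    then have "(g has_derivative (\<lambda>v'. vec2_of_complex (deriv h (complex_of_vec2 v) * complex_of_vec2 v'))) (at v)"
      unfolding g_def by (rule bounded_linear.has_derivative[OF bounded_linear_vec2_of_complex])
    then show ?thesis
      by (rule has_derivative_at_withinI)
  qed
  have inj: "inj_on g T'"
  proof (rule inj_onI)
    fix v w assume vw: "v \<in> T'" "w \<in> T'" "g v = g w"
    then have "h (complex_of_vec2 v) = h (complex_of_vec2 w)"
      unfolding g_def by (metis complex_of_vec2_of_complex)
    then have "complex_of_vec2 v = complex_of_vec2 w"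
      using vw h(2) by (auto simp: T'_def T_def dest: inj_onD)
    then show "v = w"
      by (metis vec2_of_complex_of_vec2)
  qed
  have "A' \<in> lmeasurable"
    using fin A' by (auto simp: fmeasurable_def)
  then have "((\<lambda>v. D v) has_integral measure lebesgue A') T'"
    using has_measure_differentiable_image[of T' g, OF _ der inj] T'
    by (auto simp: img det_vec2_mult D_def)
  then have "((\<lambda>v. indicator T' v * D v) has_integral measure lebesgue A') UNIV"
    by (subst (asm) has_integral_restrict_UNIV[symmetric], elim has_integral_eq[rotated]) auto
  moreover have [measurable]: "(\<lambda>w. indicator S w *\<^sub>R deriv h w) \<in> borel_measurable borel"
    using h S by (intro borel_measurable_continuous_on_indicator holomorphic_on_imp_continuous_on holomorphic_deriv) auto
  have meas: "(\<lambda>w. indicator T w * (norm (deriv h w))\<^sup>2) \<in> borel_measurable borel"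
  proof -
    have "(\<lambda>w. indicator T w * (norm (indicator S w *\<^sub>R deriv h w))\<^sup>2) \<in> borel_measurable borel"
      by measurable
    moreover have "(\<lambda>w. indicator T w * (norm (indicator S w *\<^sub>R deriv h w))\<^sup>2) =
        (\<lambda>w. indicator T w * (norm (deriv h w))\<^sup>2)"
      by (auto simp: T_def indicator_def)
    ultimately show ?thesis
      by simp
  qed
  have eq: "indicator T' v * D v = (\<lambda>w. indicator T w * (norm (deriv h w))\<^sup>2) (complex_of_vec2 v)" for v
    by (simp add: T'_def D_def indicator_def)
  have "(\<lambda>v. indicator T' v * D v) \<in> borel_measurable borel"
    unfolding eq using meas by (rule measurable_compose[rotated]) measurable
  ultimately have "(\<integral>\<^sup>+v. ennreal (indicator T' v * D v) \<partial>lborel) = ennreal (measure lebesgue A')"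
    by (intro nn_integral_has_integral_lborel) (auto simp: D_def)
  moreover have "(\<integral>\<^sup>+v. ennreal (indicator T' v * D v) \<partial>lborel) =
      (\<integral>\<^sup>+w. ennreal (indicator T w * (norm (deriv h w))\<^sup>2) \<partial>lborel)"
    unfolding eq using meas by (subst lborel_complex_eq_distr_vec2, subst nn_integral_distr) auto
  moreover have "ennreal (measure lebesgue A') = emeasure lborel A'"
    using fin A' by (simp add: emeasure_eq_ennreal_measure)
  moreover have "emeasure lborel A' = emeasure lborel A"
    by (subst lborel_complex_eq_distr_vec2, subst emeasure_distr) (auto simp: A'_def)
  moreover have "(\<integral>\<^sup>+w. ennreal (indicator T w * (norm (deriv h w))\<^sup>2) \<partial>lborel) =
      (\<integral>\<^sup>+w\<in>T. ennreal ((norm (deriv h w))\<^sup>2) \<partial>lborel)"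
    by (intro nn_integral_cong) (auto simp: indicator_def)
  ultimately show ?thesis
    by (simp add: T_def)
qed

text \<open>By \<open>emeasure_holomorphic_image\<close>, Lebesgue measure on the image and the
  push-forward of |h'|^2 dw agree on Borel sets. Equality of these measures gives equality of all
  integrals at once.\<close>

lemma nn_integral_holomorphic_image:
  assumes S: "open S" and h: "h holomorphic_on S" "inj_on h S" and B: "bounded (h ` S)"
    and q: "q \<in> borel_measurable borel"
  shows "(\<integral>\<^sup>+z\<in>h ` S. q z \<partial>lborel) = (\<integral>\<^sup>+w\<in>S. q (h w) * ennreal ((norm (deriv h w))\<^sup>2) \<partial>lborel)"
proof -
  have opn: "open (h ` S)"
    using open_mapping_thm3[OF h(1) S h(2)] .
  have [measurable]: "S \<in> sets borel" "h ` S \<in> sets borel"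
    using S opn by auto
  have [measurable]: "q \<in> borel_measurable borel" by fact
  define h0 where "h0 = (\<lambda>w. indicator S w *\<^sub>R h w)"
  define d0 where "d0 = (\<lambda>w. indicator S w *\<^sub>R deriv h w)"
  have h0[measurable]: "h0 \<in> borel_measurable borel" and d0[measurable]: "d0 \<in> borel_measurable borel"
    unfolding h0_def d0_def using h S
    by (auto intro!: borel_measurable_continuous_on_indicator holomorphic_on_imp_continuous_on holomorphic_deriv)
  define \<mu> where "\<mu> = density lborel (\<lambda>w. indicator S w * ennreal ((norm (d0 w))\<^sup>2))"
  have "density lborel (indicator (h ` S)) = density (distr \<mu> borel h0) (indicator (h ` S))"
  proof (rule measure_eqI)
    fix X :: "complex set" assume "X \<in> sets (density lborel (indicator (h ` S)))"
    then have X[measurable]: "X \<in> sets borel"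
      by simp
    have "emeasure (density lborel (indicator (h ` S))) X = emeasure lborel (h ` S \<inter> X)"
      by (subst emeasure_density) (auto simp: indicator_inter_arith[symmetric] nn_integral_indicator)
    also have "\<dots> = (\<integral>\<^sup>+w\<in>h -` (h ` S \<inter> X) \<inter> S. ennreal ((norm (deriv h w))\<^sup>2) \<partial>lborel)"
      by (intro emeasure_holomorphic_image[OF S h B]) auto
    also have "\<dots> = (\<integral>\<^sup>+w. indicator S w * ennreal ((norm (d0 w))\<^sup>2) * indicator (h0 -` (h ` S \<inter> X)) w \<partial>lborel)"
      by (intro nn_integral_cong) (auto simp: indicator_def d0_def h0_def)
    also have "\<dots> = emeasure \<mu> (h0 -` (h ` S \<inter> X))"
      unfolding \<mu>_def by (subst emeasure_density) (auto intro: measurable_sets_borel)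
    also have "\<dots> = emeasure (distr \<mu> borel h0) (h ` S \<inter> X)"
      by (subst emeasure_distr) (auto simp: \<mu>_def)
    also have "\<dots> = emeasure (density (distr \<mu> borel h0) (indicator (h ` S))) X"
      by (subst emeasure_density) (auto simp: indicator_inter_arith[symmetric] nn_integral_indicator)
    finally show "emeasure (density lborel (indicator (h ` S))) X = \<dots>" .
  qed simp
  then have "(\<integral>\<^sup>+z. q z \<partial>density lborel (indicator (h ` S))) =
      (\<integral>\<^sup>+z. q z \<partial>density (distr \<mu> borel h0) (indicator (h ` S)))"
    by simp
  then have "(\<integral>\<^sup>+z\<in>h ` S. q z \<partial>lborel) = (\<integral>\<^sup>+z\<in>h ` S. q z \<partial>distr \<mu> borel h0)"
    by (simp add: nn_integral_density mult.commute)
  also have "\<dots> = (\<integral>\<^sup>+w. q (h0 w) * indicator (h ` S) (h0 w) \<partial>\<mu>)"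
    by (subst nn_integral_distr) (auto simp: \<mu>_def)
  also have "\<dots> = (\<integral>\<^sup>+w. (indicator S w * ennreal ((norm (d0 w))\<^sup>2)) * (q (h0 w) * indicator (h ` S) (h0 w)) \<partial>lborel)"
    unfolding \<mu>_def by (subst nn_integral_density) auto
  also have "\<dots> = (\<integral>\<^sup>+w\<in>S. q (h w) * ennreal ((norm (deriv h w))\<^sup>2) \<partial>lborel)"
    by (intro nn_integral_cong) (auto simp: indicator_def d0_def h0_def mult_ac)
  finally show ?thesis .
qed

section \<open>The logarithmic potential\<close>

text \<open>Partial derivatives are those along 1 and \<open>\<i>\<close>. Being defined from the
  values of \<open>v\<close> alone, they refer to no local formula for \<open>v\<close>, so the
  formulas valid near a pole and away from poles describe one function.\<close>

definition dir_deriv :: "complex \<Rightarrow> (complex \<Rightarrow> real) \<Rightarrow> complex \<Rightarrow> real" where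
  "dir_deriv e v z = deriv (\<lambda>t. v (z + of_real t * e)) 0"

lemma has_derivative_imp_dir_deriv:
  fixes u v :: "complex \<Rightarrow> real"
  assumes "(u has_derivative u') (at z)" "eventually (\<lambda>w. v w = u w) (nhds z)"
  shows "((\<lambda>t. v (z + of_real t * e)) has_real_derivative u' e) (at 0)" "dir_deriv e v z = u' e"
proof -
  have line: "((\<lambda>t. z + of_real t * e) has_derivative (\<lambda>t. of_real t * e)) (at (0::real))"
    by (auto intro!: derivative_eq_intros)
  have "((\<lambda>t. u (z + of_real t * e)) has_derivative (\<lambda>t. u' (of_real t * e))) (at (0::real))"
    using assms(1) by (intro has_derivative_compose[OF line]) simp
  moreover have "u' (of_real t * e) = t * u' e" for t
    using linear_scale[OF has_derivative_linear[OF assms(1)], of t e] by (simp add: scaleR_conv_of_real)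
  ultimately have d: "((\<lambda>t. u (z + of_real t * e)) has_real_derivative u' e) (at 0)"
    by (simp add: has_field_derivative_def mult_commute_abs)
  have "((\<lambda>t. z + of_real t * e) \<longlongrightarrow> z + of_real 0 * e) (nhds (0::real))"
    by (intro tendsto_intros filterlim_ident)
  then have ev: "eventually (\<lambda>t. v (z + of_real t * e) = u (z + of_real t * e)) (nhds (0::real))"
    using assms(2) by (auto simp: filterlim_iff)
  show "((\<lambda>t. v (z + of_real t * e)) has_real_derivative u' e) (at 0)"
    using d by (simp only: DERIV_cong_ev[OF refl ev refl])
  then show "dir_deriv e v z = u' e"
    unfolding dir_deriv_def by (rule DERIV_imp_deriv)
qed

text \<open>The potential of the spherical metric. \<open>log_sphere1 g e\<close> and
  \<open>log_sphere2 g e\<close> are its first and second derivatives along \<open>e\<close> in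
  closed form, from which the Laplacian and the continuity of the second derivatives are read
  off.\<close>

definition log_sphere :: "(complex \<Rightarrow> complex) \<Rightarrow> complex \<Rightarrow> real" where
  "log_sphere g z = ln (1 + (norm (g z))\<^sup>2)"

definition log_sphere1 :: "(complex \<Rightarrow> complex) \<Rightarrow> complex \<Rightarrow> complex \<Rightarrow> real" where
  "log_sphere1 g e z = 2 * Re (cnj (g z) * (deriv g z * e)) / (1 + (norm (g z))\<^sup>2)"

definition log_sphere2 :: "(complex \<Rightarrow> complex) \<Rightarrow> complex \<Rightarrow> complex \<Rightarrow> real" where
  "log_sphere2 g e z =
     2 * ((norm (deriv g z * e))\<^sup>2 + Re (cnj (g z) * (deriv (deriv g) z * e * e))) / (1 + (norm (g z))\<^sup>2) -
     (log_sphere1 g e z)\<^sup>2"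

lemma one_plus_square_pos: "0 < 1 + (x :: real)\<^sup>2"
  by (intro add_pos_nonneg) auto

lemma has_derivative_one_plus_norm_square:
  assumes "g analytic_on {z}"
  shows "((\<lambda>w. 1 + (norm (g w))\<^sup>2) has_derivative (\<lambda>h. 2 * Re (cnj (g z) * (deriv g z * h)))) (at z)"
  using has_derivative_add[OF has_derivative_const has_derivative_norm_square[OF analytic_derivI[OF assms]], of 1]
  by simp

lemma has_derivative_log_sphere:
  assumes "g analytic_on {z}"
  shows "(log_sphere g has_derivative (\<lambda>h. log_sphere1 g h z)) (at z)"
  unfolding log_sphere_def[abs_def] log_sphere1_def using one_plus_square_pos[of "norm (g z)"]
  by (intro has_derivative_eq_rhs[OF has_derivative_ln[OF _ has_derivative_one_plus_norm_square[OF assms]]])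
    (auto simp: divide_inverse)

lemma has_derivative_log_sphere1:
  assumes "g analytic_on {z}"
  shows "\<exists>u'. (log_sphere1 g e has_derivative u') (at z) \<and> u' e = log_sphere2 g e z"
proof -
  let ?q = "1 + (norm (g z))\<^sup>2"
  have q: "?q > 0"
    by (rule one_plus_square_pos)
  have "(g has_field_derivative deriv g z) (at z)"
    using assms analytic_derivI by blast
  then have g: "(g has_derivative (\<lambda>h. deriv g z * h)) (at z)"
    by (simp add: has_field_derivative_def)
  have "(deriv g has_field_derivative deriv (deriv g) z) (at z)"
    using analytic_deriv[OF assms] analytic_derivI by blast
  then have g': "(deriv g has_derivative (\<lambda>h. deriv (deriv g) z * h)) (at z)"
    by (simp add: has_field_derivative_def)
  define A where "A = (\<lambda>h. 2 * Re (cnj (deriv g z * h) * (deriv g z * e) + cnj (g z) * (deriv (deriv g) z * h * e)))"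
  define X where "X = 2 * Re (cnj (g z) * (deriv g z * e))"
  have num: "((\<lambda>w. 2 * Re (cnj (g w) * (deriv g w * e))) has_derivative A) (at z)"
    unfolding A_def by (auto intro!: derivative_eq_intros g g' simp: algebra_simps)
  note den = has_derivative_one_plus_norm_square[OF assms]
  define u' where "u' = (\<lambda>h. (A h * ?q - X * (2 * Re (cnj (g z) * (deriv g z * h)))) / (?q * ?q))"
  have "(log_sphere1 g e has_derivative u') (at z)"
    unfolding log_sphere1_def[abs_def] X_def u'_def using q
    by (intro has_derivative_divide'[OF num den]) auto
  moreover have "u' e = log_sphere2 g e z"
  proof -
    have "A e = 2 * ((norm (deriv g z * e))\<^sup>2 + Re (cnj (g z) * (deriv (deriv g) z * e * e)))"
      unfolding A_def by (simp only: plus_complex.sel mult.commute[of "cnj (deriv g z * e)"] complex_norm_square[symmetric])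
        (simp flip: of_real_power)
    moreover have "(A e * ?q - X * X) / (?q * ?q) = A e / ?q - (X / ?q)\<^sup>2"
      using q by (simp add: diff_divide_distrib power2_eq_square)
    ultimately show ?thesis
      unfolding u'_def log_sphere2_def log_sphere1_def X_def[symmetric] by (simp only:)
  qed
  ultimately show ?thesis
    by blast
qed

text \<open>The terms with g'' cancel because e^2 takes the values 1 and -1. The squares of the
  first derivatives add up to 4 |g g'|^2 / (1 + |g|^2)^2, and |g'|^2 (1 + |g|^2) - |g g'|^2 =
  |g'|^2.\<close>

lemma log_sphere_laplacian:
  "log_sphere2 g 1 z + log_sphere2 g \<i> z = 4 * (norm (deriv g z) / (1 + (norm (g z))\<^sup>2))\<^sup>2"
proof -
  let ?q = "1 + (norm (g z))\<^sup>2" and ?X = "cnj (g z) * deriv g z"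
  have q: "?q > 0"
    by (rule one_plus_square_pos)
  have "log_sphere2 g 1 z + log_sphere2 g \<i> z =
      4 * (norm (deriv g z))\<^sup>2 / ?q - ((2 * Re ?X / ?q)\<^sup>2 + (2 * Im ?X / ?q)\<^sup>2)"
  proof -
    have 1: "log_sphere1 g 1 z = 2 * Re ?X / ?q" and i: "log_sphere1 g \<i> z = - (2 * Im ?X / ?q)"
      by (simp_all add: log_sphere1_def algebra_simps diff_divide_distrib)
    show ?thesis
      unfolding log_sphere2_def 1 i power2_minus
      by (simp add: norm_mult add_divide_distrib[symmetric] diff_divide_distrib[symmetric] algebra_simps)
  qed
  also have "(2 * Re ?X / ?q)\<^sup>2 + (2 * Im ?X / ?q)\<^sup>2 = 4 * (norm ?X)\<^sup>2 / ?q\<^sup>2"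
  proof -
    have "(2 * a / q)\<^sup>2 + (2 * b / q)\<^sup>2 = 4 * (a\<^sup>2 + b\<^sup>2) / q\<^sup>2" for a b q :: real
      by (simp add: power_divide power_mult_distrib add_divide_distrib)
    then show ?thesis
      by (simp only: cmod_power2[of ?X])
  qed
  also have "4 * (norm (deriv g z))\<^sup>2 / ?q - 4 * (norm ?X)\<^sup>2 / ?q\<^sup>2 = 4 * (norm (deriv g z) / ?q)\<^sup>2"
  proof -
    have "4 * x\<^sup>2 / (1 + y\<^sup>2) - 4 * (y * x)\<^sup>2 / (1 + y\<^sup>2)\<^sup>2 = 4 * (x / (1 + y\<^sup>2))\<^sup>2" for x y :: real
    proof -
      have "1 + y\<^sup>2 \<noteq> 0"
        using one_plus_square_pos[of y] by simp
      then have "4 * x\<^sup>2 / (1 + y\<^sup>2) = 4 * x\<^sup>2 * (1 + y\<^sup>2) / (1 + y\<^sup>2)\<^sup>2"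
        by (simp add: power2_eq_square)
      then show ?thesis
        by (simp add: power_divide power_mult_distrib diff_divide_distrib[symmetric] algebra_simps)
    qed
    from this[of "norm (deriv g z)" "norm (g z)"] show ?thesis
      by (simp add: norm_mult)
  qed
  finally show ?thesis .
qed

lemma isCont_log_sphere2:
  assumes "g analytic_on {z}"
  shows "isCont (log_sphere2 g e) z"
proof -
  have "isCont g z" "isCont (deriv g) z" "isCont (deriv (deriv g)) z"
    using assms by (auto intro: analytic_at_imp_isCont analytic_deriv)
  then show ?thesis
    unfolding log_sphere2_def[abs_def] log_sphere1_def using one_plus_square_pos[of "norm (g z)"]
    by (intro continuous_intros) auto
qed

text \<open>Integration against the tent function with vertices \<open>q - h\<close>, \<open>q\<close>, \<open>q + h\<close>, whose second
  derivative is a combination of three point masses.\<close>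

lemma tent_integral:
  fixes \<phi> \<phi>1 \<phi>2 :: "real \<Rightarrow> real"
  assumes h: "h > 0"
    and d1: "\<And>x. x \<in> {q - h..q + h} \<Longrightarrow> (\<phi> has_real_derivative \<phi>1 x) (at x)"
    and d2: "\<And>x. x \<in> {q - h..q + h} \<Longrightarrow> (\<phi>1 has_real_derivative \<phi>2 x) (at x)"
  shows "((\<lambda>x. \<phi>2 x * (h - \<bar>x - q\<bar>)) has_integral \<phi> (q + h) - 2 * \<phi> q + \<phi> (q - h)) {q - h..q + h}"
proof -
  \<comment> \<open>Integration by parts on each half, with explicit antiderivatives. The
    contributions h \<phi>1(q) of the two halves have opposite signs and cancel in the sum.\<close>
  have l: "((\<lambda>x. \<phi>2 x * (h - \<bar>x - q\<bar>)) has_integral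
      (((q - (q - h)) * \<phi>1 q - \<phi> q) - (((q - h) - (q - h)) * \<phi>1 (q - h) - \<phi> (q - h)))) {q - h..q}"
  proof (rule fundamental_theorem_of_calculus[where f = "\<lambda>x. (x - (q - h)) * \<phi>1 x - \<phi> x"])
    fix x assume x: "x \<in> {q - h..q}"
    then have x': "x \<in> {q - h..q + h}"
      using h by auto
    have "((\<lambda>x. (x - (q - h)) * \<phi>1 x - \<phi> x) has_real_derivative \<phi>2 x * (x - (q - h))) (at x)"
      by (rule derivative_eq_intros d1[OF x'] d2[OF x'] refl)+ simp
    moreover have "x - (q - h) = h - \<bar>x - q\<bar>"
      using x by simp
    ultimately show "((\<lambda>x. (x - (q - h)) * \<phi>1 x - \<phi> x) has_vector_derivative \<phi>2 x * (h - \<bar>x - q\<bar>)) (at x within {q - h..q})"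
      unfolding has_real_derivative_iff_has_vector_derivative[symmetric]
      by (simp only: has_field_derivative_at_within)
  qed (use h in auto)
  have r: "((\<lambda>x. \<phi>2 x * (h - \<bar>x - q\<bar>)) has_integral
      ((((q + h) - (q + h)) * \<phi>1 (q + h) + \<phi> (q + h)) - (((q + h) - q) * \<phi>1 q + \<phi> q))) {q..q + h}"
  proof (rule fundamental_theorem_of_calculus[where f = "\<lambda>x. ((q + h) - x) * \<phi>1 x + \<phi> x"])
    fix x assume x: "x \<in> {q..q + h}"
    then have x': "x \<in> {q - h..q + h}"
      using h by auto
    have "((\<lambda>x. ((q + h) - x) * \<phi>1 x + \<phi> x) has_real_derivative \<phi>2 x * ((q + h) - x)) (at x)"
      by (rule derivative_eq_intros d1[OF x'] d2[OF x'] refl)+ simp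
    moreover have "(q + h) - x = h - \<bar>x - q\<bar>"
      using x by simp
    ultimately show "((\<lambda>x. ((q + h) - x) * \<phi>1 x + \<phi> x) has_vector_derivative \<phi>2 x * (h - \<bar>x - q\<bar>)) (at x within {q..q + h})"
      unfolding has_real_derivative_iff_has_vector_derivative[symmetric]
      by (simp only: has_field_derivative_at_within)
  qed (use h in auto)
  show ?thesis
    using has_integral_combine[OF _ _ l r] h by (simp add: algebra_simps)
qed

text \<open>Links the nonnegative integrals of the final estimates with iterated real integrals,
  where terms of either sign can be integrated by parts in one variable at a time.\<close>

lemma set_nn_integral_complex_rectangle:
  fixes f :: "complex \<Rightarrow> real"
  assumes f: "continuous_on (cbox (Complex a c) (Complex b d)) f"
    and nonneg: "\<And>w. w \<in> cbox (Complex a c) (Complex b d) \<Longrightarrow> f w \<ge> 0"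
  shows "(\<integral>\<^sup>+w\<in>cbox (Complex a c) (Complex b d). ennreal (f w) \<partial>lborel) =
    ennreal (integral {a..b} (\<lambda>x. integral {c..d} (\<lambda>y. f (Complex x y))))"
proof -
  let ?K = "cbox (Complex a c) (Complex b d)" and ?R = "cbox (a, c) (b, d)"
  define F where "F = (\<lambda>w. indicator ?K w *\<^sub>R f w)"
  have [measurable]: "F \<in> borel_measurable borel"
    unfolding F_def using f by (intro borel_measurable_continuous_on_indicator) auto
  have [measurable]: "(\<lambda>(x, y). Complex x y) \<in> borel_measurable (borel \<Otimes>\<^sub>M borel)"
    unfolding borel_prod by (intro borel_measurable_continuous_onI) (auto intro!: continuous_intros simp: case_prod_beta)
  have "(\<integral>\<^sup>+w\<in>?K. ennreal (f w) \<partial>lborel) = (\<integral>\<^sup>+w. ennreal (F w) \<partial>lborel)"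
    by (intro nn_integral_cong) (auto simp: F_def indicator_def)
  also have "\<dots> = (\<integral>\<^sup>+v. ennreal (F (case v of (x, y) \<Rightarrow> Complex x y)) \<partial>(lborel \<Otimes>\<^sub>M lborel))"
    by (subst lborel_complex_eq_distr_prod, subst nn_integral_distr) auto
  also have "\<dots> = (\<integral>\<^sup>+v. ennreal (F (case v of (x, y) \<Rightarrow> Complex x y)) \<partial>lborel)"
    by (simp add: lborel_prod)
  also have "\<dots> = ennreal (integral ?R (\<lambda>v. f (case v of (x, y) \<Rightarrow> Complex x y)))"
  proof (rule nn_integral_has_integral_lborel)
    show "(\<lambda>v. F (case v of (x, y) \<Rightarrow> Complex x y)) \<in> borel_measurable borel"
      unfolding borel_prod[symmetric] by measurable
    show "0 \<le> F (case v of (x, y) \<Rightarrow> Complex x y)" for v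
      using nonneg by (auto simp: F_def indicator_def)
    have "continuous_on ?R (\<lambda>v. f (case v of (x, y) \<Rightarrow> Complex x y))"
      by (rule continuous_on_compose2[OF f])
        (auto intro!: continuous_intros simp: case_prod_beta cbox_Pair_eq in_cbox_complex_iff)
    then have "((\<lambda>v. f (case v of (x, y) \<Rightarrow> Complex x y)) has_integral
        integral ?R (\<lambda>v. f (case v of (x, y) \<Rightarrow> Complex x y))) ?R"
      by (intro integrable_integral integrable_continuous)
    then show "((\<lambda>v. F (case v of (x, y) \<Rightarrow> Complex x y)) has_integral
        integral ?R (\<lambda>v. f (case v of (x, y) \<Rightarrow> Complex x y))) UNIV"
      by (subst (asm) has_integral_restrict_UNIV[symmetric], elim has_integral_eq[rotated])
        (auto simp: F_def indicator_def cbox_Pair_eq in_cbox_complex_iff)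
  qed
  also have "integral ?R (\<lambda>v. f (case v of (x, y) \<Rightarrow> Complex x y)) =
      integral {a..b} (\<lambda>x. integral {c..d} (\<lambda>y. f (Complex x y)))"
  proof -
    have "continuous_on ?R (\<lambda>v. f (case v of (x, y) \<Rightarrow> Complex x y))"
      by (rule continuous_on_compose2[OF f])
        (auto intro!: continuous_intros simp: case_prod_beta cbox_Pair_eq in_cbox_complex_iff)
    from integral_prod_continuous[OF this] show ?thesis
      by simp
  qed
  finally show ?thesis .
qed

text \<open>Used with \<open>G = g ^ N\<close> for \<open>g = f\<close> or \<open>g = 1 / f\<close>: then \<open>v\<close> does not depend on the choice of \<open>g\<close>, hence is
  smooth across the poles of \<open>f\<close>, and \<open>A1\<close>, \<open>A2\<close> are the spherical derivatives of \<open>f\<close> and \<open>f ^ N\<close>.\<close>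

definition sphere_chart ::
  "real \<Rightarrow> (complex \<Rightarrow> real) \<Rightarrow> (complex \<Rightarrow> real) \<Rightarrow> (complex \<Rightarrow> real) \<Rightarrow>
     (complex \<Rightarrow> complex) \<Rightarrow> (complex \<Rightarrow> complex) \<Rightarrow> complex \<Rightarrow> bool" where
  "sphere_chart N v A1 A2 g G x \<longleftrightarrow>
     g analytic_on {x} \<and> G analytic_on {x} \<and> v x = N * log_sphere g x - log_sphere G x \<and>
     A1 x = norm (deriv g x) / (1 + (norm (g x))\<^sup>2) \<and> A2 x = norm (deriv G x) / (1 + (norm (G x))\<^sup>2)"

lemma sphere_chart_dir_deriv:
  assumes "eventually (sphere_chart N v A1 A2 g G) (nhds w)"
  shows "eventually (\<lambda>x. ((\<lambda>t. v (x + of_real t * e)) has_real_derivative dir_deriv e v x) (at 0)) (nhds w)"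
    and "eventually (\<lambda>x. ((\<lambda>t. dir_deriv e v (x + of_real t * e)) has_real_derivative
           dir_deriv e (dir_deriv e v) x) (at 0)) (nhds w)"
    and "eventually (\<lambda>x. dir_deriv e (dir_deriv e v) x = N * log_sphere2 g e x - log_sphere2 G e x) (nhds w)"
proof -
  have ev: "eventually (\<lambda>x. eventually (sphere_chart N v A1 A2 g G) (nhds x)) (nhds w)"
    using assms by (simp add: eventually_eventually)
  have 1: "((\<lambda>t. v (x + of_real t * e)) has_real_derivative dir_deriv e v x) (at 0) \<and>
      dir_deriv e v x = N * log_sphere1 g e x - log_sphere1 G e x"
    if "eventually (sphere_chart N v A1 A2 g G) (nhds x)" for x
  proof -
    have "sphere_chart N v A1 A2 g G x"
      using that by (rule eventually_nhds_x_imp_x)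
    then have "((\<lambda>z. N * log_sphere g z - log_sphere G z) has_derivative
        (\<lambda>h. N * log_sphere1 g h x - log_sphere1 G h x)) (at x)"
      by (intro has_derivative_diff has_derivative_mult_right has_derivative_log_sphere)
        (auto simp: sphere_chart_def)
    moreover have "eventually (\<lambda>z. v z = N * log_sphere g z - log_sphere G z) (nhds x)"
      using that by eventually_elim (simp add: sphere_chart_def)
    ultimately show ?thesis
      using has_derivative_imp_dir_deriv[of "\<lambda>z. N * log_sphere g z - log_sphere G z" _ x v e] by simp
  qed
  show "eventually (\<lambda>x. ((\<lambda>t. v (x + of_real t * e)) has_real_derivative dir_deriv e v x) (at 0)) (nhds w)"
    using ev by eventually_elim (use 1 in blast)
  have 2: "((\<lambda>t. dir_deriv e v (x + of_real t * e)) has_real_derivative dir_deriv e (dir_deriv e v) x) (at 0) \<and>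
      dir_deriv e (dir_deriv e v) x = N * log_sphere2 g e x - log_sphere2 G e x"
    if ev: "eventually (\<lambda>x. eventually (sphere_chart N v A1 A2 g G) (nhds x)) (nhds x)" for x
  proof -
    have "sphere_chart N v A1 A2 g G x"
      using eventually_nhds_x_imp_x[OF ev] by (rule eventually_nhds_x_imp_x)
    then have an: "g analytic_on {x}" "G analytic_on {x}"
      by (auto simp: sphere_chart_def)
    obtain u1 u2 where u: "(log_sphere1 g e has_derivative u1) (at x)" "u1 e = log_sphere2 g e x"
        "(log_sphere1 G e has_derivative u2) (at x)" "u2 e = log_sphere2 G e x"
      using has_derivative_log_sphere1[OF an(1), of e] has_derivative_log_sphere1[OF an(2), of e] by blast
    have D: "((\<lambda>z. N * log_sphere1 g e z - log_sphere1 G e z) has_derivative (\<lambda>h. N * u1 h - u2 h)) (at x)"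
      by (intro has_derivative_diff has_derivative_mult_right u)
    have E: "eventually (\<lambda>z. dir_deriv e v z = N * log_sphere1 g e z - log_sphere1 G e z) (nhds x)"
      using ev by eventually_elim (use 1 in blast)
    show ?thesis
      using has_derivative_imp_dir_deriv[OF D E, of e] u(2,4) by (simp only: simp_thms)
  qed
  \<comment> \<open>The formula for the first derivative must hold around \<open>x\<close> before it
    can be differentiated at \<open>x\<close>, hence one more layer of
    \<open>eventually\<close>.\<close>
  have ev2: "eventually (\<lambda>x. eventually (\<lambda>x. eventually (sphere_chart N v A1 A2 g G) (nhds x)) (nhds x)) (nhds w)"
    using ev by (simp only: eventually_eventually)
  show "eventually (\<lambda>x. ((\<lambda>t. dir_deriv e v (x + of_real t * e)) has_real_derivative
           dir_deriv e (dir_deriv e v) x) (at 0)) (nhds w)"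
    using ev2 by eventually_elim (use 2 in blast)
  show "eventually (\<lambda>x. dir_deriv e (dir_deriv e v) x = N * log_sphere2 g e x - log_sphere2 G e x) (nhds w)"
    using ev2 by eventually_elim (use 2 in blast)
qed

lemma isCont_spherical_quotient:
  assumes "g analytic_on {z}"
  shows "isCont (\<lambda>w. norm (deriv g w) / (1 + (norm (g w))\<^sup>2)) z"
  using analytic_spherical_tendsto[OF assms] by (simp add: isCont_def)

text \<open>Since \<open>v\<close> has Laplacian \<open>4 (N A1\<^sup>2 - A2\<^sup>2)\<close>, integrating it against a tent function of \<open>Re w\<close> leaves only
  values of \<open>v\<close>: the \<open>y\<close>-derivatives drop out by periodicity.\<close>

lemma half_plane_inequality:
  fixes v A1 A2 :: "complex \<Rightarrow> real" and N :: real
  assumes chart: "\<And>w. Re w < 0 \<Longrightarrow> \<exists>g G. eventually (sphere_chart N v A1 A2 g G) (nhds w)"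
    and N: "N \<ge> 0"
    and v: "\<And>w. Re w < 0 \<Longrightarrow> v w \<ge> 0 \<and> v w \<le> B"
    and periodic: "\<And>w. v (w + 2 * of_real pi * \<i>) = v w"
    and h: "h > 0" and qh: "q + h < 0"
  shows "(\<integral>\<^sup>+w\<in>cbox (Complex (q - h) 0) (Complex (q + h) (2 * pi)). ennreal (N * (A1 w)\<^sup>2 * (h - \<bar>Re w - q\<bar>)) \<partial>lborel) \<le>
    (\<integral>\<^sup>+w\<in>cbox (Complex (q - h) 0) (Complex (q + h) (2 * pi)). ennreal ((A2 w)\<^sup>2 * (h - \<bar>Re w - q\<bar>)) \<partial>lborel) + ennreal (pi * B)"
proof -
  let ?p = "q - h" and ?r = "q + h"
  let ?K = "cbox (Complex ?p 0) (Complex ?r (2 * pi))"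
  define \<psi> where "\<psi> x = h - \<bar>x - q\<bar>" for x
  define D1 where "D1 e = dir_deriv e v" for e
  define D2 where "D2 e = dir_deriv e (D1 e)" for e
  have B: "B \<ge> 0"
    using v[of "-1"] by simp
  have d1: "((\<lambda>t. v (w + of_real t * e)) has_real_derivative D1 e w) (at 0)"
    and d2: "((\<lambda>t. D1 e (w + of_real t * e)) has_real_derivative D2 e w) (at 0)"
    and cont2: "isCont (D2 e) w" and lap: "D2 1 w + D2 \<i> w = 4 * (N * (A1 w)\<^sup>2 - (A2 w)\<^sup>2)"
    and contA: "isCont A1 w" "isCont A2 w" if w: "Re w < 0" for w e
  proof -
    obtain g G where ch: "eventually (sphere_chart N v A1 A2 g G) (nhds w)"
      using chart[OF w] by blast
    have chw: "sphere_chart N v A1 A2 g G w"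
      using ch by (rule eventually_nhds_x_imp_x)
    then have an: "g analytic_on {w}" "G analytic_on {w}"
      by (auto simp: sphere_chart_def)
    note dd = sphere_chart_dir_deriv[OF ch, folded D1_def D2_def]
    show "((\<lambda>t. v (w + of_real t * e)) has_real_derivative D1 e w) (at 0)"
      using dd(1) by (rule eventually_nhds_x_imp_x)
    show "((\<lambda>t. D1 e (w + of_real t * e)) has_real_derivative D2 e w) (at 0)"
      using dd(2) by (rule eventually_nhds_x_imp_x)
    have "isCont (\<lambda>x. N * log_sphere2 g e x - log_sphere2 G e x) w"
      using an by (intro continuous_intros isCont_log_sphere2)
    then show "isCont (D2 e) w"
      using isCont_cong[OF dd(3)] by simp
    have "D2 e w = N * log_sphere2 g e w - log_sphere2 G e w" for e
      using dd(3) by (rule eventually_nhds_x_imp_x)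
    then have "D2 1 w + D2 \<i> w = N * (log_sphere2 g 1 w + log_sphere2 g \<i> w) - (log_sphere2 G 1 w + log_sphere2 G \<i> w)"
      by (simp add: distrib_left)
    then show "D2 1 w + D2 \<i> w = 4 * (N * (A1 w)\<^sup>2 - (A2 w)\<^sup>2)"
      using chw unfolding log_sphere_laplacian sphere_chart_def by simp
    have "eventually (\<lambda>x. A1 x = norm (deriv g x) / (1 + (norm (g x))\<^sup>2)) (nhds w)"
      "eventually (\<lambda>x. A2 x = norm (deriv G x) / (1 + (norm (G x))\<^sup>2)) (nhds w)"
      using ch by (eventually_elim, simp add: sphere_chart_def)+
    from this[THEN isCont_cong] show "isCont A1 w" "isCont A2 w"
      using an isCont_spherical_quotient by auto
  qed
  have K: "Re w < 0" if "w \<in> ?K" for w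
    using that qh by (auto simp: in_cbox_complex_iff)
  \<comment> \<open>Second derivatives of \<open>v\<close> have no definite sign, so the computation
    uses real integrals over the rectangle; \<open>nn\<close> returns to \<open>ennreal\<close> for
    the two nonnegative terms.\<close>
  define J where "J f = integral (cbox (?p, 0) (?r, 2 * pi)) (\<lambda>v. f (Complex (fst v) (snd v)))" for f :: "complex \<Rightarrow> real"
  have cont: "continuous_on (cbox (?p, 0) (?r, 2 * pi)) (\<lambda>v. f (Complex (fst v) (snd v)))"
    if "\<And>w. Re w < 0 \<Longrightarrow> isCont f w" for f :: "complex \<Rightarrow> real"
  proof (rule continuous_on_compose2[of "{w. Re w < 0}" f])
    show "continuous_on {w. Re w < 0} f"
      using that by (auto intro: continuous_at_imp_continuous_on)
    show "continuous_on (cbox (?p, 0) (?r, 2 * pi)) (\<lambda>v. Complex (fst v) (snd v))"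
      by (auto intro!: continuous_intros)
  qed (use qh in \<open>auto simp: cbox_Pair_eq\<close>)
  have intg: "(\<lambda>v. f (Complex (fst v) (snd v))) integrable_on cbox (?p, 0) (?r, 2 * pi)"
    if "\<And>w. Re w < 0 \<Longrightarrow> isCont f w" for f :: "complex \<Rightarrow> real"
    using cont[OF that] by (rule integrable_continuous)
  have J: "J f = integral {?p..?r} (\<lambda>x. integral {0..2 * pi} (\<lambda>y. f (Complex x y)))"
    if "\<And>w. Re w < 0 \<Longrightarrow> isCont f w" for f :: "complex \<Rightarrow> real"
    unfolding J_def using integral_prod_continuous[OF cont[OF that]] by simp
  have c\<psi>: "isCont (\<lambda>w. \<psi> (Re w)) w" for w
    unfolding \<psi>_def by (intro continuous_intros isCont_Re[OF continuous_ident])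
  have \<psi>0: "\<psi> (Re w) \<ge> 0" if "w \<in> ?K" for w
    using that by (auto simp: \<psi>_def in_cbox_complex_iff)
  have nn: "(\<integral>\<^sup>+w\<in>?K. ennreal (f w) \<partial>lborel) = ennreal (J f)"
    if "\<And>w. Re w < 0 \<Longrightarrow> isCont f w" "\<And>w. w \<in> ?K \<Longrightarrow> f w \<ge> 0" for f :: "complex \<Rightarrow> real"
  proof -
    have "continuous_on ?K f"
      using that(1) K by (auto intro: continuous_at_imp_continuous_on)
    then show ?thesis
      using set_nn_integral_complex_rectangle[OF _ that(2)] J[OF that(1)] by simp
  qed
  have cA: "isCont (\<lambda>w. N * (A1 w)\<^sup>2 * \<psi> (Re w)) w" "isCont (\<lambda>w. (A2 w)\<^sup>2 * \<psi> (Re w)) w"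
    "isCont (\<lambda>w. D2 e w * \<psi> (Re w)) w" if "Re w < 0" for w e
    using c\<psi> contA cont2 that by (auto intro!: continuous_intros)
  have "4 * (J (\<lambda>w. N * (A1 w)\<^sup>2 * \<psi> (Re w)) - J (\<lambda>w. (A2 w)\<^sup>2 * \<psi> (Re w))) =
      integral (cbox (?p, 0) (?r, 2 * pi)) (\<lambda>v. 4 * (N * (A1 (Complex (fst v) (snd v)))\<^sup>2 * \<psi> (fst v) -
        (A2 (Complex (fst v) (snd v)))\<^sup>2 * \<psi> (fst v)))"
    unfolding J_def using intg[OF cA(1)] intg[OF cA(2)]
    by (subst integral_mult_right, subst integral_diff) auto
  also have "\<dots> = integral (cbox (?p, 0) (?r, 2 * pi)) (\<lambda>v. D2 1 (Complex (fst v) (snd v)) * \<psi> (fst v) +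
      D2 \<i> (Complex (fst v) (snd v)) * \<psi> (fst v))"
  proof (rule integral_cong)
    fix v :: "real \<times> real" assume "v \<in> cbox (?p, 0) (?r, 2 * pi)"
    then have "Re (Complex (fst v) (snd v)) < 0"
      using qh by (auto simp: cbox_Pair_eq)
    from lap[OF this] show "4 * (N * (A1 (Complex (fst v) (snd v)))\<^sup>2 * \<psi> (fst v) -
        (A2 (Complex (fst v) (snd v)))\<^sup>2 * \<psi> (fst v)) = D2 1 (Complex (fst v) (snd v)) * \<psi> (fst v) +
      D2 \<i> (Complex (fst v) (snd v)) * \<psi> (fst v)"
      by (simp only: distrib_right[symmetric] left_diff_distrib[symmetric] mult.assoc[symmetric])
  qed
  also have "\<dots> = J (\<lambda>w. D2 1 w * \<psi> (Re w)) + J (\<lambda>w. D2 \<i> w * \<psi> (Re w))"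
    unfolding J_def using intg[OF cA(3)] by (subst integral_add) auto
  also have "J (\<lambda>w. D2 \<i> w * \<psi> (Re w)) = 0"
  proof -
    have "integral {0..2 * pi} (\<lambda>y. D2 \<i> (Complex x y) * \<psi> x) = 0" if x: "x \<in> {?p..?r}" for x
    proof -
      have "((\<lambda>y. D2 \<i> (Complex x y)) has_integral D1 \<i> (Complex x (2 * pi)) - D1 \<i> (Complex x 0)) {0..2 * pi}"
      proof (rule fundamental_theorem_of_calculus)
        fix y
        have "((\<lambda>t. D1 \<i> (Complex x (t + y))) has_real_derivative D2 \<i> (Complex x y)) (at 0)"
          using d2[of "Complex x y" \<i>] x qh by (simp add: Complex_eq algebra_simps)
        then have "((\<lambda>t. D1 \<i> (Complex x t)) has_real_derivative D2 \<i> (Complex x y)) (at y)"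
          using DERIV_shift[of "\<lambda>t. D1 \<i> (Complex x t)" "D2 \<i> (Complex x y)" 0 y] by simp
        then show "((\<lambda>t. D1 \<i> (Complex x t)) has_vector_derivative D2 \<i> (Complex x y)) (at y within {0..2 * pi})"
          unfolding has_real_derivative_iff_has_vector_derivative[symmetric]
          by (rule has_field_derivative_at_within)
      qed simp
      moreover have "D1 \<i> (Complex x (2 * pi)) = D1 \<i> (Complex x 0)"
      proof -
        have "v (Complex x (2 * pi) + of_real t * \<i>) = v (Complex x 0 + of_real t * \<i>)" for t
          using periodic[of "Complex x 0 + of_real t * \<i>"] by (simp add: Complex_eq algebra_simps)
        then show ?thesis
          by (simp add: D1_def dir_deriv_def)
      qed
      ultimately have "((\<lambda>y. D2 \<i> (Complex x y)) has_integral 0) {0..2 * pi}"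
        by simp
      from has_integral_mult_left[OF this, of "\<psi> x"]
      have "((\<lambda>y. D2 \<i> (Complex x y) * \<psi> x) has_integral 0) {0..2 * pi}"
        by simp
      then show ?thesis
        by (rule integral_unique)
    qed
    then have "integral {?p..?r} (\<lambda>x. integral {0..2 * pi} (\<lambda>y. D2 \<i> (Complex x y) * \<psi> x)) = integral {?p..?r} (\<lambda>x. 0)"
      by (intro integral_cong)
    then show ?thesis
      using J[OF cA(3)] by simp
  qed
  \<comment> \<open>The x-integral is the second difference v(q+h) - 2 v(q) + v(q-h), at most 2 B
    because 0 \<le> v \<le> B. Integration over height 2 pi gives 4 pi B, and the factor 4 of the
    Laplacian leaves pi B.\<close>
  also have "J (\<lambda>w. D2 1 w * \<psi> (Re w)) \<le> 4 * pi * B"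
  proof -
    have le: "integral {?p..?r} (\<lambda>x. D2 1 (Complex x y) * \<psi> x) \<le> 2 * B" for y
    proof -
      have "((\<lambda>x. D2 1 (Complex x y) * (h - \<bar>x - q\<bar>)) has_integral
          v (Complex (q + h) y) - 2 * v (Complex q y) + v (Complex (q - h) y)) {?p..?r}"
      proof (rule tent_integral[OF h, where \<phi> = "\<lambda>x. v (Complex x y)" and ?\<phi>1.0 = "\<lambda>x. D1 1 (Complex x y)"])
        fix x assume x: "x \<in> {?p..?r}"
        have "((\<lambda>t. v (Complex (t + x) y)) has_real_derivative D1 1 (Complex x y)) (at 0)"
          using d1[of "Complex x y" 1] x qh by (simp add: Complex_eq algebra_simps)
        then show "((\<lambda>t. v (Complex t y)) has_real_derivative D1 1 (Complex x y)) (at x)"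
          using DERIV_shift[of "\<lambda>t. v (Complex t y)" "D1 1 (Complex x y)" 0 x] by simp
        have "((\<lambda>t. D1 1 (Complex (t + x) y)) has_real_derivative D2 1 (Complex x y)) (at 0)"
          using d2[of "Complex x y" 1] x qh by (simp add: Complex_eq algebra_simps)
        then show "((\<lambda>t. D1 1 (Complex t y)) has_real_derivative D2 1 (Complex x y)) (at x)"
          using DERIV_shift[of "\<lambda>t. D1 1 (Complex t y)" "D2 1 (Complex x y)" 0 x] by simp
      qed
      then have "integral {?p..?r} (\<lambda>x. D2 1 (Complex x y) * \<psi> x) =
          v (Complex (q + h) y) - 2 * v (Complex q y) + v (Complex (q - h) y)"
        by (simp add: \<psi>_def integral_unique)
      then show ?thesis
        using v[of "Complex (q + h) y"] v[of "Complex q y"] v[of "Complex (q - h) y"] h qh by simp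
    qed
    have c: "continuous_on (cbox (?p, 0) (?r, 2 * pi)) (\<lambda>(x, y). D2 1 (Complex x y) * \<psi> x)"
      using cont[OF cA(3)] by (simp add: case_prod_beta)
    have "J (\<lambda>w. D2 1 w * \<psi> (Re w)) = integral {0..2 * pi} (\<lambda>y. integral {?p..?r} (\<lambda>x. D2 1 (Complex x y) * \<psi> x))"
      using J[OF cA(3)] integral_swap_continuous[OF c] by simp
    also have "\<dots> \<le> integral {0..2 * pi} (\<lambda>y. 2 * B)"
    proof (rule integral_le)
      have "continuous_on (cbox (0, ?p) (2 * pi, ?r)) (\<lambda>(y, x). D2 1 (Complex x y) * \<psi> x)"
        using c by (rule swap_continuous)
      from integral_integrable_2dim[OF this]
      show "(\<lambda>y. integral {?p..?r} (\<lambda>x. D2 1 (Complex x y) * \<psi> x)) integrable_on {0..2 * pi}"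
        by simp
    qed (use le in auto)
    finally show ?thesis
      by simp
  qed
  finally have *: "J (\<lambda>w. N * (A1 w)\<^sup>2 * \<psi> (Re w)) \<le> J (\<lambda>w. (A2 w)\<^sup>2 * \<psi> (Re w)) + pi * B"
    by simp
  have "J (\<lambda>w. (A2 w)\<^sup>2 * \<psi> (Re w)) \<ge> 0"
    unfolding J_def by (intro integral_nonneg intg[OF cA(2)])
      (use \<psi>0[of "Complex _ _"] in \<open>auto simp: cbox_Pair_eq in_cbox_complex_iff\<close>)
  then have "ennreal (J (\<lambda>w. N * (A1 w)\<^sup>2 * \<psi> (Re w))) \<le> ennreal (J (\<lambda>w. (A2 w)\<^sup>2 * \<psi> (Re w))) + ennreal (pi * B)"
    using * B by (simp add: ennreal_plus[symmetric] del: ennreal_plus)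
  then show ?thesis
    using nn[OF cA(1)] nn[OF cA(2)] \<psi>0 N by (simp add: \<psi>_def)
qed

section \<open>Transfer from the half-plane to the disc\<close>

lemma disc_aut_eq_Moebius: "disc_aut b z = - Moebius_function 0 b z"
  by (simp add: disc_aut_def Moebius_function_def minus_divide_left)

lemma disc_aut_in_ball:
  assumes "b \<in> ball 0 1" "z \<in> ball 0 1"
  shows "disc_aut b z \<in> ball 0 1"
  using Moebius_function_norm_lt_1[of b z 0] assms by (simp add: disc_aut_eq_Moebius)

lemma disc_aut_holomorphic:
  assumes "b \<in> ball 0 1"
  shows "disc_aut b holomorphic_on ball 0 1"
  using Moebius_function_holomorphic[of b 0] assms
  unfolding disc_aut_eq_Moebius[abs_def] by (auto intro!: holomorphic_intros)

lemma disc_aut_involution: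
  assumes "b \<in> ball 0 1" "z \<in> ball 0 1"
  shows "disc_aut b (disc_aut b z) = z"
proof -
  have "- Moebius_function 0 b (- y) = Moebius_function 0 (- b) y" for y
    by (simp add: Moebius_function_simple minus_divide_left add.commute)
  then have "disc_aut b (disc_aut b z) = Moebius_function 0 (- b) (Moebius_function 0 b z)"
    unfolding disc_aut_eq_Moebius by simp
  also have "\<dots> = z"
    using assms by (intro Moebius_function_compose) auto
  finally show ?thesis .
qed

text \<open>Both quantities are comparable with max(1, t)^N; the constant 2^N comes from 1 + t \<le>
  2 max(1, t).\<close>

lemma add_power_le_power_add:
  fixes t :: real
  assumes "t \<ge> 0" "N \<ge> 1"
  shows "1 + t ^ N \<le> (1 + t) ^ N" "(1 + t) ^ N \<le> 2 ^ N * (1 + t ^ N)"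
proof -
  show "1 + t ^ N \<le> (1 + t) ^ N"
    using assms(2)
  proof (induction N rule: dec_induct)
    case (step n)
    have "1 + t ^ Suc n \<le> (1 + t) * (1 + t ^ n)"
      using assms(1) by (simp add: algebra_simps)
    also have "\<dots> \<le> (1 + t) * (1 + t) ^ n"
      using step assms(1) by (intro mult_left_mono) auto
    finally show ?case
      by simp
  qed simp
  show "(1 + t) ^ N \<le> 2 ^ N * (1 + t ^ N)"
  proof (cases "t \<le> 1")
    case True
    then have "(1 + t) ^ N \<le> 2 ^ N * 1"
      using assms(1) power_mono[of "1 + t" 2 N] by simp
    also have "\<dots> \<le> 2 ^ N * (1 + t ^ N)"
      using assms(1) by (intro mult_left_mono) auto
    finally show ?thesis .
  next
    case False
    then have "(1 + t) ^ N \<le> (2 * t) ^ N"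
      by (intro power_mono) auto
    also have "\<dots> \<le> 2 ^ N * (1 + t ^ N)"
      by (simp add: power_mult_distrib)
    finally show ?thesis .
  qed
qed

text \<open>\<open>1 + t ^ N\<close> and \<open>(1 + t) ^ N\<close> with t = |f|^2 differ by a
  factor between 1 and 2^N. As the bound depends on N alone, so does the constant in the energy
  comparison.\<close>

lemma log_sphere_power_bounds:
  assumes "N \<ge> 1"
  shows "0 \<le> real N * log_sphere f z - log_sphere (\<lambda>w. f w ^ N) z"
    "real N * log_sphere f z - log_sphere (\<lambda>w. f w ^ N) z \<le> real N * ln 2"
proof -
  define t where "t = (norm (f z))\<^sup>2"
  have t: "t \<ge> 0"
    by (simp add: t_def)
  have ls: "log_sphere f z = ln (1 + t)" "log_sphere (\<lambda>w. f w ^ N) z = ln (1 + t ^ N)"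
    by (simp_all add: log_sphere_def t_def norm_power power_mult[symmetric] mult.commute)
  have pos: "1 + t ^ N > 0"
    using t by (intro add_pos_nonneg) auto
  have "ln (1 + t ^ N) \<le> ln ((1 + t) ^ N)"
    using add_power_le_power_add(1)[OF t assms] pos t by (subst ln_le_cancel_iff) auto
  moreover have "ln ((1 + t) ^ N) \<le> ln (2 ^ N * (1 + t ^ N))"
    using add_power_le_power_add(2)[OF t assms] pos t by (subst ln_le_cancel_iff) auto
  moreover have "ln ((1 + t) ^ N) = real N * ln (1 + t)"
    by (rule ln_realpow)
  moreover have "ln (2 ^ N * (1 + t ^ N)) = real N * ln 2 + ln (1 + t ^ N)"
    using pos by (simp add: ln_mult ln_realpow)
  ultimately show "0 \<le> real N * log_sphere f z - log_sphere (\<lambda>w. f w ^ N) z"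
    "real N * log_sphere f z - log_sphere (\<lambda>w. f w ^ N) z \<le> real N * ln 2"
    by (simp_all add: ls)
qed

text \<open>Replacing f by 1/f subtracts N ln |f|^2 from both terms, so the difference does not
  change; this is what carries it smoothly across poles. Where \<open>f z = 0\<close>, the
  convention \<open>inverse 0 = 0\<close> makes the two sides coincide.\<close>

lemma log_sphere_power_inverse:
  "real N * log_sphere (\<lambda>w. inverse (f w)) z - log_sphere (\<lambda>w. inverse (f w) ^ N) z =
   real N * log_sphere f z - log_sphere (\<lambda>w. f w ^ N) z"
proof (cases "f z = 0")
  case False
  define t where "t = (norm (f z))\<^sup>2"
  have t: "t > 0"
    using False by (simp add: t_def)
  have ls: "log_sphere f z = ln (1 + t)" "log_sphere (\<lambda>w. f w ^ N) z = ln (1 + t ^ N)"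
    "log_sphere (\<lambda>w. inverse (f w)) z = ln (1 + inverse t)"
    "log_sphere (\<lambda>w. inverse (f w) ^ N) z = ln (1 + inverse (t ^ N))"
    by (simp_all add: log_sphere_def t_def norm_power norm_inverse power_mult[symmetric] mult.commute power_inverse)
  have *: "ln (1 + inverse s) = ln (1 + s) - ln s" if "s > 0" for s :: real
  proof -
    have "1 + inverse s = (1 + s) / s"
      using that by (simp add: field_simps)
    then show ?thesis
      using that by (simp add: ln_div)
  qed
  show ?thesis
    unfolding ls using t by (simp add: * ln_realpow algebra_simps)
qed (cases "N = 0"; simp add: log_sphere_def)

text \<open>By the chain rule composition with h multiplies spherical derivatives by |h'|. The
  square of this factor is the Jacobian, so the energy integrals are conformally invariant.\<close>

lemma eventually_sphere_chart_comp:
  assumes f: "f analytic_on {h w}" and h: "h holomorphic_on S" "open S" "w \<in> S"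
  shows "eventually (sphere_chart (real N)
      (\<lambda>w. real N * log_sphere f (h w) - log_sphere (\<lambda>z. f z ^ N) (h w))
      (\<lambda>w. spherical_deriv f (h w) * norm (deriv h w))
      (\<lambda>w. spherical_deriv (\<lambda>z. f z ^ N) (h w) * norm (deriv h w))
      (\<lambda>w. f (h w)) (\<lambda>w. f (h w) ^ N)) (nhds w)"
proof -
  have "isCont h w"
    using h holomorphic_on_imp_continuous_on continuous_on_eq_continuous_at by blast
  then have "filterlim h (nhds (h w)) (nhds w)"
    by (simp add: isCont_def tendsto_at_iff_tendsto_nhds)
  from eventually_compose_filterlim[OF analytic_at_imp_eventually_analytic[OF f] this]
  have "eventually (\<lambda>x. f analytic_on {h x}) (nhds w)" .
  moreover have "eventually (\<lambda>x. x \<in> S) (nhds w)"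
    using h by (intro eventually_nhds_in_open)
  ultimately show ?thesis
  proof eventually_elim
    case (elim x)
    have hx: "h analytic_on {x}"
      using h elim by (meson analytic_on_holomorphic holomorphic_on_imp_analytic_at)
    have comp: "(\<lambda>w. g (h w)) analytic_on {x}" 
      "norm (deriv (\<lambda>w. g (h w)) x) / (1 + (norm (g (h x)))\<^sup>2) = spherical_deriv g (h x) * norm (deriv h x)"
      if g: "g analytic_on {h x}" for g
    proof -
      show "(\<lambda>w. g (h w)) analytic_on {x}"
        using analytic_on_compose[OF hx, of g] g by (simp add: o_def)
      have "((\<lambda>w. g (h w)) has_field_derivative deriv g (h x) * deriv h x) (at x)"
        using DERIV_chain2[OF analytic_derivI[OF g] analytic_derivI[OF hx]] by simp
      then show "norm (deriv (\<lambda>w. g (h w)) x) / (1 + (norm (g (h x)))\<^sup>2) = spherical_deriv g (h x) * norm (deriv h x)"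
        by (simp add: DERIV_imp_deriv norm_mult spherical_deriv_analytic[OF g])
    qed
    have F: "(\<lambda>z. f z ^ N) analytic_on {h x}"
      using elim by (intro analytic_on_power)
    show ?case
      unfolding sphere_chart_def using comp[OF elim(1)] comp[OF F] by (simp add: log_sphere_def)
  qed
qed

lemma AE_lborel_Im_neq: "AE w in lborel. Im w \<noteq> c"
proof -
  have "negligible {w :: complex. w \<bullet> \<i> = c}"
    by (intro negligible_standard_hyperplane) (simp add: Basis_complex_def)
  from AE_not_in[OF this[unfolded negligible_iff_null_sets]] show ?thesis
    by (simp add: AE_completion_iff)
qed

text \<open>The map \<open>w \<mapsto> disc_aut b (exp w)\<close> pulls \<open>ln |disc_aut b z|\<close> back to \<open>Re w\<close>, and the tent functions exhaust
  \<open>max 0 (R - Re w)\<close>. For \<open>b = 0\<close> this is the comparison of the Ahlfors--Shimizu characteristics of \<open>f\<close>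
  and \<open>f ^ N\<close>.\<close>

lemma disc_inequality:
  assumes f: "sphere_analytic_on f (ball 0 1)" and N: "N \<ge> 1" and b: "b \<in> ball 0 1" and R: "R \<le> 0"
  shows "(\<integral>\<^sup>+z\<in>ball 0 1. ennreal (real N * (spherical_deriv f z)\<^sup>2 * max 0 (R - ln (norm (disc_aut b z)))) \<partial>lborel) \<le>
    (\<integral>\<^sup>+z\<in>ball 0 1. ennreal ((spherical_deriv (\<lambda>w. f w ^ N) z)\<^sup>2 * max 0 (R - ln (norm (disc_aut b z)))) \<partial>lborel)
      + ennreal (pi * (real N * ln 2))"
proof -
  define F where "F = (\<lambda>w. f w ^ N)"
  define H where "H = {w :: complex. Re w < 0}"
  \<comment> \<open>On this open strip exp is injective, and its image is the unit disc without the
    real segment from 0 to 1.\<close>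
  define S where "S = {w. Re w < 0 \<and> 0 < Im w \<and> Im w < 2 * pi}"
  define h where "h = (\<lambda>w. disc_aut b (exp w))"
  have H: "open H" and S: "open S" and SH: "S \<subseteq> H"
    unfolding H_def S_def by (auto simp: open_halfspace_Re_lt open_halfspace_Im_gt open_halfspace_Im_lt intro!: open_Collect_conj)
  have [measurable]: "S \<in> sets borel"
    using S by auto
  have expH: "exp w \<in> ball 0 1" if "w \<in> H" for w
    using that by (simp add: H_def norm_exp_eq_Re)
  have hH: "h w \<in> ball 0 1" if "w \<in> H" for w
    unfolding h_def using b expH[OF that] by (rule disc_aut_in_ball)
  have holH: "h holomorphic_on H"
  proof -
    have "exp ` H \<subseteq> ball 0 1"
      using expH by blast
    from holomorphic_on_compose_gen[OF holomorphic_on_exp disc_aut_holomorphic[OF b] this]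
    show ?thesis
      by (simp add: o_def h_def)
  qed
  then have hol: "h holomorphic_on S"
    using SH by (rule holomorphic_on_subset)
  have hinv: "disc_aut b (h w) = exp w" if "w \<in> H" for w
    unfolding h_def by (rule disc_aut_involution[OF b expH[OF that]])
  have inj: "inj_on h S"
  proof (rule inj_onI)
    fix w w' assume w: "w \<in> S" "w' \<in> S" "h w = h w'"
    then have "disc_aut b (h w) = exp w" "disc_aut b (h w') = exp w'"
      using hinv w(1,2) SH by blast+
    then have e: "exp w = exp w'"
      using w(3) by simp
    have "\<bar>Im w - Im w'\<bar> < 2 * pi"
      using w(1,2) unfolding S_def mem_Collect_eq by linarith
    then show "w = w'"
      using e by (rule exp_complex_eqI)
  qed
  have img: "h ` S \<subseteq> ball 0 1"
    using hH SH by auto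
  then have bdd: "bounded (h ` S)"
    using bounded_ball bounded_subset by blast
  have lnh: "ln (norm (disc_aut b (h w))) = Re w" if "w \<in> H" for w
    using hinv[OF that] by (simp add: norm_exp_eq_Re)
  \<comment> \<open>Points of the disc missed by \<open>h\<close> lie in the image of the real
    diameter under \<open>disc_aut b\<close>, and differentiable maps send null sets to null
    sets.\<close>
  have ae: "AE z in lborel. z \<in> ball 0 1 \<longrightarrow> z \<in> h ` S"
  proof -
    let ?L = "{z. z \<bullet> \<i> = 0} \<inter> ball 0 1"
    have "negligible {z :: complex. z \<bullet> \<i> = 0}"
      by (intro negligible_standard_hyperplane) (simp add: Basis_complex_def)
    then have "negligible ?L"
      by (rule negligible_subset) auto
    moreover have "disc_aut b differentiable_on ?L"
      using disc_aut_holomorphic[OF b] holomorphic_on_imp_differentiable_on holomorphic_on_subset by blast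
    ultimately have "negligible (disc_aut b ` ?L)"
      by (intro negligible_differentiable_image_negligible) auto
    then have "AE z in lebesgue. z \<notin> disc_aut b ` ?L"
      by (intro AE_not_in) (simp add: negligible_iff_null_sets)
    moreover have "z \<in> h ` S" if z: "z \<in> ball 0 1" "z \<notin> disc_aut b ` ?L" for z
    proof -
      define u where "u = disc_aut b z"
      have u: "u \<in> ball 0 1" "disc_aut b u = z"
        unfolding u_def using disc_aut_in_ball[OF b z(1)] disc_aut_involution[OF b z(1)] by auto
      then have "Im u \<noteq> 0"
        using z(2) by auto
      then have u0: "u \<noteq> 0" "u \<notin> \<real>"
        by (auto simp: complex_is_Real_iff)
      define w where "w = Complex (ln (norm u)) (Arg2pi u)"
      have "exp w = of_real (norm u) * exp (\<i> * of_real (Arg2pi u))"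
        using u0 by (simp add: w_def Complex_eq exp_add exp_of_real)
      also have "\<dots> = u"
        by (rule Arg2pi_eq[symmetric])
      finally have "h w = z"
        using u by (simp add: h_def)
      moreover have "w \<in> S"
        using u u0 Arg2pi[of u] Arg2pi_eq_0[of u] by (auto simp: S_def w_def ln_less_zero order.order_iff_strict)
      ultimately show ?thesis
        by blast
    qed
    ultimately have "AE z in lebesgue. z \<in> ball 0 1 \<longrightarrow> z \<in> h ` S"
      by (auto elim!: eventually_mono)
    then show ?thesis
      by (simp add: AE_completion_iff)
  qed
  have contS: "continuous_on (ball 0 1) (spherical_deriv g)" if "sphere_analytic_on g (ball 0 1)" for g
    using that spherical_deriv_isCont by (auto simp: sphere_analytic_on_def intro!: continuous_at_imp_continuous_on)
  have cov: "(\<integral>\<^sup>+z\<in>ball 0 1. ennreal (c * (spherical_deriv g z)\<^sup>2 * max 0 (R - ln (norm (disc_aut b z)))) \<partial>lborel) =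
      (\<integral>\<^sup>+w\<in>S. ennreal (c * (spherical_deriv g (h w) * norm (deriv h w))\<^sup>2 * max 0 (R - Re w)) \<partial>lborel)"
    if g: "sphere_analytic_on g (ball 0 1)" and c: "c \<ge> 0" for g c
  proof -
    define g0 where "g0 = (\<lambda>z. indicator (ball 0 1) z *\<^sub>R spherical_deriv g z)"
    have [measurable]: "g0 \<in> borel_measurable borel"
      unfolding g0_def using contS[OF g] by (intro borel_measurable_continuous_on_indicator) auto
    define q where "q z = ennreal (c * (g0 z)\<^sup>2 * max 0 (R - ln (norm (disc_aut b z))))" for z
    have q: "q \<in> borel_measurable borel"
      unfolding q_def disc_aut_def by measurable
    have "(\<integral>\<^sup>+z\<in>ball 0 1. ennreal (c * (spherical_deriv g z)\<^sup>2 * max 0 (R - ln (norm (disc_aut b z)))) \<partial>lborel) =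
        (\<integral>\<^sup>+z\<in>h ` S. q z \<partial>lborel)"
      by (rule nn_integral_cong_AE, rule AE_mp[OF ae])
        (use img in \<open>auto simp: q_def g0_def indicator_def intro!: AE_I2\<close>)
    also have "\<dots> = (\<integral>\<^sup>+w\<in>S. q (h w) * ennreal ((norm (deriv h w))\<^sup>2) \<partial>lborel)"
      by (rule nn_integral_holomorphic_image[OF S hol inj bdd q])
    also have "\<dots> = (\<integral>\<^sup>+w\<in>S. ennreal (c * (spherical_deriv g (h w) * norm (deriv h w))\<^sup>2 * max 0 (R - Re w)) \<partial>lborel)"
    proof (rule nn_integral_cong)
      fix w
      show "q (h w) * ennreal ((norm (deriv h w))\<^sup>2) * indicator S w =
          ennreal (c * (spherical_deriv g (h w) * norm (deriv h w))\<^sup>2 * max 0 (R - Re w)) * indicator S w"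
      proof (cases "w \<in> S")
        case True
        then have "w \<in> H"
          using SH by auto
        have "q (h w) = ennreal (c * (spherical_deriv g (h w))\<^sup>2 * max 0 (R - Re w))"
          using hH[OF \<open>w \<in> H\<close>] by (simp add: q_def g0_def lnh[OF \<open>w \<in> H\<close>])
        then show ?thesis
          using c by (simp add: ennreal_mult[symmetric] power_mult_distrib mult_ac)
      qed simp
    qed
    finally show ?thesis .
  qed
  define A1 where "A1 = (\<lambda>w. spherical_deriv f (h w) * norm (deriv h w))"
  define A2 where "A2 = (\<lambda>w. spherical_deriv F (h w) * norm (deriv h w))"
  define v where "v = (\<lambda>w. real N * log_sphere f (h w) - log_sphere F (h w))"
  have F: "sphere_analytic_on F (ball 0 1)"
    unfolding F_def using f by (rule sphere_analytic_on_power)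
  have chart: "\<exists>g G. eventually (sphere_chart (real N) v A1 A2 g G) (nhds w)" if "w \<in> H" for w
  proof (cases "f analytic_on {h w}")
    case True
    from eventually_sphere_chart_comp[OF True holH H that] show ?thesis
      unfolding v_def A1_def A2_def F_def by blast
  next
    case False
    then have "(\<lambda>z. inverse (f z)) analytic_on {h w}"
      using f hH[OF that] by (auto simp: sphere_analytic_on_def)
    from eventually_sphere_chart_comp[OF this holH H that, of N]
    have "eventually (sphere_chart (real N)
      (\<lambda>w. real N * log_sphere (\<lambda>z. inverse (f z)) (h w) - log_sphere (\<lambda>z. inverse (f z) ^ N) (h w))
      (\<lambda>w. spherical_deriv (\<lambda>z. inverse (f z)) (h w) * norm (deriv h w))
      (\<lambda>w. spherical_deriv (\<lambda>z. inverse (f z) ^ N) (h w) * norm (deriv h w))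
      (\<lambda>w. inverse (f (h w))) (\<lambda>w. inverse (f (h w)) ^ N)) (nhds w)" .
    moreover have "eventually (\<lambda>x. x \<in> H) (nhds w)"
      using H that by (intro eventually_nhds_in_open)
    ultimately have "eventually (sphere_chart (real N) v A1 A2
        (\<lambda>w. inverse (f (h w))) (\<lambda>w. inverse (f (h w)) ^ N)) (nhds w)"
    proof eventually_elim
      case (elim x)
      have fx: "sphere_analytic_on f {h x}" and Fx: "sphere_analytic_on F {h x}"
        using f F hH[OF elim(2)] by (auto simp: sphere_analytic_on_def)
      have "spherical_deriv (\<lambda>z. inverse (f z) ^ N) (h x) = spherical_deriv F (h x)"
        using spherical_deriv_inverse[OF Fx] by (simp add: F_def power_inverse)
      then show ?case
        using elim spherical_deriv_inverse[OF fx]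
        by (simp add: sphere_chart_def v_def A1_def A2_def log_sphere_power_inverse F_def)
    qed
    then show ?thesis
      by blast
  qed
  have periodic: "v (w + 2 * of_real pi * \<i>) = v w" for w
    by (simp add: v_def h_def exp_add)
  have vb: "v w \<ge> 0 \<and> v w \<le> real N * ln 2" for w
    unfolding v_def F_def using log_sphere_power_bounds[OF N] by blast
  \<comment> \<open>Tents of half-width i + 1 whose right foot \<open>RR i\<close> increases to R.
    Staying strictly left of R \<le> 0 keeps the closed rectangles inside the half-plane, where
    charts exist.\<close>
  define hh where "hh i = real i + 1" for i
  define RR where "RR i = R - 1 / (real i + 1)" for i
  define qq where "qq i = RR i - hh i" for i
  define t where "t i x = max 0 (hh i - \<bar>x - qq i\<bar>)" for i x
  have hh: "hh i > 0" "qq i + hh i < 0" "RR i < R" for i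
  proof -
    have "1 / (real i + 1) > 0"
      by simp
    then show "hh i > 0" "qq i + hh i < 0" "RR i < R"
      using R unfolding hh_def qq_def RR_def by linarith+
  qed
  have t_le: "t i x \<le> max 0 (R - x)" for i x
    using hh(3)[of i] by (auto simp: t_def qq_def)
  have inc: "incseq (\<lambda>i. t i x)" for x
  proof (rule incseq_SucI)
    fix i
    \<comment> \<open>The right arm rises because \<open>RR\<close> increases; the left foot
      \<open>RR i - 2 * hh i\<close> moves to the left because \<open>RR\<close> gains at most 1
      while \<open>2 * hh\<close> gains 2.\<close>
    have "0 \<le> 1 / (real i + 1) - 1 / (real (Suc i) + 1)" "1 / (real i + 1) - 1 / (real (Suc i) + 1) \<le> 1"
    proof -
      have "1 / (real (Suc i) + 1) \<le> 1 / (real i + 1)"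
        by (intro divide_left_mono) auto
      then show "0 \<le> 1 / (real i + 1) - 1 / (real (Suc i) + 1)"
        by simp
      have "1 / (real i + 1) \<le> 1" "0 \<le> 1 / (real (Suc i) + 1)"
        by auto
      then show "1 / (real i + 1) - 1 / (real (Suc i) + 1) \<le> 1"
        by linarith
    qed
    then have "RR i \<le> RR (Suc i)" "RR (Suc i) \<le> RR i + 1" "hh (Suc i) = hh i + 1"
      by (auto simp: RR_def hh_def)
    then show "t i x \<le> t (Suc i) x"
      by (auto simp: t_def qq_def)
  qed
  have lim: "(\<lambda>i. t i x) \<longlonglongrightarrow> max 0 (R - x)" for x
  proof -
    have "(\<lambda>i. 1 / (real i + 1)) \<longlonglongrightarrow> 0"
      using LIMSEQ_inverse_real_of_nat by (simp add: inverse_eq_divide add.commute)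
    then have "(\<lambda>i. max 0 (RR i - x)) \<longlonglongrightarrow> max 0 (R - 0 - x)"
      unfolding RR_def by (intro tendsto_intros)
    \<comment> \<open>For large i the point \<open>x\<close> lies to the right of the vertex, where
      only the right arm matters.\<close>
    moreover have "eventually (\<lambda>i. max 0 (RR i - x) = t i x) sequentially"
    proof (rule eventually_mono[OF eventually_ge_at_top[of "nat \<lceil>R - x\<rceil>"]])
      fix i assume "nat \<lceil>R - x\<rceil> \<le> i"
      then have "R - x \<le> real i"
        by linarith
      then show "max 0 (RR i - x) = t i x"
        using hh(3)[of i] by (auto simp: t_def qq_def hh_def)
    qed
    ultimately show ?thesis
      by (simp add: Lim_transform_eventually)
  qed
  have contA: "continuous_on S A1" "continuous_on S A2"
  proof -
    have "continuous_on S h"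
      using hol by (rule holomorphic_on_imp_continuous_on)
    then have "continuous_on S (\<lambda>w. spherical_deriv g (h w))" if "sphere_analytic_on g (ball 0 1)" for g
      using continuous_on_compose2[OF contS[OF that] _ img] by blast
    moreover have "continuous_on S (deriv h)"
      using hol S by (intro holomorphic_on_imp_continuous_on holomorphic_deriv)
    ultimately show "continuous_on S A1" "continuous_on S A2"
      unfolding A1_def A2_def using f F by (auto intro!: continuous_intros)
  qed
  define a1 where "a1 = (\<lambda>w. indicator S w *\<^sub>R A1 w)"
  have a1[measurable]: "a1 \<in> borel_measurable borel"
    unfolding a1_def using contA by (intro borel_measurable_continuous_on_indicator) auto
  \<comment> \<open>A limit over the tents is taken on the left side only. On the right each tent is
    below max 0 (R - Re w), so one bound serves all i.\<close>
  let ?I2 = "(\<integral>\<^sup>+w\<in>S. ennreal ((A2 w)\<^sup>2 * max 0 (R - Re w)) \<partial>lborel)"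
  have le: "(\<integral>\<^sup>+w. ennreal (real N * (a1 w)\<^sup>2 * t i (Re w)) \<partial>lborel) \<le> ?I2 + ennreal (pi * (real N * ln 2))" for i
  proof -
    let ?K = "cbox (Complex (qq i - hh i) 0) (Complex (qq i + hh i) (2 * pi))"
    have tK: "t i (Re w) = hh i - \<bar>Re w - qq i\<bar>" if "w \<in> ?K" for w
      using that by (auto simp: t_def in_cbox_complex_iff)
    have "(\<integral>\<^sup>+w. ennreal (real N * (a1 w)\<^sup>2 * t i (Re w)) \<partial>lborel) \<le>
        (\<integral>\<^sup>+w\<in>?K. ennreal (real N * (A1 w)\<^sup>2 * (hh i - \<bar>Re w - qq i\<bar>)) \<partial>lborel)"
    proof (rule nn_integral_mono)
      fix w
      show "ennreal (real N * (a1 w)\<^sup>2 * t i (Re w)) \<le>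
          ennreal (real N * (A1 w)\<^sup>2 * (hh i - \<bar>Re w - qq i\<bar>)) * indicator ?K w"
      proof (cases "w \<in> S \<and> t i (Re w) \<noteq> 0")
        case True
        then have "w \<in> ?K"
          by (auto simp: S_def t_def in_cbox_complex_iff max_def split: if_splits)
        then show ?thesis
          using True tK[of w] by (simp add: a1_def)
      next
        case False
        then show ?thesis
          by (auto simp: a1_def)
      qed
    qed
    also have "\<dots> \<le> (\<integral>\<^sup>+w\<in>?K. ennreal ((A2 w)\<^sup>2 * (hh i - \<bar>Re w - qq i\<bar>)) \<partial>lborel) + ennreal (pi * (real N * ln 2))"
      by (rule half_plane_inequality[where v = v]) (use chart vb periodic hh in \<open>auto simp: H_def\<close>)
    also have "(\<integral>\<^sup>+w\<in>?K. ennreal ((A2 w)\<^sup>2 * (hh i - \<bar>Re w - qq i\<bar>)) \<partial>lborel) \<le> ?I2"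
    proof (rule nn_integral_mono_AE)
      have "AE w in lborel. Im w \<noteq> 0 \<and> Im w \<noteq> 2 * pi"
        using AE_lborel_Im_neq[of 0] AE_lborel_Im_neq[of "2 * pi"] by eventually_elim simp
      then show "AE w in lborel. ennreal ((A2 w)\<^sup>2 * (hh i - \<bar>Re w - qq i\<bar>)) * indicator ?K w \<le>
          ennreal ((A2 w)\<^sup>2 * max 0 (R - Re w)) * indicator S w"
      proof eventually_elim
        case (elim w)
        show ?case
        proof (cases "w \<in> ?K")
          case True
          then have "w \<in> S"
            using elim hh(2)[of i] by (auto simp: S_def in_cbox_complex_iff)
          moreover have "(A2 w)\<^sup>2 * t i (Re w) \<le> (A2 w)\<^sup>2 * max 0 (R - Re w)"
            by (intro mult_left_mono t_le) auto
          ultimately show ?thesis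
            using True tK[OF True] by (simp add: ennreal_leI)
        qed simp
      qed
    qed
    finally show ?thesis
      by (simp add: add_right_mono)
  qed
  have "(\<integral>\<^sup>+w\<in>S. ennreal (real N * (A1 w)\<^sup>2 * max 0 (R - Re w)) \<partial>lborel) =
      (\<integral>\<^sup>+w. (SUP i. ennreal (real N * (a1 w)\<^sup>2 * t i (Re w))) \<partial>lborel)"
  proof (rule nn_integral_cong)
    fix w
    have "incseq (\<lambda>i. ennreal (real N * (a1 w)\<^sup>2 * t i (Re w)))"
      using inc[of "Re w"] by (auto simp: incseq_def intro!: ennreal_leI mult_left_mono)
    then have "(\<lambda>i. ennreal (real N * (a1 w)\<^sup>2 * t i (Re w))) \<longlonglongrightarrow> (SUP i. ennreal (real N * (a1 w)\<^sup>2 * t i (Re w)))"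
      by (rule LIMSEQ_SUP)
    moreover have "(\<lambda>i. ennreal (real N * (a1 w)\<^sup>2 * t i (Re w))) \<longlonglongrightarrow> ennreal (real N * (a1 w)\<^sup>2 * max 0 (R - Re w))"
      by (intro tendsto_ennrealI tendsto_mult_left lim)
    ultimately have "(SUP i. ennreal (real N * (a1 w)\<^sup>2 * t i (Re w))) = ennreal (real N * (a1 w)\<^sup>2 * max 0 (R - Re w))"
      by (rule LIMSEQ_unique)
    then show "ennreal (real N * (A1 w)\<^sup>2 * max 0 (R - Re w)) * indicator S w =
        (SUP i. ennreal (real N * (a1 w)\<^sup>2 * t i (Re w)))"
      by (simp add: a1_def indicator_def)
  qed
  also have "\<dots> = (SUP i. \<integral>\<^sup>+w. ennreal (real N * (a1 w)\<^sup>2 * t i (Re w)) \<partial>lborel)"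
  proof (rule nn_integral_monotone_convergence_SUP)
    show "incseq (\<lambda>i w. ennreal (real N * (a1 w)\<^sup>2 * t i (Re w)))"
      using inc by (auto simp: incseq_def le_fun_def intro!: ennreal_leI mult_left_mono)
    show "(\<lambda>w. ennreal (real N * (a1 w)\<^sup>2 * t i (Re w))) \<in> borel_measurable lborel" for i
      unfolding t_def by measurable
  qed
  also have "\<dots> \<le> ?I2 + ennreal (pi * (real N * ln 2))"
    by (rule SUP_least) (rule le)
  finally show ?thesis
    using cov[OF f, of "real N"] cov[OF F, of 1] by (simp add: A1_def A2_def F_def)
qed

section \<open>Growth conditions\<close>

lemma eventually_to_unit_circle:
  "eventually P to_unit_circle \<longleftrightarrow> (\<exists>r. 0 \<le> r \<and> r < 1 \<and> (\<forall>z. r < norm z \<and> norm z < 1 \<longrightarrow> P z))"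
proof
  assume "eventually P to_unit_circle"
  then obtain Q where Q: "eventually Q (at_left (1::real))" "\<And>z. Q (norm z) \<Longrightarrow> P z"
    by (auto simp: to_unit_circle_def eventually_filtercomap)
  obtain b where b: "b < 1" "\<And>y. b < y \<Longrightarrow> y < 1 \<Longrightarrow> Q y"
    using Q(1) by (auto simp: eventually_at_left_field)
  show "\<exists>r. 0 \<le> r \<and> r < 1 \<and> (\<forall>z. r < norm z \<and> norm z < 1 \<longrightarrow> P z)"
    using b Q(2) by (intro exI[of _ "max b 0"]) auto
next
  assume "\<exists>r. 0 \<le> r \<and> r < 1 \<and> (\<forall>z. r < norm z \<and> norm z < 1 \<longrightarrow> P z)"
  then obtain r where r: "r < 1" "\<And>z. r < norm z \<Longrightarrow> norm z < 1 \<Longrightarrow> P z"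
    by blast
  have "eventually (\<lambda>x. x \<in> {r<..<1}) (at_left (1::real))"
    using r(1) by (rule eventually_at_left_real)
  then show "eventually P to_unit_circle"
    unfolding to_unit_circle_def eventually_filtercomap using r(2) by force
qed

lemma eventually_in_disc: "eventually (\<lambda>z. z \<in> ball 0 1) to_unit_circle"
  unfolding eventually_to_unit_circle by (intro exI[of _ 0]) auto

text \<open>What the passage from f^N to f needs of a comparison function: a positive lower bound
  for the compact part, and near the circle a disc of radius 1 / (2 \<Phi> a) inside the unit disc
  on which \<Phi> at most doubles. The inequality 2 |a| - 1 < |z| keeps that disc near the circle,
  for the little-o statements.\<close>

definition growth_weight :: "(complex \<Rightarrow> real) \<Rightarrow> bool" where
  "growth_weight \<Phi> \<longleftrightarrow> (\<exists>c>0. \<forall>z\<in>ball 0 1. c \<le> \<Phi> z) \<and>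
     eventually (\<lambda>a. \<forall>z\<in>ball a (1 / (2 * \<Phi> a)).
       z \<in> ball 0 1 \<and> 2 * norm a - 1 < norm z \<and> \<Phi> z \<le> 2 * \<Phi> a) to_unit_circle"

lemma growth_weight_disc: "growth_weight (\<lambda>z. 1 / (1 - norm z))"
  unfolding growth_weight_def
proof (intro conjI exI[of _ 1] ballI)
  show "1 \<le> 1 / (1 - norm z)" if "z \<in> ball 0 1" for z :: complex
    using that by (simp add: field_simps)
  show "eventually (\<lambda>a. \<forall>z\<in>ball a (1 / (2 * (1 / (1 - norm a)))).
       z \<in> ball 0 1 \<and> 2 * norm a - 1 < norm z \<and> 1 / (1 - norm z) \<le> 2 * (1 / (1 - norm a))) to_unit_circle"
    using eventually_in_disc
  proof eventually_elim
    case (elim a)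
    show ?case
    proof
      fix z assume "z \<in> ball a (1 / (2 * (1 / (1 - norm a))))"
      then have "norm (a - z) < (1 - norm a) / 2"
        by (simp add: dist_norm)
      moreover have "norm a \<le> norm z + norm (a - z)" "norm z \<le> norm a + norm (a - z)"
        using norm_triangle_sub[of a z] norm_triangle_sub[of z a] by (simp_all add: norm_minus_commute)
      moreover have "norm a < 1"
        using elim by simp
      ultimately have *: "norm z < 1" "2 * norm a - 1 < norm z" "(1 - norm a) / 2 \<le> 1 - norm z" "0 < (1 - norm a) / 2"
        by auto
      have "1 / (1 - norm z) \<le> 1 / ((1 - norm a) / 2)"
        using *(3,4) by (intro divide_left_mono) auto
      then show "z \<in> ball 0 1 \<and> 2 * norm a - 1 < norm z \<and> 1 / (1 - norm z) \<le> 2 * (1 / (1 - norm a))"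
        using * by simp
    qed
  qed
qed simp

text \<open>The uniform limit on the closed unit disc with tolerance 1 gives the doubling on discs
  of radius 1/\<phi>(|a|), and \<phi>(r) (1 - r) \<ge> 1 near the circle gives room for half that
  radius.\<close>

lemma growth_weight_smoothly_increasing:
  assumes "smoothly_increasing \<phi>"
  shows "growth_weight (\<lambda>z. \<phi> (norm z))"
  unfolding growth_weight_def
proof (intro conjI exI[of _ "\<phi> 0"] ballI)
  have mono: "mono_on {0..<1} \<phi>" and pos: "\<And>r. r \<in> {0..<1} \<Longrightarrow> \<phi> r > 0"
    using assms by (auto simp: smoothly_increasing_def)
  show "\<phi> 0 > 0"
    by (rule pos) simp
  show "\<phi> 0 \<le> \<phi> (norm z)" if "z \<in> ball 0 1" for z :: complex
    using mono by (rule mono_onD) (use that in auto)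
  have "eventually (\<lambda>r. 1 \<le> \<phi> r * (1 - r)) (at_left 1)"
    using assms by (auto simp: smoothly_increasing_def filterlim_at_top)
  then have ev1: "eventually (\<lambda>a. 1 \<le> \<phi> (norm a) * (1 - norm a)) to_unit_circle"
    unfolding to_unit_circle_def by (rule eventually_filtercomapI)
  have "uniform_limit (cball 0 1) (\<lambda>a z. \<phi> (norm (a + z / complex_of_real (\<phi> (norm a)))) / \<phi> (norm a))
          (\<lambda>_. 1) to_unit_circle"
    using assms by (auto simp: smoothly_increasing_def)
  from uniform_limitD[OF this, of 1]
  have ev2: "eventually (\<lambda>a. \<forall>z\<in>cball 0 1. dist (\<phi> (norm (a + z / complex_of_real (\<phi> (norm a)))) / \<phi> (norm a)) 1 < 1) to_unit_circle"
    by simp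
  show "eventually (\<lambda>a. \<forall>z\<in>ball a (1 / (2 * \<phi> (norm a))).
       z \<in> ball 0 1 \<and> 2 * norm a - 1 < norm z \<and> \<phi> (norm z) \<le> 2 * \<phi> (norm a)) to_unit_circle"
    using ev1 ev2 eventually_in_disc
  proof eventually_elim
    case (elim a)
    have a: "norm a < 1"
      using elim by simp
    have p: "\<phi> (norm a) > 0"
      using a by (intro pos) auto
    have le: "1 / \<phi> (norm a) \<le> 1 - norm a"
      using elim(1) p by (simp add: field_simps)
    show ?case
    proof
      fix z assume "z \<in> ball a (1 / (2 * \<phi> (norm a)))"
      then have z: "norm (a - z) < (1 / \<phi> (norm a)) / 2"
        by (simp add: dist_norm)
      moreover have "norm a \<le> norm z + norm (a - z)" "norm z \<le> norm a + norm (a - z)"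
        using norm_triangle_sub[of a z] norm_triangle_sub[of z a] by (simp_all add: norm_minus_commute)
      ultimately have *: "norm z < 1" "2 * norm a - 1 < norm z"
        using le a by auto
      define \<zeta> where "\<zeta> = (z - a) * complex_of_real (\<phi> (norm a))"
      have "norm \<zeta> = norm (a - z) * \<phi> (norm a)"
        using p by (simp add: \<zeta>_def norm_mult norm_minus_commute)
      also have "\<dots> \<le> (1 / \<phi> (norm a)) / 2 * \<phi> (norm a)"
        using z p by (intro mult_right_mono) auto
      finally have "\<zeta> \<in> cball 0 1"
        using p by simp
      moreover have "a + \<zeta> / complex_of_real (\<phi> (norm a)) = z"
        using p by (simp add: \<zeta>_def)
      ultimately have "dist (\<phi> (norm z) / \<phi> (norm a)) 1 < 1"
        using elim(2) by metis
      then have "\<phi> (norm z) / \<phi> (norm a) < 2"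
        by (simp add: dist_real_def abs_less_iff)
      then have "\<phi> (norm z) \<le> 2 * \<phi> (norm a)"
        using p by (simp add: field_simps)
      then show "z \<in> ball 0 1 \<and> 2 * norm a - 1 < norm z \<and> \<phi> (norm z) \<le> 2 * \<phi> (norm a)"
        using * by simp
    qed
  qed
qed

lemma growth_bound_of_power:
  assumes gw: "growth_weight \<Phi>" and f: "sphere_analytic_on f (ball 0 1)" and N: "N \<ge> 1"
    and B: "\<And>z. z \<in> ball 0 1 \<Longrightarrow> spherical_deriv (\<lambda>w. f w ^ N) z \<le> B * \<Phi> z"
  shows "\<exists>B'. \<forall>z\<in>ball 0 1. spherical_deriv f z \<le> B' * \<Phi> z"
proof -
  obtain c where c: "c > 0" "\<And>z. z \<in> ball 0 1 \<Longrightarrow> c \<le> \<Phi> z"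
    using gw by (auto simp: growth_weight_def)
  obtain r where r: "0 \<le> r" "r < 1" "\<And>a z. r < norm a \<Longrightarrow> norm a < 1 \<Longrightarrow> z \<in> ball a (1 / (2 * \<Phi> a)) \<Longrightarrow>
      z \<in> ball 0 1 \<and> \<Phi> z \<le> 2 * \<Phi> a"
    using gw unfolding growth_weight_def eventually_to_unit_circle by metis
  \<comment> \<open>\<open>M\<close> shrinks the radius to \<rho> = 1 / (2 \<Phi>(a) M), so that B
    \<Phi>(z) \<le> (1/4)^N / \<rho> on the disc: the local lemma with e = 1/4. Since M \<ge> 1, the
    disc remains admissible.\<close>
  define M where "M = max 1 (B * 4 ^ N)"
  have M: "M \<ge> 1" "B * 4 ^ N \<le> M"
    by (auto simp: M_def)
  have near: "spherical_deriv f a \<le> 5 * M * \<Phi> a" if a: "r < norm a" "norm a < 1" for a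
  proof -
    have \<Phi>: "\<Phi> a > 0"
      using c a by (metis dist_0_norm less_le_trans mem_ball)
    define \<rho> where "\<rho> = 1 / (2 * \<Phi> a * M)"
    have \<rho>: "\<rho> > 0"
      using \<Phi> M by (simp add: \<rho>_def)
    have "\<rho> \<le> 1 / (2 * \<Phi> a)"
      unfolding \<rho>_def using \<Phi> M by (intro divide_left_mono) auto
    then have sub: "z \<in> ball 0 1 \<and> \<Phi> z \<le> 2 * \<Phi> a" if "z \<in> ball a \<rho>" for z
      using that r(3)[OF a, of z] by (simp add: subset_ball[THEN subsetD])
    have "spherical_deriv f a \<le> 10 * (1 / 4) / \<rho>"
    proof (rule spherical_deriv_le_of_power[OF _ \<rho> N])
      show "sphere_analytic_on f (ball a \<rho>)"
        using f sub by (auto simp: sphere_analytic_on_def)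
      show "(1 / 4) ^ N \<le> (1 / 4 :: real)"
        using N power_decreasing[of 1 N "1 / 4 :: real"] by simp
      fix z assume "z \<in> ball a \<rho>"
      note z = sub[OF this]
      have "spherical_deriv (\<lambda>w. f w ^ N) z \<le> B * \<Phi> z"
        using z by (intro B) auto
      also have "\<dots> \<le> (M / 4 ^ N) * \<Phi> z"
        using M c(1) c(2)[of z] z by (intro mult_right_mono) (auto simp: field_simps)
      also have "\<dots> \<le> (M / 4 ^ N) * (2 * \<Phi> a)"
        using M z by (intro mult_left_mono) auto
      also have "\<dots> = (1 / 4) ^ N / \<rho>"
        by (simp add: \<rho>_def power_divide)
      finally show "spherical_deriv (\<lambda>w. f w ^ N) z \<le> (1 / 4) ^ N / \<rho>" .
    qed auto
    then show ?thesis
      by (simp add: \<rho>_def mult_ac)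
  qed
  \<comment> \<open>On the remaining compact disc continuity gives a bound, which \<Phi> \<ge> c
    turns into a multiple of \<Phi>.\<close>
  have "cball 0 r \<subseteq> ball (0 :: complex) 1"
    using r by auto
  then have "continuous_on (cball 0 r) (spherical_deriv f)"
    using f spherical_deriv_isCont by (auto simp: sphere_analytic_on_def intro!: continuous_at_imp_continuous_on)
  then have "bdd_above (spherical_deriv f ` cball 0 r)"
    by (intro bounded_imp_bdd_above compact_imp_bounded compact_continuous_image compact_cball)
  then obtain L where L: "\<And>z. z \<in> cball 0 r \<Longrightarrow> spherical_deriv f z \<le> L"
    unfolding bdd_above_def by blast
  have "spherical_deriv f z \<le> max (5 * M) (max L 0 / c) * \<Phi> z" if z: "z \<in> ball 0 1" for z
  proof (cases "r < norm z")
    case True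
    then have "spherical_deriv f z \<le> 5 * M * \<Phi> z"
      using z by (intro near) auto
    also have "\<dots> \<le> max (5 * M) (max L 0 / c) * \<Phi> z"
      using c(1) c(2)[OF z] by (intro mult_right_mono) auto
    finally show ?thesis .
  next
    case False
    then have "spherical_deriv f z \<le> max L 0"
      using L[of z] by simp
    also have "\<dots> = max L 0 / c * c"
      using c(1) by simp
    also have "\<dots> \<le> max (5 * M) (max L 0 / c) * \<Phi> z"
      using c(1) c(2)[OF z] M by (intro mult_mono) auto
    finally show ?thesis .
  qed
  then show ?thesis
    by blast
qed

lemma growth_small_of_power:
  assumes gw: "growth_weight \<Phi>" and f: "sphere_analytic_on f (ball 0 1)" and N: "N \<ge> 1"
    and small: "\<And>\<epsilon>. \<epsilon> > 0 \<Longrightarrow> eventually (\<lambda>z. spherical_deriv (\<lambda>w. f w ^ N) z \<le> \<epsilon> * \<Phi> z) to_unit_circle"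
    and \<epsilon>: "\<epsilon> > 0"
  shows "eventually (\<lambda>z. spherical_deriv f z \<le> \<epsilon> * \<Phi> z) to_unit_circle"
proof -
  obtain c where c: "c > 0" "\<And>z. z \<in> ball 0 1 \<Longrightarrow> c \<le> \<Phi> z"
    using gw by (auto simp: growth_weight_def)
  obtain r where r: "0 \<le> r" "r < 1" "\<And>a z. r < norm a \<Longrightarrow> norm a < 1 \<Longrightarrow> z \<in> ball a (1 / (2 * \<Phi> a)) \<Longrightarrow>
      z \<in> ball 0 1 \<and> 2 * norm a - 1 < norm z \<and> \<Phi> z \<le> 2 * \<Phi> a"
    using gw unfolding growth_weight_def eventually_to_unit_circle by metis
  \<comment> \<open>Here the radius stays 1 / (2 \<Phi>(a)) and \<open>e\<close> is small instead:
    the local lemma yields 10 e / \<rho> = 20 e \<Phi>(a), whence \<epsilon> / 20.\<close>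
  define e where "e = min (\<epsilon> / 20) (1 / 4)"
  have e: "e > 0" "e \<le> 1 / 4" "20 * e \<le> \<epsilon>"
    using \<epsilon> by (auto simp: e_def)
  have "e ^ N > 0"
    using e by simp
  from small[OF this] obtain r' where r': "0 \<le> r'" "r' < 1"
    "\<And>z. r' < norm z \<Longrightarrow> norm z < 1 \<Longrightarrow> spherical_deriv (\<lambda>w. f w ^ N) z \<le> e ^ N * \<Phi> z"
    unfolding eventually_to_unit_circle by metis
  \<comment> \<open>Beyond (1 + r') / 2 one has 2 |a| - 1 > r', so the estimate for f^N is available
    on the whole disc around \<open>a\<close>.\<close>
  have "spherical_deriv f a \<le> \<epsilon> * \<Phi> a" if a: "max r ((1 + r') / 2) < norm a" "norm a < 1" for a
  proof -
    have \<Phi>: "\<Phi> a > 0"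
      using c a by (metis dist_0_norm less_le_trans mem_ball)
    define \<rho> where "\<rho> = 1 / (2 * \<Phi> a)"
    have \<rho>: "\<rho> > 0"
      using \<Phi> by (simp add: \<rho>_def)
    have sub: "z \<in> ball 0 1 \<and> 2 * norm a - 1 < norm z \<and> \<Phi> z \<le> 2 * \<Phi> a" if "z \<in> ball a \<rho>" for z
      using that r(3)[of a z] a by (simp add: \<rho>_def)
    have "spherical_deriv f a \<le> 10 * e / \<rho>"
    proof (rule spherical_deriv_le_of_power[OF _ \<rho> N e(1)])
      show "sphere_analytic_on f (ball a \<rho>)"
        using f sub by (auto simp: sphere_analytic_on_def)
      have "e ^ N \<le> e ^ 1"
        using e N by (intro power_decreasing) auto
      then show "e ^ N \<le> 1 / 4"
        using e by simp
      fix z assume "z \<in> ball a \<rho>"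
      note z = sub[OF this]
      have "spherical_deriv (\<lambda>w. f w ^ N) z \<le> e ^ N * \<Phi> z"
        using z a by (intro r'(3)) auto
      also have "\<dots> \<le> e ^ N * (2 * \<Phi> a)"
        using e z by (intro mult_left_mono) auto
      also have "\<dots> = e ^ N / \<rho>"
        by (simp add: \<rho>_def)
      finally show "spherical_deriv (\<lambda>w. f w ^ N) z \<le> e ^ N / \<rho>" .
    qed
    also have "\<dots> = 20 * e * \<Phi> a"
      by (simp add: \<rho>_def)
    also have "\<dots> \<le> \<epsilon> * \<Phi> a"
      using e \<Phi> by (intro mult_right_mono) auto
    finally show ?thesis .
  qed
  then show ?thesis
    unfolding eventually_to_unit_circle using r r' by (intro exI[of _ "max r ((1 + r') / 2)"]) auto
qed

text \<open>Resetting the unspecified values of \<open>f\<close> changes no spherical derivative,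
  and it yields a function that is sphere-analytic at every point, as the local arguments
  require.\<close>

lemma meromorphic_remove_sings:
  assumes "f meromorphic_on S"
  shows "sphere_analytic_on (remove_sings f) S"
    "\<And>z. z \<in> S \<Longrightarrow> spherical_deriv (\<lambda>w. remove_sings f w ^ N) z = spherical_deriv (\<lambda>w. f w ^ N) z"
    "\<And>z. z \<in> S \<Longrightarrow> spherical_deriv (remove_sings f) z = spherical_deriv f z"
proof -
  show "sphere_analytic_on (remove_sings f) S"
    by (intro nicely_meromorphic_imp_sphere_analytic remove_sings_nicely_meromorphic assms)
  fix z assume "z \<in> S"
  then have "isolated_singularity_at f z"
    using assms meromorphic_on_isolated_singularity meromorphic_on_subset by blast
  then have ev: "eventually (\<lambda>w. remove_sings f w = f w) (at z)"
    by (rule eventually_remove_sings_eq_at)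
  then show "spherical_deriv (remove_sings f) z = spherical_deriv f z"
    by (rule spherical_deriv_cong)
  from ev have "eventually (\<lambda>w. remove_sings f w ^ N = f w ^ N) (at z)"
    by eventually_elim simp
  then show "spherical_deriv (\<lambda>w. remove_sings f w ^ N) z = spherical_deriv (\<lambda>w. f w ^ N) z"
    by (rule spherical_deriv_cong)
qed

lemma spherical_deriv_nonneg:
  assumes "f meromorphic_on {z}"
  shows "spherical_deriv f z \<ge> 0"
  using meromorphic_remove_sings(1,3)[OF assms] spherical_deriv_nonneg_analytic[of "remove_sings f" z] by simp

section \<open>Growth of solutions from growth of the coefficients\<close>

lemma root_le_of_power_bound:
  assumes "k \<ge> 1" "x \<le> B * y ^ k" "y \<ge> 0"
  shows "root k x \<le> root k B * y"
proof -
  have "root k x \<le> root k (B * y ^ k)"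
    using assms by (subst real_root_le_iff) auto
  also have "\<dots> = root k B * y"
    using assms by (simp add: real_root_mult real_root_power_cancel)
  finally show ?thesis .
qed

lemma solution_growth_bound:
  assumes gw: "growth_weight \<Phi>"
    and n: "n \<ge> 1" and m: "\<And>k. k \<in> {1..n} \<Longrightarrow> m k \<le> k * (M + 2)"
    and a: "\<And>k j. k \<in> {1..n} \<Longrightarrow> j \<in> {0..m k} \<Longrightarrow> a k j holomorphic_on ball 0 1"
    and B: "\<And>k j. k \<in> {1..n} \<Longrightarrow> j \<in> {0..m k} \<Longrightarrow> \<exists>B. \<forall>z\<in>ball 0 1. norm (a k j z) \<le> B * \<Phi> z ^ k"
    and sol: "meromorphic_solution n m a f"
  shows "\<exists>B. \<forall>z\<in>ball 0 1. spherical_deriv f z \<le> B * \<Phi> z"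
proof -
  define C where "C = real (Suc M) * real (n * (\<Sum>k=1..n. m k + 1))"
  have C: "C \<ge> 0"
    by (simp only: C_def) (intro mult_nonneg_nonneg of_nat_0_le_iff)
  have mero: "f meromorphic_on ball 0 1"
    using sol by (simp add: meromorphic_solution_def)
  have \<Phi>: "\<Phi> z \<ge> 0" if "z \<in> ball 0 1" for z
    using gw that unfolding growth_weight_def by (meson less_imp_le order_trans)
  define Bd where "Bd k j = (SOME B. \<forall>z\<in>ball 0 1. norm (a k j z) \<le> B * \<Phi> z ^ k)" for k j
  have Bd: "norm (a k j z) \<le> Bd k j * \<Phi> z ^ k" if "k \<in> {1..n}" "j \<in> {0..m k}" "z \<in> ball 0 1" for k j z
    using someI_ex[OF B[OF that(1,2)]] that(3) by (simp add: Bd_def)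
  have "spherical_deriv (\<lambda>w. remove_sings f w ^ Suc M) z \<le> C * (\<Sum>k=1..n. \<Sum>j=0..m k. root k (Bd k j)) * \<Phi> z"
    if z: "z \<in> ball 0 1" for z
  proof -
    have "spherical_deriv (\<lambda>w. f w ^ Suc M) z \<le> C * (\<Sum>k=1..n. \<Sum>j=0..m k. root k (norm (a k j z)))"
      unfolding C_def by (rule meromorphic_solution_spherical_deriv_bound[OF n m a sol z])
    also have "\<dots> \<le> C * (\<Sum>k=1..n. \<Sum>j=0..m k. root k (Bd k j) * \<Phi> z)"
      using C Bd[OF _ _ z] \<Phi>[OF z] by (intro mult_left_mono sum_mono root_le_of_power_bound) auto
    also have "\<dots> = C * (\<Sum>k=1..n. \<Sum>j=0..m k. root k (Bd k j)) * \<Phi> z"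
      by (simp only: sum_distrib_right[symmetric] mult.assoc)
    finally show ?thesis
      by (simp only: meromorphic_remove_sings(2)[OF mero z])
  qed
  from growth_bound_of_power[OF gw meromorphic_remove_sings(1)[OF mero] _ this]
  show ?thesis
    using meromorphic_remove_sings(3)[OF mero] by auto
qed

lemma solution_growth_small:
  assumes gw: "growth_weight \<Phi>"
    and n: "n \<ge> 1" and m: "\<And>k. k \<in> {1..n} \<Longrightarrow> m k \<le> k * (M + 2)"
    and a: "\<And>k j. k \<in> {1..n} \<Longrightarrow> j \<in> {0..m k} \<Longrightarrow> a k j holomorphic_on ball 0 1"
    and small: "\<And>k j \<epsilon>. k \<in> {1..n} \<Longrightarrow> j \<in> {0..m k} \<Longrightarrow> \<epsilon> > 0 \<Longrightarrow>
      eventually (\<lambda>z. norm (a k j z) \<le> \<epsilon> * \<Phi> z ^ k) to_unit_circle"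
    and sol: "meromorphic_solution n m a f" and \<epsilon>: "\<epsilon> > 0"
  shows "eventually (\<lambda>z. spherical_deriv f z \<le> \<epsilon> * \<Phi> z) to_unit_circle"
proof -
  define C where "C = real (Suc M) * real (n * (\<Sum>k=1..n. m k + 1))"
  have C: "C \<ge> 0"
    by (simp only: C_def) (intro mult_nonneg_nonneg of_nat_0_le_iff)
  have mero: "f meromorphic_on ball 0 1"
    using sol by (simp add: meromorphic_solution_def)
  have \<Phi>: "\<Phi> z \<ge> 0" if "z \<in> ball 0 1" for z
    using gw that unfolding growth_weight_def by (meson less_imp_le order_trans)
  have "eventually (\<lambda>z. spherical_deriv (\<lambda>w. remove_sings f w ^ Suc M) z \<le> \<delta> * \<Phi> z) to_unit_circle"
    if \<delta>: "\<delta> > 0" for \<delta>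
  proof -
    \<comment> \<open>C times the number of pairs (k, j); adding 1 makes division by
      \<open>D\<close> possible.\<close>
    define D where "D = C * (\<Sum>k=1..n. \<Sum>j=0..m k. 1) + 1"
    have D: "D > 0"
      using C by (simp add: D_def add_nonneg_pos sum_nonneg)
    define e where "e = \<delta> / D"
    have e: "e > 0"
      using \<delta> D by (simp add: e_def)
    \<comment> \<open>Smallness is requested with the constant e^k, so that the k-th root of the
      coefficient is at most e \<Phi> for every k.\<close>
    have "eventually (\<lambda>z. \<forall>k\<in>{1..n}. \<forall>j\<in>{0..m k}. norm (a k j z) \<le> e ^ k * \<Phi> z ^ k) to_unit_circle"
      using small e by (intro eventually_ball_finite ballI) auto
    then show ?thesis
      using eventually_in_disc
    proof eventually_elim
      case (elim z)
      note z = elim(2)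
      have "spherical_deriv (\<lambda>w. f w ^ Suc M) z \<le> C * (\<Sum>k=1..n. \<Sum>j=0..m k. root k (norm (a k j z)))"
        unfolding C_def by (rule meromorphic_solution_spherical_deriv_bound[OF n m a sol z])
      also have "\<dots> \<le> C * (\<Sum>k=1..n. \<Sum>j=0..m k. 1 * (e * \<Phi> z))"
      proof (intro mult_left_mono sum_mono C)
        fix k j assume kj: "k \<in> {1..n}" "j \<in> {0..m k}"
        then have "root k (norm (a k j z)) \<le> root k (e ^ k) * \<Phi> z"
          using elim(1) \<Phi>[OF z] by (intro root_le_of_power_bound) auto
        then show "root k (norm (a k j z)) \<le> 1 * (e * \<Phi> z)"
          using kj e by (simp add: real_root_power_cancel)
      qed
      also have "\<dots> = (D - 1) * e * \<Phi> z"
        by (simp only: D_def sum_distrib_right[symmetric] mult.assoc) simp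
      also have "\<dots> \<le> D * e * \<Phi> z"
        using e \<Phi>[OF z] by (intro mult_right_mono) auto
      also have "\<dots> = \<delta> * \<Phi> z"
        using D by (simp add: e_def)
      finally show ?case
        by (simp only: meromorphic_remove_sings(2)[OF mero z])
    qed
  qed
  from growth_small_of_power[OF gw meromorphic_remove_sings(1)[OF mero] _ this \<epsilon>]
  have "eventually (\<lambda>z. spherical_deriv (remove_sings f) z \<le> \<epsilon> * \<Phi> z) to_unit_circle"
    by simp
  then show ?thesis
    using eventually_in_disc
    by eventually_elim (simp add: meromorphic_remove_sings(3)[OF mero])
qed

section \<open>Energy conditions\<close>

lemma root_square_eq_powr:
  assumes "k \<ge> 1" "x \<ge> 0"
  shows "(root k x)\<^sup>2 = x powr (2 / real k)"
proof (cases "x = 0")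
  case False
  then have "root k x = x powr (1 / real k)"
    using assms by (intro root_powr_inverse) auto
  then show ?thesis
    by (simp add: power2_eq_square flip: powr_add)
qed (use assms in simp)

lemma nn_integral_area_measure:
  assumes "q \<in> borel_measurable borel"
  shows "(\<integral>\<^sup>+z. q z \<partial>area_measure) = ennreal (1 / pi) * (\<integral>\<^sup>+z. q z \<partial>lborel)"
  unfolding area_measure_def using assms by (intro nn_integral_scale_measure) simp

lemma AE_area_measure:
  assumes "AE z in lborel. P z"
  shows "AE z in area_measure. P z"
proof -
  obtain N where N: "N \<in> sets lborel" "emeasure lborel N = 0" "{z \<in> space lborel. \<not> P z} \<subseteq> N"
    using assms by (auto elim: AE_E)
  then show ?thesis
    by (intro AE_I[of _ _ N]) (auto simp: area_measure_def space_scale_measure)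
qed

lemma borel_measurable_indicator_continuous:
  fixes q :: "complex \<Rightarrow> real"
  assumes "continuous_on (ball 0 1) q" and [measurable]: "W \<in> borel_measurable borel"
  shows "(\<lambda>z. ennreal (q z * W z) * indicator (ball 0 1) z) \<in> borel_measurable borel"
proof -
  have [measurable]: "(\<lambda>z. indicator (ball 0 1) z *\<^sub>R q z) \<in> borel_measurable borel"
    using assms by (intro borel_measurable_continuous_on_indicator) auto
  have "(\<lambda>z. ennreal ((indicator (ball 0 1) z *\<^sub>R q z) * W z)) \<in> borel_measurable borel"
    by measurable
  moreover have "(\<lambda>z. ennreal ((indicator (ball 0 1) z *\<^sub>R q z) * W z)) =
      (\<lambda>z. ennreal (q z * W z) * indicator (ball 0 1) z)"
    by (auto simp: indicator_def)
  ultimately show ?thesis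
    by simp
qed

lemma continuous_on_spherical_deriv:
  assumes "f meromorphic_on ball 0 1"
  shows "continuous_on (ball 0 1) (spherical_deriv f)"
proof -
  have "continuous_on (ball 0 1) (spherical_deriv (remove_sings f))"
    using meromorphic_remove_sings(1)[OF assms] spherical_deriv_isCont
    by (auto simp: sphere_analytic_on_def intro!: continuous_at_imp_continuous_on)
  then show ?thesis
    by (rule continuous_on_eq) (rule meromorphic_remove_sings(3)[OF assms])
qed

lemma continuous_on_norm_powr:
  assumes "g holomorphic_on ball 0 1" "p > 0"
  shows "continuous_on (ball 0 1) (\<lambda>z. norm (g z) powr p)"
  using assms by (intro continuous_on_powr' continuous_intros holomorphic_on_imp_continuous_on) auto

text \<open>Squaring the pointwise estimate turns k-th roots into the exponents 2/k of the
  hypotheses. The weight is the Green function, with pole \<open>b\<close>, of the pseudohyperbolic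
  disc of radius exp R about \<open>b\<close>: R = 0 serves UBC, b = 0 and R = ln s serve radial
  weights. \<open>K\<close> and \<open>C\<close> are fixed before \<open>b\<close> and
  \<open>R\<close>.\<close>

lemma solution_energy_bound:
  assumes n: "n \<ge> 1" and m: "\<And>k. k \<in> {1..n} \<Longrightarrow> m k \<le> k * (M + 2)"
    and a: "\<And>k j. k \<in> {1..n} \<Longrightarrow> j \<in> {0..m k} \<Longrightarrow> a k j holomorphic_on ball 0 1"
    and sol: "meromorphic_solution n m a f"
  obtains K C where "\<And>b R. b \<in> ball 0 1 \<Longrightarrow> R \<le> 0 \<Longrightarrow>
    (\<integral>\<^sup>+z\<in>ball 0 1. ennreal ((spherical_deriv f z)\<^sup>2 * max 0 (R - ln (norm (disc_aut b z)))) \<partial>lborel) \<le>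
    ennreal K * (\<Sum>(k, j)\<in>Sigma {1..n} (\<lambda>k. {0..m k}). \<integral>\<^sup>+z\<in>ball 0 1.
      ennreal (norm (a k j z) powr (2 / real k) * max 0 (R - ln (norm (disc_aut b z)))) \<partial>lborel) + ennreal C"
proof
  define C where "C = real (Suc M) * real (n * (\<Sum>k=1..n. m k + 1))"
  have C: "C \<ge> 0"
    by (simp only: C_def) (intro mult_nonneg_nonneg of_nat_0_le_iff)
  define I where "I = Sigma {1..n} (\<lambda>k. {0..m k})"
  define K where "K = C\<^sup>2 * real (card I)"
  have mero: "f meromorphic_on ball 0 1"
    using sol by (simp add: meromorphic_solution_def)
  define f0 where "f0 = remove_sings f"
  note f0 = meromorphic_remove_sings[OF mero, folded f0_def]
  have bound: "(spherical_deriv (\<lambda>w. f0 w ^ Suc M) z)\<^sup>2 \<le> K * (\<Sum>(k, j)\<in>I. norm (a k j z) powr (2 / real k))"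
    if z: "z \<in> ball 0 1" for z
  proof -
    have "spherical_deriv (\<lambda>w. f w ^ Suc M) z \<le> C * (\<Sum>k=1..n. \<Sum>j=0..m k. root k (norm (a k j z)))"
      unfolding C_def by (rule meromorphic_solution_spherical_deriv_bound[OF n m a sol z])
    also have "(\<Sum>k=1..n. \<Sum>j=0..m k. root k (norm (a k j z))) = (\<Sum>(k, j)\<in>I. root k (norm (a k j z)))"
      unfolding I_def by (intro sum.Sigma) auto
    finally have 1: "spherical_deriv (\<lambda>w. f0 w ^ Suc M) z \<le> C * (\<Sum>(k, j)\<in>I. root k (norm (a k j z)))"
      by (simp only: f0(2)[OF z])
    have "sphere_analytic_on (\<lambda>w. f0 w ^ Suc M) {z}"
      by (rule sphere_analytic_on_subset[OF sphere_analytic_on_power[OF f0(1)]]) (use z in simp)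
    then have 0: "0 \<le> spherical_deriv (\<lambda>w. f0 w ^ Suc M) z"
      by (rule spherical_deriv_nonneg_analytic)
    have "(spherical_deriv (\<lambda>w. f0 w ^ Suc M) z)\<^sup>2 \<le> (C * (\<Sum>(k, j)\<in>I. root k (norm (a k j z))))\<^sup>2"
      using 1 0 by (rule power_mono)
    also have "\<dots> = C\<^sup>2 * (\<Sum>(k, j)\<in>I. root k (norm (a k j z)))\<^sup>2"
      by (rule power_mult_distrib)
    \<comment> \<open>Cauchy-Schwarz; it contributes the number of pairs to
      \<open>K\<close>.\<close>
    also have "\<dots> \<le> C\<^sup>2 * ((\<Sum>p\<in>I. (case p of (k, j) \<Rightarrow> root k (norm (a k j z)))\<^sup>2) * real (card I))"
      using sum_squared_le_sum_of_squares[of "\<lambda>(k, j). root k (norm (a k j z))" I]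
      by (intro mult_left_mono) (auto simp: I_def)
    also have "(\<Sum>p\<in>I. (case p of (k, j) \<Rightarrow> root k (norm (a k j z)))\<^sup>2) = (\<Sum>(k, j)\<in>I. norm (a k j z) powr (2 / real k))"
      by (intro sum.cong) (auto simp: I_def root_square_eq_powr)
    finally show ?thesis
      by (simp add: K_def mult_ac)
  qed
  fix b :: complex and R :: real
  assume b: "b \<in> ball 0 1" and R: "R \<le> 0"
  define W where "W z = max 0 (R - ln (norm (disc_aut b z)))" for z
  have W[measurable]: "W \<in> borel_measurable borel"
    unfolding W_def disc_aut_def by measurable
  have W0: "W z \<ge> 0" for z
    by (simp add: W_def)
  have "(\<integral>\<^sup>+z\<in>ball 0 1. ennreal ((spherical_deriv f z)\<^sup>2 * W z) \<partial>lborel) \<le>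
      (\<integral>\<^sup>+z\<in>ball 0 1. ennreal (real (Suc M) * (spherical_deriv f0 z)\<^sup>2 * W z) \<partial>lborel)"
  proof (rule nn_integral_mono)
    fix z
    have "1 * ((spherical_deriv f0 z)\<^sup>2 * W z) \<le> real (Suc M) * ((spherical_deriv f0 z)\<^sup>2 * W z)"
      using W0 by (intro mult_right_mono) auto
    then show "ennreal ((spherical_deriv f z)\<^sup>2 * W z) * indicator (ball 0 1) z \<le>
        ennreal (real (Suc M) * (spherical_deriv f0 z)\<^sup>2 * W z) * indicator (ball 0 1) z"
      using f0(3)[of z] by (auto simp: indicator_def mult.assoc intro!: ennreal_leI)
  qed
  also have "\<dots> \<le> (\<integral>\<^sup>+z\<in>ball 0 1. ennreal ((spherical_deriv (\<lambda>w. f0 w ^ Suc M) z)\<^sup>2 * W z) \<partial>lborel)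
      + ennreal (pi * (real (Suc M) * ln 2))"
    unfolding W_def by (rule disc_inequality[OF f0(1) _ b R]) simp
  also have "(\<integral>\<^sup>+z\<in>ball 0 1. ennreal ((spherical_deriv (\<lambda>w. f0 w ^ Suc M) z)\<^sup>2 * W z) \<partial>lborel) \<le>
      (\<integral>\<^sup>+z. ennreal K * (\<Sum>(k, j)\<in>I. ennreal (norm (a k j z) powr (2 / real k) * W z) * indicator (ball 0 1) z) \<partial>lborel)"
  proof (rule nn_integral_mono)
    fix z
    show "ennreal ((spherical_deriv (\<lambda>w. f0 w ^ Suc M) z)\<^sup>2 * W z) * indicator (ball 0 1) z \<le>
        ennreal K * (\<Sum>(k, j)\<in>I. ennreal (norm (a k j z) powr (2 / real k) * W z) * indicator (ball 0 1) z)"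
    proof (cases "z \<in> ball 0 1")
      case True
      have "(spherical_deriv (\<lambda>w. f0 w ^ Suc M) z)\<^sup>2 * W z \<le>
          K * (\<Sum>(k, j)\<in>I. norm (a k j z) powr (2 / real k)) * W z"
        using W0 by (intro mult_right_mono bound[OF True])
      also have "\<dots> = K * (\<Sum>(k, j)\<in>I. norm (a k j z) powr (2 / real k) * W z)"
        by (simp add: sum_distrib_right mult.assoc case_prod_beta)
      finally have "ennreal ((spherical_deriv (\<lambda>w. f0 w ^ Suc M) z)\<^sup>2 * W z) \<le>
          ennreal (K * (\<Sum>(k, j)\<in>I. norm (a k j z) powr (2 / real k) * W z))"
        by (rule ennreal_leI)
      also have "\<dots> = ennreal K * (\<Sum>(k, j)\<in>I. ennreal (norm (a k j z) powr (2 / real k) * W z))"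
        using W0 C by (subst ennreal_mult) (auto simp: K_def case_prod_beta intro!: sum_nonneg)
      finally show ?thesis
        using True by simp
    qed simp
  qed
  also have "\<dots> = ennreal K * (\<Sum>(k, j)\<in>I. \<integral>\<^sup>+z\<in>ball 0 1. ennreal (norm (a k j z) powr (2 / real k) * W z) \<partial>lborel)"
  proof -
    have meas: "(\<lambda>z. ennreal (norm (a k j z) powr (2 / real k) * W z) * indicator (ball 0 1) z) \<in> borel_measurable lborel"
      if "(k, j) \<in> I" for k j
      using that borel_measurable_indicator_continuous[OF continuous_on_norm_powr[OF a[of k j]] W, of "2 / real k"]
      by (auto simp: I_def)
    show ?thesis
      using meas by (subst nn_integral_cmult) (auto simp: case_prod_beta nn_integral_sum intro!: borel_measurable_sum)
  qed
  finally show "(\<integral>\<^sup>+z\<in>ball 0 1. ennreal ((spherical_deriv f z)\<^sup>2 * max 0 (R - ln (norm (disc_aut b z)))) \<partial>lborel) \<le>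
    ennreal K * (\<Sum>(k, j)\<in>Sigma {1..n} (\<lambda>k. {0..m k}). \<integral>\<^sup>+z\<in>ball 0 1.
      ennreal (norm (a k j z) powr (2 / real k) * max 0 (R - ln (norm (disc_aut b z)))) \<partial>lborel)
      + ennreal (pi * (real (Suc M) * ln 2))"
    by (simp add: W_def I_def add_right_mono)
qed

section \<open>Radial weights as averages of Green functions\<close>

lemma radial_weight_representation:
  assumes "radial_weight \<omega>"
  obtains w :: "real \<Rightarrow> ennreal" where "w \<in> borel_measurable borel" "\<And>s. s \<notin> {0<..<1} \<Longrightarrow> w s = 0"
    "(\<integral>\<^sup>+s. w s \<partial>lborel) < \<infinity>" "\<And>z. 0 < norm z \<Longrightarrow> norm z < 1 \<Longrightarrow> weight_star \<omega> z \<ge> 0"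
    "\<And>z. 0 < norm z \<Longrightarrow> norm z < 1 \<Longrightarrow>
       ennreal (weight_star \<omega> z) = (\<integral>\<^sup>+s. w s * ennreal (s * max 0 (ln s - ln (norm z))) \<partial>lborel)"
proof -
  define g where "g = (\<lambda>s. indicator {0<..<1} s *\<^sub>R \<omega> s)"
  have g0: "g s \<ge> 0" for s
    using assms by (auto simp: g_def radial_weight_def indicator_def)
  have gint: "integrable lebesgue g"
    using assms by (simp add: g_def radial_weight_def set_integrable_def)
  then have gm[measurable]: "g \<in> borel_measurable lebesgue"
    by (rule borel_measurable_integrable)
  have "(\<lambda>s. ennreal (g s)) \<in> borel_measurable lebesgue"
    by measurable
  \<comment> \<open>\<open>\<omega>\<close> is only Lebesgue measurable, while Fubini's theorem is
    later applied to Borel functions; \<open>w\<close> is a Borel version, cut off to (0,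
    1).\<close>
  then obtain g' where g': "g' \<in> borel_measurable lborel" "AE s in lborel. ennreal (g s) = g' s"
    using completion_ex_borel_measurable by blast
  define w where "w = (\<lambda>s. g' s * indicator {0<..<1} s)"
  have [measurable]: "g' \<in> borel_measurable borel"
    using g'(1) by simp
  have w[measurable]: "w \<in> borel_measurable borel"
    unfolding w_def by measurable
  have gw: "AE s in lborel. ennreal (g s) = w s"
    using g'(2) by eventually_elim (auto simp: w_def g_def indicator_def)
  have fin: "(\<integral>\<^sup>+s. w s \<partial>lborel) < \<infinity>"
  proof -
    have "(\<integral>\<^sup>+s. w s \<partial>lborel) = (\<integral>\<^sup>+s. ennreal (g s) \<partial>lborel)"
      using gw by (intro nn_integral_cong_AE) (auto elim: eventually_mono)
    also have "\<dots> = (\<integral>\<^sup>+s. ennreal (g s) \<partial>lebesgue)"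
      by (simp add: nn_integral_completion)
    also have "\<dots> < \<infinity>"
      using gint g0 by (simp add: integrable_iff_bounded)
    finally show ?thesis .
  qed
  have star: "weight_star \<omega> z \<ge> 0"
    "ennreal (weight_star \<omega> z) = (\<integral>\<^sup>+s. w s * ennreal (s * max 0 (ln s - ln (norm z))) \<partial>lborel)"
    if z: "0 < norm z" "norm z < 1" for z :: complex
  proof -
    \<comment> \<open>The kernel lies between 0 and ln (1 / |z|), so its product with the weight is
      integrable and \<open>weight_star\<close> is a genuine integral, not the default value
      0.\<close>
    define c where "c s = indicator {norm z<..<1} s * (ln (s / norm z) * s)" for s
    have c: "0 \<le> c s" "c s \<le> ln (1 / norm z)" for s
    proof -
      have "0 \<le> ln (s / norm z) * s \<and> ln (s / norm z) * s \<le> ln (1 / norm z) * 1" if s: "norm z < s" "s < 1"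
      proof -
        have "s / norm z \<le> 1 / norm z" "1 \<le> s / norm z"
          using s z by (auto intro: divide_right_mono)
        then have "0 \<le> ln (s / norm z)" "ln (s / norm z) \<le> ln (1 / norm z)"
          using s z by (auto simp only: ln_ge_zero intro!: iffD2[OF ln_le_cancel_iff] divide_pos_pos)
        then show ?thesis
          using s z le_less_trans[OF norm_ge_zero s(1)] by (intro conjI mult_mono mult_nonneg_nonneg) auto
      qed
      moreover have "0 \<le> ln (1 / norm z)"
        using z by (simp add: ln_ge_zero)
      ultimately show "0 \<le> c s" "c s \<le> ln (1 / norm z)"
        by (auto simp: c_def indicator_def)
    qed
    have [measurable]: "c \<in> borel_measurable borel"
      unfolding c_def by measurable
    have [measurable]: "c \<in> borel_measurable lebesgue"
      by (rule measurable_completion) simp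
    have int: "integrable lebesgue (\<lambda>s. g s * c s)"
    proof (rule Bochner_Integration.integrable_bound)
      show "integrable lebesgue (\<lambda>s. g s * ln (1 / norm z))"
        using gint by simp
      show "AE s in lebesgue. norm (g s * c s) \<le> norm (g s * ln (1 / norm z))"
        using c g0 order_trans[OF c] by (auto simp: abs_mult intro!: mult_left_mono AE_I2)
    qed measurable
    have eq: "weight_star \<omega> z = (\<integral>s. g s * c s \<partial>lebesgue)"
      unfolding weight_star_def set_lebesgue_integral_def
      by (intro Bochner_Integration.integral_cong) (use z in \<open>auto simp: g_def c_def indicator_def mult_ac dest: le_less_trans[OF norm_ge_zero]\<close>)
    then show "weight_star \<omega> z \<ge> 0"
      using g0 c by simp
    have "ennreal (weight_star \<omega> z) = (\<integral>\<^sup>+s. ennreal (g s * c s) \<partial>lebesgue)"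
      unfolding eq using g0 c by (intro nn_integral_eq_integral[symmetric] int) auto
    also have "\<dots> = (\<integral>\<^sup>+s. ennreal (g s * c s) \<partial>lborel)"
      by (simp add: nn_integral_completion)
    also have "\<dots> = (\<integral>\<^sup>+s. w s * ennreal (s * max 0 (ln s - ln (norm z))) \<partial>lborel)"
    proof (rule nn_integral_cong_AE)
      show "AE s in lborel. ennreal (g s * c s) = w s * ennreal (s * max 0 (ln s - ln (norm z)))"
        using gw
      proof eventually_elim
        case (elim s)
        have "c s = s * max 0 (ln s - ln (norm z))" if s: "0 < s" "s < 1"
        proof (cases "norm z < s")
          case True
          then have "ln (norm z) < ln s"
            using z s by (subst ln_less_cancel_iff) auto
          then show ?thesis
            using s True z by (simp add: c_def ln_div)
        next
          case False
          then have "ln s \<le> ln (norm z)"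
            using s z by (subst ln_le_cancel_iff) auto
          then show ?thesis
            using False by (simp add: c_def)
        qed
        moreover have "w s = 0 \<and> g s = 0" if "\<not> (0 < s \<and> s < 1)"
          using that by (auto simp: w_def g_def)
        ultimately show ?case
          using elim g0[of s] c[of s] by (cases "0 < s \<and> s < 1") (auto simp: ennreal_mult)
      qed
    qed
    finally show "ennreal (weight_star \<omega> z) = \<dots>" .
  qed
  show ?thesis
    by (rule that[OF w _ fin star]) (auto simp: w_def)
qed

text \<open>Tonelli: \<open>weight_star\<close> is an average over s of the Green functions, with
  pole 0, of the discs |z| < s, so a weighted energy is the same average of Green energies. The
  point 0 is null. \<open>disc_aut 0 z\<close> is -z, written so as to match
  \<open>solution_energy_bound\<close>.\<close>

lemma nn_integral_weight_star:
  fixes w :: "real \<Rightarrow> ennreal" and q :: "complex \<Rightarrow> real"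
  assumes w[measurable]: "w \<in> borel_measurable borel" and w0: "\<And>s. s \<notin> {0<..<1} \<Longrightarrow> w s = 0"
    and star: "\<And>z. 0 < norm z \<Longrightarrow> norm z < 1 \<Longrightarrow> weight_star \<omega> z \<ge> 0"
    "\<And>z. 0 < norm z \<Longrightarrow> norm z < 1 \<Longrightarrow>
       ennreal (weight_star \<omega> z) = (\<integral>\<^sup>+s. w s * ennreal (s * max 0 (ln s - ln (norm z))) \<partial>lborel)"
    and q: "continuous_on (ball 0 1) q" "\<And>z. z \<in> ball 0 1 \<Longrightarrow> q z \<ge> 0"
  shows "(\<integral>\<^sup>+z\<in>ball 0 1. ennreal (q z * weight_star \<omega> z) \<partial>area_measure) =
      (\<integral>\<^sup>+s. ennreal (1 / pi) * (w s * ennreal s *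
         (\<integral>\<^sup>+z\<in>ball 0 1. ennreal (q z * max 0 (ln s - ln (norm (disc_aut 0 z)))) \<partial>lborel)) \<partial>lborel)"
    (is "?L = ?R")
    and "(\<lambda>s. ennreal (1 / pi) * (w s * ennreal s *
         (\<integral>\<^sup>+z\<in>ball 0 1. ennreal (q z * max 0 (ln s - ln (norm (disc_aut 0 z)))) \<partial>lborel))) \<in> borel_measurable borel"
proof -
  define q0 where "q0 = (\<lambda>z. indicator (ball 0 1) z *\<^sub>R q z)"
  have [measurable]: "q0 \<in> borel_measurable borel"
    unfolding q0_def using q by (intro borel_measurable_continuous_on_indicator) auto
  have q0: "q0 z \<ge> 0" for z
    using q(2) by (auto simp: q0_def indicator_def)
  define E where "E s = (\<integral>\<^sup>+z. ennreal (q0 z * max 0 (ln s - ln (norm z))) \<partial>lborel)" for s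
  have [measurable]: "E \<in> borel_measurable borel"
    unfolding E_def by measurable
  have E: "(\<integral>\<^sup>+z\<in>ball 0 1. ennreal (q z * max 0 (ln s - ln (norm (disc_aut 0 z)))) \<partial>lborel) = E s" for s
    unfolding E_def by (intro nn_integral_cong) (auto simp: q0_def indicator_def disc_aut_def)
  show "(\<lambda>s. ennreal (1 / pi) * (w s * ennreal s *
         (\<integral>\<^sup>+z\<in>ball 0 1. ennreal (q z * max 0 (ln s - ln (norm (disc_aut 0 z)))) \<partial>lborel))) \<in> borel_measurable borel"
    unfolding E by measurable
  define ws where "ws z = (\<integral>\<^sup>+s. w s * ennreal (s * max 0 (ln s - ln (norm z))) \<partial>lborel)" for z :: complex
  have [measurable]: "ws \<in> borel_measurable borel"
    unfolding ws_def by measurable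
  have ae: "AE z in lborel. ennreal (q z * weight_star \<omega> z) * indicator (ball 0 1) z = ennreal (q0 z) * ws z"
    using AE_lborel_singleton[of "0 :: complex"]
  proof eventually_elim
    case (elim z)
    then show ?case
      using star[of z] q(2)[of z] by (auto simp: q0_def ws_def indicator_def ennreal_mult)
  qed
  have "?L = (\<integral>\<^sup>+z. ennreal (q0 z) * ws z \<partial>area_measure)"
    using AE_area_measure[OF ae] by (rule nn_integral_cong_AE)
  also have "\<dots> = ennreal (1 / pi) * (\<integral>\<^sup>+z. ennreal (q0 z) * ws z \<partial>lborel)"
    by (rule nn_integral_area_measure) measurable
  also have "(\<integral>\<^sup>+z. ennreal (q0 z) * ws z \<partial>lborel) =
      (\<integral>\<^sup>+z. \<integral>\<^sup>+s. ennreal (q0 z) * (w s * ennreal (s * max 0 (ln s - ln (norm z)))) \<partial>lborel \<partial>lborel)"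
    unfolding ws_def by (intro nn_integral_cong nn_integral_cmult[symmetric]) measurable
  also have "\<dots> = (\<integral>\<^sup>+s. \<integral>\<^sup>+z. ennreal (q0 z) * (w s * ennreal (s * max 0 (ln s - ln (norm z)))) \<partial>lborel \<partial>lborel)"
    by (rule lborel_pair.Fubini') measurable
  also have "\<dots> = (\<integral>\<^sup>+s. w s * ennreal s * E s \<partial>lborel)"
  proof (rule nn_integral_cong)
    fix s :: real
    show "(\<integral>\<^sup>+z. ennreal (q0 z) * (w s * ennreal (s * max 0 (ln s - ln (norm z)))) \<partial>lborel) = w s * ennreal s * E s"
    proof (cases "s \<in> {0<..<1}")
      case True
      have "(\<integral>\<^sup>+z. ennreal (q0 z) * (w s * ennreal (s * max 0 (ln s - ln (norm z)))) \<partial>lborel) =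
          (\<integral>\<^sup>+z. (w s * ennreal s) * ennreal (q0 z * max 0 (ln s - ln (norm z))) \<partial>lborel)"
        using True q0 by (intro nn_integral_cong) (simp add: ennreal_mult mult_ac)
      also have "\<dots> = w s * ennreal s * E s"
        unfolding E_def by (rule nn_integral_cmult) measurable
      finally show ?thesis .
    qed (simp add: w0)
  qed
  also have "ennreal (1 / pi) * \<dots> = (\<integral>\<^sup>+s. ennreal (1 / pi) * (w s * ennreal s * E s) \<partial>lborel)"
    by (rule nn_integral_cmult[symmetric]) measurable
  finally show "?L = ?R"
    by (simp only: E)
qed

section \<open>Coefficient spaces as pointwise bounds\<close>

lemma Hinf_imp_bound:
  assumes "g \<in> Hinf (real k)"
  shows "\<exists>B. \<forall>z\<in>ball 0 1. norm (g z) \<le> B * (1 / (1 - norm z)) ^ k"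
proof -
  obtain B where "\<And>z. z \<in> ball 0 1 \<Longrightarrow> norm (g z) * (1 - norm z) powr real k \<le> B"
    using assms unfolding Hinf_def bdd_above_def by blast
  then have "\<forall>z\<in>ball 0 1. norm (g z) \<le> B * (1 / (1 - norm z)) ^ k"
    by (simp add: powr_realpow power_divide field_simps)
  then show ?thesis ..
qed

lemma Hinf_0_imp_small:
  assumes "g \<in> Hinf_0 (real k)" "\<epsilon> > 0"
  shows "eventually (\<lambda>z. norm (g z) \<le> \<epsilon> * (1 / (1 - norm z)) ^ k) to_unit_circle"
proof -
  have "eventually (\<lambda>z. norm (g z) * (1 - norm z) powr real k < \<epsilon>) to_unit_circle"
    using assms by (auto simp: Hinf_0_def intro: order_tendstoD)
  then show ?thesis
    using eventually_in_disc
    by eventually_elim (simp add: powr_realpow power_divide field_simps)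
qed

lemma Hinf_growth_imp_bound:
  assumes "\<And>r. r \<in> {0..<1} \<Longrightarrow> \<phi> r > 0" "g \<in> Hinf_growth (\<lambda>r. \<phi> r ^ k)"
  shows "\<exists>B. \<forall>z\<in>ball 0 1. norm (g z) \<le> B * \<phi> (norm z) ^ k"
proof -
  obtain B where "\<And>z. z \<in> ball 0 1 \<Longrightarrow> norm (g z) / \<phi> (norm z) ^ k \<le> B"
    using assms(2) unfolding Hinf_growth_def bdd_above_def by blast
  then have "\<forall>z\<in>ball 0 1. norm (g z) \<le> B * \<phi> (norm z) ^ k"
    using assms(1) by (simp add: pos_divide_le_eq)
  then show ?thesis ..
qed

lemma Hinf_growth_0_imp_small:
  assumes "\<And>r. r \<in> {0..<1} \<Longrightarrow> \<phi> r > 0" "g \<in> Hinf_growth_0 (\<lambda>r. \<phi> r ^ k)" "\<epsilon> > 0"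
  shows "eventually (\<lambda>z. norm (g z) \<le> \<epsilon> * \<phi> (norm z) ^ k) to_unit_circle"
proof -
  have "eventually (\<lambda>z. norm (g z) / \<phi> (norm z) ^ k < \<epsilon>) to_unit_circle"
    using assms by (auto simp: Hinf_growth_0_def intro: order_tendstoD)
  then show ?thesis
    using eventually_in_disc
    by eventually_elim (use assms(1) in \<open>simp add: pos_divide_less_eq less_imp_le\<close>)
qed

lemma tendsto_0_to_unit_circleI:
  fixes u :: "complex \<Rightarrow> real"
  assumes "\<And>z. z \<in> ball 0 1 \<Longrightarrow> u z \<ge> 0"
    and "\<And>\<epsilon>. \<epsilon> > 0 \<Longrightarrow> eventually (\<lambda>z. u z \<le> \<epsilon>) to_unit_circle"
  shows "(u \<longlongrightarrow> 0) to_unit_circle"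
proof (rule tendstoI)
  fix e :: real assume "e > 0"
  then have "eventually (\<lambda>z. u z \<le> e / 2) to_unit_circle"
    by (intro assms(2)) simp
  then show "eventually (\<lambda>z. dist (u z) 0 < e) to_unit_circle"
    using eventually_in_disc
  proof eventually_elim
    case (elim z)
    then show ?case
      using assms(1)[OF elim(2)] \<open>e > 0\<close> by (simp add: dist_real_def)
  qed
qed

text \<open>The factor 1 + r \<le> 2 is the cost of passing from 1 - r to the factor 1 - |z|^2 of
  the normal classes.\<close>

lemma one_minus_square_le:
  fixes r :: real
  assumes "0 \<le> r" "r < 1" "s \<le> B * (1 / (1 - r))" "s \<ge> 0"
  shows "s * (1 - r\<^sup>2) \<le> 2 * B"
proof -
  have "s * (1 - r) \<le> B"
    using assms by (simp add: field_simps)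
  then have "s * (1 - r) * (1 + r) \<le> B * (1 + r)"
    using assms by (intro mult_right_mono) auto
  also have "\<dots> \<le> B * 2"
  proof (rule mult_left_mono)
    have "0 \<le> s * (1 - r)"
      using assms by simp
    also note \<open>s * (1 - r) \<le> B\<close>
    finally show "0 \<le> B" .
  qed (use assms in auto)
  finally show ?thesis
    by (simp add: power2_eq_square algebra_simps)
qed

section \<open>The conclusions for the individual classes\<close>

theorem corollary4:
  fixes n M\<^sub>0 :: nat and m :: "nat \<Rightarrow> nat"
    and \<phi> \<omega> :: "real \<Rightarrow> real"
    and a :: "nat \<Rightarrow> nat \<Rightarrow> complex \<Rightarrow> complex"
  assumes n: "n \<ge> 1"
    and M0: "(MAX k\<in>{1..n}. real (m k) / real k) \<le> real M\<^sub>0 + 2"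
    and phi: "smoothly_increasing \<phi>"
    and omega: "radial_weight \<omega>"
    and a: "\<And>k j. k \<in> {1..n} \<Longrightarrow> j \<in> {0..m k} \<Longrightarrow> a k j holomorphic_on ball 0 1"
  shows
    "((\<forall>k\<in>{1..n}. \<forall>j\<in>{0..m k}. a k j \<in> Hinf (real k)) \<longrightarrow>
        (\<forall>f. meromorphic_solution n m a f \<longrightarrow> f \<in> normal_fns)) \<and>
     ((\<forall>k\<in>{1..n}. \<forall>j\<in>{0..m k}. a k j \<in> Hinf_0 (real k)) \<longrightarrow>
        (\<forall>f. meromorphic_solution n m a f \<longrightarrow> f \<in> normal_fns_0)) \<and>
     ((\<forall>k\<in>{1..n}. \<forall>j\<in>{0..m k}. a k j \<in> Hinf_growth (\<lambda>r. \<phi> r ^ k)) \<longrightarrow>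
        (\<forall>f. meromorphic_solution n m a f \<longrightarrow> f \<in> phi_normal_fns \<phi>)) \<and>
     ((\<forall>k\<in>{1..n}. \<forall>j\<in>{0..m k}. a k j \<in> Hinf_growth_0 (\<lambda>r. \<phi> r ^ k)) \<longrightarrow>
        (\<forall>f. meromorphic_solution n m a f \<longrightarrow> f \<in> phi_normal_fns_0 \<phi>)) \<and>
     ((\<forall>k\<in>{1..n}. \<forall>j\<in>{0..m k}. a k j \<in> weighted_bergman (2 / real k) (weight_star \<omega>)) \<longrightarrow>
        (\<forall>f. meromorphic_solution n m a f \<longrightarrow> f \<in> spherical_dirichlet (weight_star \<omega>))) \<and>
     ((\<forall>k\<in>{1..n}. \<forall>j\<in>{0..m k}.
        (SUP b\<in>ball 0 1. \<integral>\<^sup>+z\<in>ball 0 1.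
           ennreal (norm (a k j z) powr (2 / real k) * ln (1 / norm (disc_aut b z))) \<partial>area_measure) < \<infinity>) \<longrightarrow>
        (\<forall>f. meromorphic_solution n m a f \<longrightarrow> f \<in> UBC))"
proof (intro conjI impI allI)
  have m: "m k \<le> k * (M\<^sub>0 + 2)" if k: "k \<in> {1..n}" for k
  proof -
    have "real (m k) / real k \<le> (MAX k\<in>{1..n}. real (m k) / real k)"
      using k by (intro Max_ge) auto
    also note M0
    finally have "real (m k) \<le> real (k * (M\<^sub>0 + 2))"
      using k by (simp add: pos_divide_le_eq algebra_simps)
    then show ?thesis
      by (simp only: of_nat_le_iff)
  qed
  have pos: "\<And>r. r \<in> {0..<1} \<Longrightarrow> \<phi> r > 0"
    using phi by (auto simp: smoothly_increasing_def)
  note gw = growth_weight_smoothly_increasing[OF phi]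
  fix f assume sol: "meromorphic_solution n m a f"
  then have mero: "f meromorphic_on ball 0 1"
    by (simp add: meromorphic_solution_def)
  have nonneg: "spherical_deriv f z \<ge> 0" if "z \<in> ball 0 1" for z
    by (rule spherical_deriv_nonneg, rule meromorphic_on_subset[OF mero]) (use that in simp)
  show "f \<in> normal_fns" if "\<forall>k\<in>{1..n}. \<forall>j\<in>{0..m k}. a k j \<in> Hinf (real k)"
  proof -
    have "\<exists>B. \<forall>z\<in>ball 0 1. norm (a k j z) \<le> B * (1 / (1 - norm z)) ^ k"
      if "k \<in> {1..n}" "j \<in> {0..m k}" for k j
      using \<open>\<forall>k\<in>{1..n}. \<forall>j\<in>{0..m k}. a k j \<in> Hinf (real k)\<close> that by (intro Hinf_imp_bound) blast
    from solution_growth_bound[OF growth_weight_disc n m a this sol]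
    obtain B where "\<And>z. z \<in> ball 0 1 \<Longrightarrow> spherical_deriv f z \<le> B * (1 / (1 - norm z))"
      by blast
    then have "spherical_deriv f z * (1 - (norm z)\<^sup>2) \<le> 2 * B" if "z \<in> ball 0 1" for z
      using that nonneg[OF that] by (intro one_minus_square_le) auto
    then show ?thesis
      using mero unfolding normal_fns_def bdd_above_def by blast
  qed
  show "f \<in> normal_fns_0" if "\<forall>k\<in>{1..n}. \<forall>j\<in>{0..m k}. a k j \<in> Hinf_0 (real k)"
  proof -
    have "eventually (\<lambda>z. norm (a k j z) \<le> \<epsilon> * (1 / (1 - norm z)) ^ k) to_unit_circle"
      if "k \<in> {1..n}" "j \<in> {0..m k}" "\<epsilon> > 0" for k j \<epsilon>
      using \<open>\<forall>k\<in>{1..n}. \<forall>j\<in>{0..m k}. a k j \<in> Hinf_0 (real k)\<close> that by (intro Hinf_0_imp_small) blast+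
    note small = solution_growth_small[OF growth_weight_disc n m a this sol]
    have "((\<lambda>z. spherical_deriv f z * (1 - (norm z)\<^sup>2)) \<longlongrightarrow> 0) to_unit_circle"
    proof (rule tendsto_0_to_unit_circleI)
      show "spherical_deriv f z * (1 - (norm z)\<^sup>2) \<ge> 0" if "z \<in> ball 0 1" for z
        using nonneg[OF that] that by (intro mult_nonneg_nonneg) (auto simp: power_le_one)
      fix \<epsilon> :: real assume "\<epsilon> > 0"
      \<comment> \<open>Half of \<epsilon>, because of the factor 2 in
        \<open>one_minus_square_le\<close>.\<close>
      then have "eventually (\<lambda>z. spherical_deriv f z \<le> (\<epsilon> / 2) * (1 / (1 - norm z))) to_unit_circle"
        by (intro small) auto
      then show "eventually (\<lambda>z. spherical_deriv f z * (1 - (norm z)\<^sup>2) \<le> \<epsilon>) to_unit_circle"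
        using eventually_in_disc
      proof eventually_elim
        case (elim z)
        then show ?case
          using one_minus_square_le[OF _ _ elim(1)] nonneg[OF elim(2)] by simp
      qed
    qed
    then show ?thesis
      using mero by (simp add: normal_fns_0_def)
  qed
  show "f \<in> phi_normal_fns \<phi>" if "\<forall>k\<in>{1..n}. \<forall>j\<in>{0..m k}. a k j \<in> Hinf_growth (\<lambda>r. \<phi> r ^ k)"
  proof -
    have "\<exists>B. \<forall>z\<in>ball 0 1. norm (a k j z) \<le> B * \<phi> (norm z) ^ k"
      if "k \<in> {1..n}" "j \<in> {0..m k}" for k j
      using \<open>\<forall>k\<in>{1..n}. \<forall>j\<in>{0..m k}. a k j \<in> Hinf_growth (\<lambda>r. \<phi> r ^ k)\<close> that
      by (intro Hinf_growth_imp_bound pos) auto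
    from solution_growth_bound[OF gw n m a this sol]
    obtain B where "\<And>z. z \<in> ball 0 1 \<Longrightarrow> spherical_deriv f z \<le> B * \<phi> (norm z)"
      by blast
    then have "spherical_deriv f z / \<phi> (norm z) \<le> B" if "z \<in> ball 0 1" for z
      using that pos[of "norm z"] by (simp add: pos_divide_le_eq)
    then show ?thesis
      using mero unfolding phi_normal_fns_def bdd_above_def by blast
  qed
  show "f \<in> phi_normal_fns_0 \<phi>" if "\<forall>k\<in>{1..n}. \<forall>j\<in>{0..m k}. a k j \<in> Hinf_growth_0 (\<lambda>r. \<phi> r ^ k)"
  proof -
    have "eventually (\<lambda>z. norm (a k j z) \<le> \<epsilon> * \<phi> (norm z) ^ k) to_unit_circle"
      if "k \<in> {1..n}" "j \<in> {0..m k}" "\<epsilon> > 0" for k j \<epsilon>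
      using \<open>\<forall>k\<in>{1..n}. \<forall>j\<in>{0..m k}. a k j \<in> Hinf_growth_0 (\<lambda>r. \<phi> r ^ k)\<close> that
      by (intro Hinf_growth_0_imp_small pos) auto
    note small = solution_growth_small[OF gw n m a this sol]
    have "((\<lambda>z. spherical_deriv f z / \<phi> (norm z)) \<longlongrightarrow> 0) to_unit_circle"
    proof (rule tendsto_0_to_unit_circleI)
      show "spherical_deriv f z / \<phi> (norm z) \<ge> 0" if "z \<in> ball 0 1" for z
        using nonneg[OF that] pos[of "norm z"] that by simp
      fix \<epsilon> :: real assume "\<epsilon> > 0"
      then have "eventually (\<lambda>z. spherical_deriv f z \<le> \<epsilon> * \<phi> (norm z)) to_unit_circle"
        by (intro small) auto
      then show "eventually (\<lambda>z. spherical_deriv f z / \<phi> (norm z) \<le> \<epsilon>) to_unit_circle"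
        using eventually_in_disc
      proof eventually_elim
        case (elim z)
        then show ?case
          using pos[of "norm z"] by (simp add: pos_divide_le_eq)
      qed
    qed
    then show ?thesis
      using mero by (simp add: phi_normal_fns_0_def)
  qed
  let ?I = "Sigma {1..n} (\<lambda>k. {0..m k})"
  obtain K C where energy: "\<And>b R. b \<in> ball 0 1 \<Longrightarrow> R \<le> 0 \<Longrightarrow>
    (\<integral>\<^sup>+z\<in>ball 0 1. ennreal ((spherical_deriv f z)\<^sup>2 * max 0 (R - ln (norm (disc_aut b z)))) \<partial>lborel) \<le>
    ennreal K * (\<Sum>(k, j)\<in>?I. \<integral>\<^sup>+z\<in>ball 0 1.
      ennreal (norm (a k j z) powr (2 / real k) * max 0 (R - ln (norm (disc_aut b z)))) \<partial>lborel) + ennreal C"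
    using solution_energy_bound[OF n m a sol] by blast
  have contf: "continuous_on (ball 0 1) (\<lambda>z. (spherical_deriv f z)\<^sup>2)"
    by (intro continuous_intros continuous_on_spherical_deriv mero)
  have conta: "continuous_on (ball 0 1) (\<lambda>z. norm (a k j z) powr (2 / real k))" if "(k, j) \<in> ?I" for k j
    using that by (intro continuous_on_norm_powr a) auto
  show "f \<in> spherical_dirichlet (weight_star \<omega>)"
    if hyp: "\<forall>k\<in>{1..n}. \<forall>j\<in>{0..m k}. a k j \<in> weighted_bergman (2 / real k) (weight_star \<omega>)"
  proof -
    obtain w where w: "w \<in> borel_measurable borel" "\<And>s. s \<notin> {0<..<1} \<Longrightarrow> w s = 0"
      and fin: "(\<integral>\<^sup>+s. w s \<partial>lborel) < \<infinity>"
      and star: "\<And>z. 0 < norm z \<Longrightarrow> norm z < 1 \<Longrightarrow> weight_star \<omega> z \<ge> 0"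
        "\<And>z. 0 < norm z \<Longrightarrow> norm z < 1 \<Longrightarrow>
           ennreal (weight_star \<omega> z) = (\<integral>\<^sup>+s. w s * ennreal (s * max 0 (ln s - ln (norm z))) \<partial>lborel)"
      using radial_weight_representation[OF omega] by blast
    have [measurable]: "w \<in> borel_measurable borel"
      by (rule w)
    define E where "E k j s = (\<integral>\<^sup>+z\<in>ball 0 1.
      ennreal (norm (a k j z) powr (2 / real k) * max 0 (ln s - ln (norm (disc_aut 0 z)))) \<partial>lborel)" for k j s
    define J where "J k j s = ennreal (1 / pi) * (w s * ennreal s * E k j s)" for k j s
    have swap: "(\<integral>\<^sup>+z\<in>ball 0 1. ennreal (q z * weight_star \<omega> z) \<partial>area_measure) =
        (\<integral>\<^sup>+s. ennreal (1 / pi) * (w s * ennreal s *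
           (\<integral>\<^sup>+z\<in>ball 0 1. ennreal (q z * max 0 (ln s - ln (norm (disc_aut 0 z)))) \<partial>lborel)) \<partial>lborel)"
      "(\<lambda>s. ennreal (1 / pi) * (w s * ennreal s *
         (\<integral>\<^sup>+z\<in>ball 0 1. ennreal (q z * max 0 (ln s - ln (norm (disc_aut 0 z)))) \<partial>lborel))) \<in> borel_measurable borel"
      if q: "continuous_on (ball 0 1) q" "\<And>z. z \<in> ball 0 1 \<Longrightarrow> q z \<ge> 0" for q
      by (rule nn_integral_weight_star[where \<omega> = \<omega>]; fact w star q)+
    have Jm: "J k j \<in> borel_measurable lborel" if "(k, j) \<in> ?I" for k j
      using swap(2)[OF conta[OF that]] by (simp add: J_def[abs_def] E_def)
    have Jfin: "(\<integral>\<^sup>+s. J k j s \<partial>lborel) < \<infinity>" if kj: "(k, j) \<in> ?I" for k j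
    proof -
      have "(\<integral>\<^sup>+s. J k j s \<partial>lborel) =
          (\<integral>\<^sup>+z\<in>ball 0 1. ennreal (norm (a k j z) powr (2 / real k) * weight_star \<omega> z) \<partial>area_measure)"
        using swap(1)[OF conta[OF kj]] by (simp add: J_def E_def)
      also have "\<dots> < \<infinity>"
        using hyp kj by (auto simp: weighted_bergman_def)
      finally show ?thesis .
    qed
    have "(\<integral>\<^sup>+z\<in>ball 0 1. ennreal ((spherical_deriv f z)\<^sup>2 * weight_star \<omega> z) \<partial>area_measure) =
      (\<integral>\<^sup>+s. ennreal (1 / pi) * (w s * ennreal s *
         (\<integral>\<^sup>+z\<in>ball 0 1. ennreal ((spherical_deriv f z)\<^sup>2 * max 0 (ln s - ln (norm (disc_aut 0 z)))) \<partial>lborel)) \<partial>lborel)"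
      by (rule swap(1)[OF contf]) simp
    \<comment> \<open>For each s in (0, 1) the energy estimate is used with b = 0 and R = ln s. Its
      additive constant is multiplied by s \<le> 1 and by \<open>w s\<close>, and so integrates to
      at most C / pi times the finite mass of \<open>w\<close>.\<close>
    also have "\<dots> \<le> (\<integral>\<^sup>+s. ennreal K * (\<Sum>(k, j)\<in>?I. J k j s) + ennreal (1 / pi) * ennreal C * w s \<partial>lborel)"
    proof (rule nn_integral_mono)
      fix s :: real
      let ?E = "(\<integral>\<^sup>+z\<in>ball 0 1. ennreal ((spherical_deriv f z)\<^sup>2 * max 0 (ln s - ln (norm (disc_aut 0 z)))) \<partial>lborel)"
      show "ennreal (1 / pi) * (w s * ennreal s * ?E) \<le>
          ennreal K * (\<Sum>(k, j)\<in>?I. J k j s) + ennreal (1 / pi) * ennreal C * w s"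
      proof (cases "s \<in> {0<..<1}")
        case True
        then have "?E \<le> ennreal K * (\<Sum>(k, j)\<in>?I. E k j s) + ennreal C"
          using energy[of 0 "ln s"] by (simp add: E_def)
        then have "ennreal (1 / pi) * (w s * ennreal s * ?E) \<le>
            ennreal (1 / pi) * (w s * ennreal s * (ennreal K * (\<Sum>(k, j)\<in>?I. E k j s) + ennreal C))"
          by (intro mult_left_mono) auto
        also have "\<dots> = ennreal K * (\<Sum>(k, j)\<in>?I. J k j s) + ennreal (1 / pi) * ennreal C * (w s * ennreal s)"
          by (simp add: J_def distrib_left sum_distrib_left case_prod_beta mult_ac)
        also have "\<dots> \<le> ennreal K * (\<Sum>(k, j)\<in>?I. J k j s) + ennreal (1 / pi) * ennreal C * (w s * ennreal 1)"
          using True by (intro add_left_mono mult_left_mono ennreal_leI) auto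
        finally show ?thesis
          by simp
      qed (simp add: w)
    qed
    also have "\<dots> = ennreal K * (\<Sum>(k, j)\<in>?I. \<integral>\<^sup>+s. J k j s \<partial>lborel) + ennreal (1 / pi) * ennreal C * (\<integral>\<^sup>+s. w s \<partial>lborel)"
    proof -
      have Jp: "(case p of (k, j) \<Rightarrow> J k j) \<in> borel_measurable lborel" if "p \<in> ?I" for p
        using Jm that by (cases p) auto
      have [measurable]: "(\<lambda>s. \<Sum>p\<in>?I. (case p of (k, j) \<Rightarrow> J k j) s) \<in> borel_measurable lborel"
        using Jp by (rule borel_measurable_sum)
      have "(\<integral>\<^sup>+s. ennreal K * (\<Sum>p\<in>?I. (case p of (k, j) \<Rightarrow> J k j) s) + ennreal (1 / pi) * ennreal C * w s \<partial>lborel) =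
          (\<integral>\<^sup>+s. ennreal K * (\<Sum>p\<in>?I. (case p of (k, j) \<Rightarrow> J k j) s) \<partial>lborel) +
          (\<integral>\<^sup>+s. ennreal (1 / pi) * ennreal C * w s \<partial>lborel)"
        by (rule nn_integral_add) measurable
      also have "(\<integral>\<^sup>+s. ennreal K * (\<Sum>p\<in>?I. (case p of (k, j) \<Rightarrow> J k j) s) \<partial>lborel) =
          ennreal K * (\<integral>\<^sup>+s. (\<Sum>p\<in>?I. (case p of (k, j) \<Rightarrow> J k j) s) \<partial>lborel)"
        by (rule nn_integral_cmult) measurable
      also have "(\<integral>\<^sup>+s. (\<Sum>p\<in>?I. (case p of (k, j) \<Rightarrow> J k j) s) \<partial>lborel) =
          (\<Sum>p\<in>?I. \<integral>\<^sup>+s. (case p of (k, j) \<Rightarrow> J k j) s \<partial>lborel)"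
        using Jp by (rule nn_integral_sum)
      also have "(\<integral>\<^sup>+s. ennreal (1 / pi) * ennreal C * w s \<partial>lborel) = ennreal (1 / pi) * ennreal C * (\<integral>\<^sup>+s. w s \<partial>lborel)"
        by (rule nn_integral_cmult) measurable
      finally show ?thesis
        by (simp only: split_def)
    qed
    also have "\<dots> < \<infinity>"
    proof -
      have "(\<Sum>(k, j)\<in>?I. \<integral>\<^sup>+s. J k j s \<partial>lborel) < \<infinity>"
        unfolding infinity_ennreal_def by (subst ennreal_sum_less_top) (use Jfin in auto)
      then show ?thesis
        using fin by (simp add: ennreal_mult_less_top)
    qed
    finally show ?thesis
      using mero by (simp add: spherical_dirichlet_def)
  qed
  show "f \<in> UBC"
    if hyp: "\<forall>k\<in>{1..n}. \<forall>j\<in>{0..m k}.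
        (SUP b\<in>ball 0 1. \<integral>\<^sup>+z\<in>ball 0 1.
           ennreal (norm (a k j z) powr (2 / real k) * ln (1 / norm (disc_aut b z))) \<partial>area_measure) < \<infinity>"
  proof -
    define A where "A k j b = (\<integral>\<^sup>+z\<in>ball 0 1.
           ennreal (norm (a k j z) powr (2 / real k) * ln (1 / norm (disc_aut b z))) \<partial>area_measure)" for k j b
    have area: "(\<integral>\<^sup>+z\<in>ball 0 1. ennreal (q z * ln (1 / norm (disc_aut b z))) \<partial>area_measure) =
        ennreal (1 / pi) * (\<integral>\<^sup>+z\<in>ball 0 1. ennreal (q z * max 0 (0 - ln (norm (disc_aut b z)))) \<partial>lborel)"
      if q: "continuous_on (ball 0 1) q" and b: "b \<in> ball 0 1" for q b
    proof -
      have "(\<lambda>z. ln (1 / norm (disc_aut b z))) \<in> borel_measurable borel"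
        unfolding disc_aut_def by measurable
      note nn_integral_area_measure[OF borel_measurable_indicator_continuous[OF q this]]
      also have "(\<integral>\<^sup>+z\<in>ball 0 1. ennreal (q z * ln (1 / norm (disc_aut b z))) \<partial>lborel) =
          (\<integral>\<^sup>+z\<in>ball 0 1. ennreal (q z * max 0 (0 - ln (norm (disc_aut b z)))) \<partial>lborel)"
      proof (rule nn_integral_cong)
        fix z
        \<comment> \<open>At the zero of \<open>disc_aut b\<close> both sides are 0 because
          \<open>ln 0 = 0\<close>; elsewhere its modulus is below 1 and the logarithm on the left is
          nonnegative.\<close>
        have "ln (1 / norm (disc_aut b z)) = max 0 (0 - ln (norm (disc_aut b z)))" if "z \<in> ball 0 1"
        proof (cases "disc_aut b z = 0")
          case False
          then show ?thesis
            using disc_aut_in_ball[OF b that] by (simp add: ln_div)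
        qed simp
        then show "ennreal (q z * ln (1 / norm (disc_aut b z))) * indicator (ball 0 1) z =
            ennreal (q z * max 0 (0 - ln (norm (disc_aut b z)))) * indicator (ball 0 1) z"
          by (auto simp: indicator_def)
      qed
      finally show ?thesis .
    qed
    \<comment> \<open>As \<open>K\<close> and \<open>C\<close> do not depend on \<open>b\<close>,
      each coefficient integral can be replaced by its supremum before the supremum on the left is
      taken.\<close>
    have "(SUP b\<in>ball 0 1. \<integral>\<^sup>+z\<in>ball 0 1.
        ennreal ((spherical_deriv f z)\<^sup>2 * ln (1 / norm (disc_aut b z))) \<partial>area_measure) \<le>
      ennreal K * (\<Sum>(k, j)\<in>?I. SUP b\<in>ball 0 1. A k j b) + ennreal (1 / pi) * ennreal C"
    proof (rule SUP_least)
      fix b :: complex assume b: "b \<in> ball 0 1"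
      let ?G = "\<lambda>k j. \<integral>\<^sup>+z\<in>ball 0 1.
        ennreal (norm (a k j z) powr (2 / real k) * max 0 (0 - ln (norm (disc_aut b z)))) \<partial>lborel"
      have "(\<integral>\<^sup>+z\<in>ball 0 1. ennreal ((spherical_deriv f z)\<^sup>2 * ln (1 / norm (disc_aut b z))) \<partial>area_measure) \<le>
          ennreal (1 / pi) * (ennreal K * (\<Sum>(k, j)\<in>?I. ?G k j) + ennreal C)"
        unfolding area[OF contf b] by (intro mult_left_mono energy b) auto
      also have "\<dots> = ennreal K * (\<Sum>(k, j)\<in>?I. ennreal (1 / pi) * ?G k j) + ennreal (1 / pi) * ennreal C"
        by (simp add: distrib_left sum_distrib_left case_prod_beta mult_ac)
      also have "(\<Sum>(k, j)\<in>?I. ennreal (1 / pi) * ?G k j) = (\<Sum>(k, j)\<in>?I. A k j b)"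
        unfolding A_def by (intro sum.cong) (auto simp: area[OF conta b])
      also have "ennreal K * (\<Sum>(k, j)\<in>?I. A k j b) + ennreal (1 / pi) * ennreal C \<le>
          ennreal K * (\<Sum>(k, j)\<in>?I. SUP b\<in>ball 0 1. A k j b) + ennreal (1 / pi) * ennreal C"
        using b by (intro add_right_mono mult_left_mono sum_mono) (auto intro: SUP_upper)
      finally show "(\<integral>\<^sup>+z\<in>ball 0 1. ennreal ((spherical_deriv f z)\<^sup>2 * ln (1 / norm (disc_aut b z))) \<partial>area_measure) \<le>
          ennreal K * (\<Sum>(k, j)\<in>?I. SUP b\<in>ball 0 1. A k j b) + ennreal (1 / pi) * ennreal C" .
    qed
    also have "\<dots> < \<infinity>"
    proof -
      have "(\<Sum>(k, j)\<in>?I. SUP b\<in>ball 0 1. A k j b) < \<infinity>"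
        unfolding infinity_ennreal_def by (subst ennreal_sum_less_top) (use hyp in \<open>auto simp: A_def\<close>)
      then show ?thesis
        by (simp add: ennreal_mult_less_top)
    qed
    finally show ?thesis
      using mero by (simp add: UBC_def)
  qed
qed

end
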